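(* Let $G=\mathbb F_4$ be the free group on generators $g_1,g_2,g_3,g_4$. Define unitaries in the $2\times2$ complex matrices $\mathbb M_2$ by $$v_1=\begin{pmatrix}1&0\\0&-1\end{pmatrix},\quad v_2=\begin{pmatrix}0&1\\1&0\end{pmatrix},\quad v_3=\begin{pmatrix}0&1\\-1&0\end{pmatrix},\quad v_4=\begin{pmatrix}1/2&\sqrt3/2\\-i\sqrt3/2&i/2\end{pmatrix},$$ and let $\beta$ be the action of $G$ on $\mathbb M_2$ determined by $\beta_{g_i}=\mathrm{Ad}(v_i)$, $1\le i\le4$. Let $R$ be the hyperfinite II$_1$ factor, realized as the infinite tensor product of copies of $\mathbb M_2$ (with respect to the normalized trace) indexed by the elements of $\mathbb F_4$, and let $\gamma$ be the Bernoulli action of $\mathbb F_4$ on $R$. Let $M=\mathbb M_2\otimes R$ with the action $\alpha=\beta\otimes\gamma$ of $G$. Then $L(G)$ is singular in $M\rtimes_\alpha G$, while the quasinormalizers of $L(G)$ in $M\rtimes_\alpha G$ generate a von Neumann algebra which is strictly larger than $L(G)$.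
   Context: $M\rtimes_\alpha G$ is the crossed product von Neumann algebra, generated by $M$ and unitaries $u_g$, $g\in G$, with $u_gxu_g^*=\alpha_g(x)$; $L(G)$ is the von Neumann subalgebra generated by $\{u_g\}$. The Bernoulli action permutes the tensor factors by left translation of the index set. An inclusion $B\subseteq P$ of von Neumann algebras is singular if every unitary $u\in P$ with $uBu^*=B$ lies in $B$ (i.e. these unitaries generate $B$). A quasinormalizer of $B$ in $P$ is an element $x\in P$ for which there exist finitely many $x_1,\dots,x_n\in P$ with $xB\subseteq\sum_iBx_i$ and $Bx\subseteq\sum_ix_iB$. *)

theory Defs
  imports "HOL-Analysis.Analysis" "HOL-Library.Poly_Mapping"
begin

section \<open>The Hilbert space of square-summable functions\<close>

typedef 'i ell2 = "{f :: 'i \<Rightarrow> complex. (\<lambda>i. (cmod (f i))\<^sup>2) summable_on UNIV}"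
  morphisms ell2_nth ell2_of
  by (rule exI[of _ "\<lambda>_. 0"]) simp

setup_lifting type_definition_ell2

lemma ell2_add_closed:
  fixes f g :: "'i \<Rightarrow> complex"
  assumes "(\<lambda>i. (cmod (f i))\<^sup>2) summable_on UNIV" "(\<lambda>i. (cmod (g i))\<^sup>2) summable_on UNIV"
  shows "(\<lambda>i. (cmod (f i + g i))\<^sup>2) summable_on UNIV"
proof (rule summable_on_comparison_test)
  show "(\<lambda>i. 2 * ((cmod (f i))\<^sup>2 + (cmod (g i))\<^sup>2)) summable_on UNIV"
    by (intro summable_on_cmult_right summable_on_add assms)
  show "(cmod (f i + g i))\<^sup>2 \<le> 2 * ((cmod (f i))\<^sup>2 + (cmod (g i))\<^sup>2)" for i
  proof -
    have "(cmod (f i + g i))\<^sup>2 \<le> (cmod (f i) + cmod (g i))\<^sup>2"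
      by (intro power_mono norm_triangle_ineq) auto
    also have "\<dots> \<le> 2 * ((cmod (f i))\<^sup>2 + (cmod (g i))\<^sup>2)"
      using sum_squares_bound[of "cmod (f i)" "cmod (g i)"] by (simp add: power2_sum)
    finally show ?thesis .
  qed
qed auto

lemma ell2_scale_closed:
  fixes f :: "'i \<Rightarrow> complex"
  assumes "(\<lambda>i. (cmod (f i))\<^sup>2) summable_on UNIV"
  shows "(\<lambda>i. (cmod (c * f i))\<^sup>2) summable_on UNIV"
  using summable_on_cmult_right[OF assms, of "(cmod c)\<^sup>2"]
  by (simp add: norm_mult power_mult_distrib)

lemma ell2_inner_summable:
  fixes f g :: "'i \<Rightarrow> complex"
  assumes "(\<lambda>i. (cmod (f i))\<^sup>2) summable_on UNIV" "(\<lambda>i. (cmod (g i))\<^sup>2) summable_on UNIV"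
  shows "(\<lambda>i. f i \<bullet> g i) summable_on UNIV"
proof -
  have sum: "(\<lambda>i. (cmod (f i))\<^sup>2 + (cmod (g i))\<^sup>2) summable_on UNIV"
    by (intro summable_on_add assms)
  have bound: "norm (f i \<bullet> g i) \<le> (cmod (f i))\<^sup>2 + (cmod (g i))\<^sup>2" for i
  proof -
    have "norm (f i \<bullet> g i) \<le> cmod (f i) * cmod (g i)"
      using Cauchy_Schwarz_ineq2[of "f i" "g i"] by simp
    also have "\<dots> \<le> (cmod (f i))\<^sup>2 + (cmod (g i))\<^sup>2"
      using sum_squares_bound[of "cmod (f i)" "cmod (g i)"]
        mult_nonneg_nonneg[OF norm_ge_zero[of "f i"] norm_ge_zero[of "g i"]]
      unfolding mult.assoc by linarith
    finally show ?thesis .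
  qed
  have "(\<lambda>i. norm (f i \<bullet> g i)) summable_on UNIV"
    by (rule summable_on_comparison_test[OF sum bound]) auto
  then show ?thesis
    by (rule abs_summable_summable)
qed

lift_definition scaleC :: "complex \<Rightarrow> 'i ell2 \<Rightarrow> 'i ell2" (infixr "*\<^sub>C" 75)
  is "\<lambda>c f i. c * f i"
  by (rule ell2_scale_closed)

text \<open>The inner product below is the real part of the complex inner product
  \<open>\<Sum>i. f i * cnj (g i)\<close>, so that norm, topology, bounded maps and, for complex-linear maps,
  adjoints are those of the complex Hilbert space.\<close>

instantiation ell2 :: (type) real_vector
begin

lift_definition zero_ell2 :: "'a ell2" is "\<lambda>_. 0" by simp
lift_definition plus_ell2 :: "'a ell2 \<Rightarrow> 'a ell2 \<Rightarrow> 'a ell2" is "\<lambda>f g i. f i + g i"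
  by (rule ell2_add_closed)
lift_definition uminus_ell2 :: "'a ell2 \<Rightarrow> 'a ell2" is "\<lambda>f i. - f i" by simp
lift_definition minus_ell2 :: "'a ell2 \<Rightarrow> 'a ell2 \<Rightarrow> 'a ell2" is "\<lambda>f g i. f i - g i"
  subgoal for f g using ell2_add_closed[of f "\<lambda>i. - g i"] by simp
  done
lift_definition scaleR_ell2 :: "real \<Rightarrow> 'a ell2 \<Rightarrow> 'a ell2" is "\<lambda>r f i. r *\<^sub>R f i"
  by (simp add: scaleR_conv_of_real ell2_scale_closed del: norm_scaleR)

instance
proof
  fix x y z :: "'a ell2" and r s :: real
  show "x + y + z = x + (y + z)" by transfer (simp add: add.assoc)
  show "x + y = y + x" by transfer (simp add: add.commute)
  show "0 + x = x" by transfer simp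
  show "- x + x = 0" by transfer simp
  show "x - y = x + - y" by transfer simp
  show "r *\<^sub>R (x + y) = r *\<^sub>R x + r *\<^sub>R y" by transfer (simp add: algebra_simps)
  show "(r + s) *\<^sub>R x = r *\<^sub>R x + s *\<^sub>R x" by transfer (simp add: algebra_simps)
  show "r *\<^sub>R s *\<^sub>R x = (r * s) *\<^sub>R x" by transfer (simp add: algebra_simps)
  show "1 *\<^sub>R x = x" by transfer simp
qed

end

instantiation ell2 :: (type) real_inner
begin

lift_definition inner_ell2 :: "'a ell2 \<Rightarrow> 'a ell2 \<Rightarrow> real"
  is "\<lambda>f g. \<Sum>\<^sub>\<infinity>i. f i \<bullet> g i" .
definition norm_ell2 :: "'a ell2 \<Rightarrow> real" where "norm_ell2 x = sqrt (inner x x)"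
definition dist_ell2 :: "'a ell2 \<Rightarrow> 'a ell2 \<Rightarrow> real" where "dist_ell2 x y = norm (x - y)"
definition sgn_ell2 :: "'a ell2 \<Rightarrow> 'a ell2" where "sgn_ell2 x = x /\<^sub>R norm x"
definition uniformity_ell2 :: "('a ell2 \<times> 'a ell2) filter"
  where "uniformity_ell2 = (INF e\<in>{0<..}. principal {(x, y). dist x y < e})"
definition open_ell2 :: "'a ell2 set \<Rightarrow> bool"
  where "open_ell2 U \<longleftrightarrow> (\<forall>x\<in>U. \<forall>\<^sub>F (x', y) in uniformity. x' = x \<longrightarrow> y \<in> U)"

instance
proof
  fix x y z :: "'a ell2" and r s :: real
  show "dist x y = norm (x - y)" by (rule dist_ell2_def)
  show "sgn x = x /\<^sub>R norm x" by (rule sgn_ell2_def)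
  show "uniformity = (INF e\<in>{0<..}. principal {(x :: 'a ell2, y). dist x y < e})"
    by (rule uniformity_ell2_def)
  show "open U = (\<forall>x\<in>U. \<forall>\<^sub>F (x', y) in uniformity. x' = x \<longrightarrow> y \<in> U)" for U :: "'a ell2 set"
    by (rule open_ell2_def)
  show "x \<bullet> y = y \<bullet> x" by transfer (simp add: inner_commute)
  show "(x + y) \<bullet> z = x \<bullet> z + y \<bullet> z"
    by transfer (simp add: inner_add_left infsum_add ell2_inner_summable)
  show "(r *\<^sub>R x) \<bullet> y = r * (x \<bullet> y)"
    by transfer (simp add: infsum_cmult_right')
  show "0 \<le> x \<bullet> x" by transfer (simp add: infsum_nonneg)
  show "x \<bullet> x = 0 \<longleftrightarrow> x = 0"
  proof transfer
    fix f :: "'a \<Rightarrow> complex" assume *: "(\<lambda>i. (cmod (f i))\<^sup>2) summable_on UNIV"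
    show "(\<Sum>\<^sub>\<infinity>i. f i \<bullet> f i) = 0 \<longleftrightarrow> f = (\<lambda>_. 0)"
    proof
      assume "(\<Sum>\<^sub>\<infinity>i. f i \<bullet> f i) = 0"
      then have "f i \<bullet> f i = 0" for i
        using nonneg_infsum_le_0D[of "\<lambda>i. f i \<bullet> f i" UNIV i] ell2_inner_summable[OF * *] by simp
      then show "f = (\<lambda>_. 0)" by auto
    qed simp
  qed
  show "norm x = sqrt (x \<bullet> x)" by (rule norm_ell2_def)
qed

end


section \<open>Von Neumann algebras of operators\<close>

type_synonym 'i op = "'i ell2 \<Rightarrow> 'i ell2"

definition bounded_op :: "'i op \<Rightarrow> bool" where
  "bounded_op x \<longleftrightarrow> bounded_linear x \<and> (\<forall>c \<xi>. x (c *\<^sub>C \<xi>) = c *\<^sub>C x \<xi>)"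

definition commutant :: "'i op set \<Rightarrow> 'i op set" where
  "commutant S = {x. bounded_op x \<and> (\<forall>y\<in>S. x \<circ> y = y \<circ> x)}"

definition vn_generated :: "'i op set \<Rightarrow> 'i op set" where
  "vn_generated S = commutant (commutant (S \<union> adjoint ` S))"

definition unitary_op :: "'i op \<Rightarrow> bool" where
  "unitary_op u \<longleftrightarrow> bounded_op u \<and> adjoint u \<circ> u = id \<and> u \<circ> adjoint u = id"

definition Ad :: "'i op \<Rightarrow> 'i op \<Rightarrow> 'i op" where
  "Ad u x = u \<circ> x \<circ> adjoint u"

definition singular :: "'i op set \<Rightarrow> 'i op set \<Rightarrow> bool" where
  "singular B P \<longleftrightarrow> B \<subseteq> P \<and> (\<forall>u\<in>P. unitary_op u \<and> Ad u ` B = B \<longrightarrow> u \<in> B)"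

definition quasinormalizers :: "'i op set \<Rightarrow> 'i op set \<Rightarrow> 'i op set" where
  "quasinormalizers B P = {x \<in> P. \<exists>n (y :: nat \<Rightarrow> 'i op). (\<forall>k<n. y k \<in> P) \<and>
     (\<forall>b\<in>B. \<exists>c. (\<forall>k<n. c k \<in> B) \<and> x \<circ> b = (\<lambda>\<xi>. \<Sum>k<n. c k (y k \<xi>))) \<and>
     (\<forall>b\<in>B. \<exists>c. (\<forall>k<n. c k \<in> B) \<and> b \<circ> x = (\<lambda>\<xi>. \<Sum>k<n. y k (c k \<xi>)))}"

definition star_automorphism :: "'i op set \<Rightarrow> ('i op \<Rightarrow> 'i op) \<Rightarrow> bool" where
  "star_automorphism N \<theta> \<longleftrightarrow> bij_betw \<theta> N N \<and>
     (\<forall>x\<in>N. \<forall>y\<in>N. \<theta> (\<lambda>\<xi>. x \<xi> + y \<xi>) = (\<lambda>\<xi>. \<theta> x \<xi> + \<theta> y \<xi>) \<and> \<theta> (x \<circ> y) = \<theta> x \<circ> \<theta> y) \<and>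
     (\<forall>x\<in>N. \<forall>c. \<theta> (\<lambda>\<xi>. c *\<^sub>C x \<xi>) = (\<lambda>\<xi>. c *\<^sub>C \<theta> x \<xi>)) \<and>
     (\<forall>x\<in>N. \<theta> (adjoint x) = adjoint (\<theta> x))"

text \<open>Groups are written additively, in the type class \<open>group_add\<close>, which does not assume
  commutativity.\<close>

definition vn_action :: "'i op set \<Rightarrow> ('g :: group_add \<Rightarrow> 'i op \<Rightarrow> 'i op) \<Rightarrow> bool" where
  "vn_action N \<alpha> \<longleftrightarrow> (\<forall>g. star_automorphism N (\<alpha> g)) \<and>
     (\<forall>x\<in>N. \<alpha> 0 x = x) \<and> (\<forall>g h. \<forall>x\<in>N. \<alpha> (g + h) x = \<alpha> g (\<alpha> h x))"


section \<open>Tensor products and crossed products\<close>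

text \<open>The Hilbert space tensor product of \<open>'i ell2\<close> and \<open>'j ell2\<close> is \<open>('i \<times> 'j) ell2\<close>;
  \<open>amp_left x\<close> is \<open>x \<otimes> 1\<close> and \<open>amp_right y\<close> is \<open>1 \<otimes> y\<close>, acting on the slices of a vector.
  Pitfall: \<open>ell2_of\<close> is unspecified off the square-summable functions.  Its arguments below are
  square-summable whenever \<open>x\<close> and \<open>y\<close> are bounded and, for the crossed product, \<open>\<alpha> g\<close> is
  isometric at \<open>x\<close>, as *-automorphisms are.\<close>

definition amp_left :: "'i op \<Rightarrow> ('i \<times> 'j) op" where
  "amp_left x \<xi> = ell2_of (\<lambda>(i, j). ell2_nth (x (ell2_of (\<lambda>i'. ell2_nth \<xi> (i', j)))) i)"

definition amp_right :: "'j op \<Rightarrow> ('i \<times> 'j) op" where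
  "amp_right y \<xi> = ell2_of (\<lambda>(i, j). ell2_nth (y (ell2_of (\<lambda>j'. ell2_nth \<xi> (i, j')))) j)"

definition tensor_op :: "'i op \<Rightarrow> 'j op \<Rightarrow> ('i \<times> 'j) op" (infixr "\<otimes>\<^sub>o" 70) where
  "x \<otimes>\<^sub>o y = amp_left x \<circ> amp_right y"

definition vn_tensor :: "'i op set \<Rightarrow> 'j op set \<Rightarrow> ('i \<times> 'j) op set" where
  "vn_tensor N1 N2 = vn_generated {x \<otimes>\<^sub>o y | x y. x \<in> N1 \<and> y \<in> N2}"

text \<open>The crossed product of \<open>N\<close>, acting on \<open>H = 'i ell2\<close>, acts on \<open>\<ell>\<^sup>2(G; H) = ('i \<times> 'g) ell2\<close> by
  \<open>(x \<xi>)(g) = \<alpha>\<^bsub>-g\<^esub>(x) \<xi>(g)\<close> and \<open>(u\<^bsub>h\<^esub> \<xi>)(g) = \<xi>(-h + g)\<close>.\<close>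

definition cp_embed ::
  "('g :: group_add \<Rightarrow> 'i op \<Rightarrow> 'i op) \<Rightarrow> 'i op \<Rightarrow> ('i \<times> 'g) op" where
  "cp_embed \<alpha> x \<xi> =
     ell2_of (\<lambda>(i, g). ell2_nth (\<alpha> (- g) x (ell2_of (\<lambda>i'. ell2_nth \<xi> (i', g)))) i)"

definition cp_unitary :: "'g :: group_add \<Rightarrow> ('i \<times> 'g) op" where
  "cp_unitary h \<xi> = ell2_of (\<lambda>(i, g). ell2_nth \<xi> (i, - h + g))"

definition crossed_product ::
  "'i op set \<Rightarrow> ('g :: group_add \<Rightarrow> 'i op \<Rightarrow> 'i op) \<Rightarrow> ('i \<times> 'g) op set" where
  "crossed_product N \<alpha> = vn_generated (cp_embed \<alpha> ` N \<union> range cp_unitary)"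

definition group_vn :: "('i \<times> 'g :: group_add) op set" where
  "group_vn = vn_generated (range cp_unitary)"


section \<open>Matrices and the infinite tensor product\<close>

type_synonym mat2 = "complex^2^2"

definition dagger :: "mat2 \<Rightarrow> mat2" where
  "dagger A = (\<chi> i j. cnj (A $ j $ i))"

definition ntr :: "mat2 \<Rightarrow> complex" where
  "ntr A = trace A / 2"

definition mat_op :: "mat2 \<Rightarrow> 2 op" where
  "mat_op A \<xi> = ell2_of (\<lambda>i. \<Sum>j\<in>UNIV. A $ i $ j * ell2_nth \<xi> j)"

definition M2 :: "2 op set" where
  "M2 = range mat_op"

text \<open>The Pauli matrices form an orthonormal basis of \<open>L\<^sup>2(M\<^sub>2, ntr)\<close> containing the vacuum
  vector \<open>1\<close>.  Hence, for an index set \<open>'g\<close>, the GNS space of the product trace on the infinite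
  tensor product has the orthonormal basis of simple tensors of Pauli matrices, indexed by
  the finitely supported functions \<open>'g \<Rightarrow>\<^sub>0 pauli\<close>, with \<open>Pauli1 = 0\<close> as default value.\<close>

datatype pauli = Pauli1 | PauliX | PauliY | PauliZ

instantiation pauli :: zero
begin
definition zero_pauli :: pauli where "zero_pauli = Pauli1"
instance ..
end

lemma UNIV_pauli: "UNIV = {Pauli1, PauliX, PauliY, PauliZ}"
  using pauli.exhaust by auto

instance pauli :: finite
  by standard (simp add: UNIV_pauli)

fun pauli_mat :: "pauli \<Rightarrow> mat2" where
  "pauli_mat Pauli1 = mat 1"
| "pauli_mat PauliX = vector [vector [0, 1], vector [1, 0]]"
| "pauli_mat PauliY = vector [vector [0, - \<i>], vector [\<i>, 0]]"
| "pauli_mat PauliZ = vector [vector [1, 0], vector [0, - 1]]"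

lemma pauli_orthonormal:
  "ntr (dagger (pauli_mat j) ** pauli_mat k) = (if j = k then 1 else 0)"
  by (cases j; cases k)
    (simp_all add: ntr_def dagger_def trace_def matrix_matrix_mult_def sum_2 mat_def)

text \<open>\<open>site_op g A\<close> is left multiplication by \<open>A\<close> on the tensor factor at \<open>g\<close>.\<close>

definition site_op :: "'g \<Rightarrow> mat2 \<Rightarrow> ('g \<Rightarrow>\<^sub>0 pauli) op" where
  "site_op g A \<xi> = ell2_of (\<lambda>s. \<Sum>k\<in>UNIV.
     ntr (dagger (pauli_mat (Poly_Mapping.lookup s g)) ** A ** pauli_mat k) * ell2_nth \<xi> (Poly_Mapping.update g k s))"

definition hyperfinite_R :: "('g \<Rightarrow>\<^sub>0 pauli) op set" where
  "hyperfinite_R = vn_generated {site_op g A | g A. True}"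

text \<open>\<open>shift_op h\<close> is the unitary moving the tensor factor at \<open>g\<close> to \<open>h + g\<close>
  (recall \<open>lookup (map_key f s) = lookup s \<circ> f\<close> for injective \<open>f\<close>).\<close>

definition shift_op :: "'g :: group_add \<Rightarrow> ('g \<Rightarrow>\<^sub>0 pauli) op" where
  "shift_op h \<xi> = ell2_of (\<lambda>s. ell2_nth \<xi> (Poly_Mapping.map_key (\<lambda>g. h + g) s))"

definition bernoulli :: "'g :: group_add \<Rightarrow> ('g \<Rightarrow>\<^sub>0 pauli) op \<Rightarrow> ('g \<Rightarrow>\<^sub>0 pauli) op" where
  "bernoulli h = Ad (shift_op h)"


section \<open>Free groups\<close>

text \<open>Letters are \<open>(a, True)\<close> for the generator \<open>a\<close> and \<open>(a, False)\<close> for its inverse.\<close>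

type_synonym 'a letter = "'a \<times> bool"

definition inv_letter :: "'a letter \<Rightarrow> 'a letter" where
  "inv_letter l = (fst l, \<not> snd l)"

definition reduced :: "'a letter list \<Rightarrow> bool" where
  "reduced = successively (\<lambda>l l'. l' \<noteq> inv_letter l)"

fun push_letter :: "'a letter \<Rightarrow> 'a letter list \<Rightarrow> 'a letter list" where
  "push_letter l [] = [l]"
| "push_letter l (l' # w) = (if l' = inv_letter l then w else l # l' # w)"

lemma inv_inv_letter [simp]: "inv_letter (inv_letter l) = l"
  by (simp add: inv_letter_def)

lemma inv_letter_neq [simp]: "inv_letter l \<noteq> l" "l \<noteq> inv_letter l"
  by (auto simp: inv_letter_def prod_eq_iff)

lemma inv_letter_eq_iff [simp]: "inv_letter l = inv_letter l' \<longleftrightarrow> l = l'"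
  by (metis inv_inv_letter)

lemma reduced_Nil [simp]: "reduced []"
  by (simp add: reduced_def)

lemma reduced_Cons: "reduced (l # w) \<longleftrightarrow> (w = [] \<or> hd w \<noteq> inv_letter l) \<and> reduced w"
  by (auto simp: reduced_def successively_Cons)

lemma reduced_push: "reduced w \<Longrightarrow> reduced (push_letter l w)"
  by (cases w) (auto simp: reduced_Cons)

lemma reduced_foldr: "reduced w \<Longrightarrow> reduced (foldr push_letter v w)"
  by (induction v) (auto intro: reduced_push)

lemma push_inv: "reduced w \<Longrightarrow> push_letter l (push_letter (inv_letter l) w) = w"
proof (cases w)
  case (Cons l' w')
  assume "reduced w"
  then show ?thesis
    using Cons by (cases w') (auto simp: reduced_Cons)
qed simp

lemma foldr_push:
  assumes "reduced w"
  shows "foldr push_letter (push_letter l v) w = push_letter l (foldr push_letter v w)"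
proof (cases v)
  case (Cons l' v')
  have "push_letter l (push_letter (inv_letter l) (foldr push_letter v' w)) = foldr push_letter v' w"
    using assms by (intro push_inv reduced_foldr)
  with Cons show ?thesis by simp
qed simp

lemma foldr_push_assoc:
  assumes "reduced w"
  shows "foldr push_letter (foldr push_letter u v) w = foldr push_letter u (foldr push_letter v w)"
  by (induction u) (auto simp: foldr_push assms)

lemma foldr_push_Nil: "reduced w \<Longrightarrow> foldr push_letter w [] = w"
proof (induction w)
  case (Cons l w)
  then show ?case by (cases w) (auto simp: reduced_Cons)
qed simp

lemma foldr_push_inverse: "foldr push_letter (rev (map inv_letter v)) (foldr push_letter v []) = []"
proof (induction v)
  case (Cons l v)
  have "push_letter (inv_letter l) (push_letter l (foldr push_letter v [])) = foldr push_letter v []"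
    using push_inv[of "foldr push_letter v []" "inv_letter l"] by (simp add: reduced_foldr)
  with Cons show ?case by simp
qed simp

lemma reduced_rev_inv: "reduced v \<Longrightarrow> reduced (rev (map inv_letter v))"
proof -
  assume *: "reduced v"
  have "successively (\<lambda>l l'. inv_letter l \<noteq> inv_letter (inv_letter l')) v"
    by (rule successively_mono[OF *[unfolded reduced_def]]) auto
  then show ?thesis
    by (simp only: reduced_def successively_rev successively_map)
qed

typedef 'a free_group = "{w :: 'a letter list. reduced w}"
  by (rule exI[of _ "[]"]) simp

setup_lifting type_definition_free_group

instantiation free_group :: (type) group_add
begin

lift_definition zero_free_group :: "'a free_group" is "[]" by simp
lift_definition plus_free_group :: "'a free_group \<Rightarrow> 'a free_group \<Rightarrow> 'a free_group"
  is "\<lambda>v w. foldr push_letter v w" by (rule reduced_foldr)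
lift_definition uminus_free_group :: "'a free_group \<Rightarrow> 'a free_group"
  is "\<lambda>w. rev (map inv_letter w)" by (rule reduced_rev_inv)
definition minus_free_group :: "'a free_group \<Rightarrow> 'a free_group \<Rightarrow> 'a free_group"
  where "minus_free_group v w = v + - w"

instance
proof
  fix u v w :: "'a free_group"
  show "u + v + w = u + (v + w)" by transfer (rule foldr_push_assoc)
  show "0 + u = u" by transfer simp
  show "u + 0 = u" by transfer (rule foldr_push_Nil)
  show "- u + u = 0" by transfer (metis foldr_push_inverse foldr_push_Nil)
  show "u + - v = u - v" by (simp add: minus_free_group_def)
qed

end

lift_definition free_gen :: "'a \<Rightarrow> 'a free_group" is "\<lambda>a. [(a, True)]"
  by (simp add: reduced_Cons)

datatype idx4 = I1 | I2 | I3 | I4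

type_synonym F4 = "idx4 free_group"

fun v_mat :: "idx4 \<Rightarrow> mat2" where
  "v_mat I1 = vector [vector [1, 0], vector [0, - 1]]"
| "v_mat I2 = vector [vector [0, 1], vector [1, 0]]"
| "v_mat I3 = vector [vector [0, 1], vector [- 1, 0]]"
| "v_mat I4 = vector [vector [1 / 2, complex_of_real (sqrt 3) / 2],
                  vector [- \<i> * complex_of_real (sqrt 3) / 2, \<i> / 2]]"

definition R_alg :: "(F4 \<Rightarrow>\<^sub>0 pauli) op set" where
  "R_alg = hyperfinite_R"

definition M_alg :: "(2 \<times> (F4 \<Rightarrow>\<^sub>0 pauli)) op set" where
  "M_alg = vn_tensor M2 R_alg"

definition LG :: "((2 \<times> (F4 \<Rightarrow>\<^sub>0 pauli)) \<times> F4) op set" where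
  "LG = group_vn"

end

(*  Let G = F4, P the crossed product, and let u in P be a unitary normalizing L(G).  Elements of P
    commute with right multiplications by Pauli matrices on R and with right translations W_k
    twisted by the unitaries implementing alpha.  Expand u along Pauli strings: for a string s of R
    and a Pauli matrix sigma_p of the first factor let phi_p(s) in l^2(G) collect the coefficients.
    Since y_k = u u_{-k} u^* lies in L(G), it acts on each phi_p(s) by an isometry C_k commuting
    with right translations rho_k, and y_k u = u u_{-k} becomes
      C_k phi_q(s) = rho_k (sum_r B(k)_{qr} phi_r(k.s)),
    where B is the orthogonal representation of G on the Pauli matrices.

    Hence sum_q |phi_q(s)|^2 is constant on G-orbits of strings; it is summable, so it vanishes for
    s <> 0, whose orbit is infinite.  For s = 0 the Gram coefficients <phi_q, rho_l phi_r> are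
    transformed by B along the conjugacy class of l.  The class of l <> 0 is infinite and coefficients
    of the regular representation tend to 0, so they vanish unless l = 0; at l = 0 the Gram matrix
    commutes with B and is therefore a scalar c on the irreducible space of traceless matrices.
    So the translates of phi_X, phi_Y, phi_Z are orthogonal of norm^2 c, and Bessel's inequality
    forces c = 0.  Thus u has only scalar coefficients and lies in L(G).

    On the other hand the Pauli matrices of the first factor span a finite-dimensional invariant
    subspace of M, so they quasinormalize L(G): commuting one of them past an element of L(G) costs
    a Schur multiplier given by the coefficients of B.  *)
theory Submission
  imports Defs
begin

section \<open>Vectors and bounded maps\<close>

text \<open>A finite-dimensional invariant subspace of M yields quasinormalizers, while an invariant
  line spanned by a non-scalar unitary would yield a normalizing one; the matrices v_i leave the
  traceless matrices without invariant lines. The isometries C_k depend on u and are otherwise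
  unknown. They are eliminated by passing to the numbers <phi_q(s), rho_l phi_r(s)>, which an
  isometry commuting with right translations leaves unchanged. The implementing matrices
  \<open>V g\<close> are fixed only up to a phase, so they need not multiply as G does; their
  conjugation action on the Pauli matrices does, and it is a real orthogonal representation. The
  inner product in use is the real part of the complex one, so the translates are only known to be
  orthogonal over the reals. Hence coefficients at the identity of G are tested with two vectors,
  \<open>ket 0\<close> and its multiple by i, and the contradiction comes from the traceless space
  having dimension 3 > 2.\<close>

lemma ell2_summable: "(\<lambda>i. (cmod (ell2_nth \<xi> i))\<^sup>2) summable_on UNIV"
  using ell2_nth[of \<xi>] by simp

lemma ell2_nth_of: "(\<lambda>i. (cmod (f i))\<^sup>2) summable_on UNIV \<Longrightarrow> ell2_nth (ell2_of f) = f"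
  by (simp add: ell2_of_inverse)

lemma ell2_eqI: "(\<And>i. ell2_nth \<xi> i = ell2_nth \<eta> i) \<Longrightarrow> \<xi> = \<eta>"
  by (metis ell2_nth_inverse ext)

lemma ell2_nth_simps [simp]:
  "ell2_nth 0 i = 0"
  "ell2_nth (\<xi> + \<eta>) i = ell2_nth \<xi> i + ell2_nth \<eta> i"
  "ell2_nth (\<xi> - \<eta>) i = ell2_nth \<xi> i - ell2_nth \<eta> i"
  "ell2_nth (- \<xi>) i = - ell2_nth \<xi> i"
  "ell2_nth (r *\<^sub>R \<xi>) i = r *\<^sub>R ell2_nth \<xi> i"
  "ell2_nth (c *\<^sub>C \<xi>) i = c * ell2_nth \<xi> i"
  by (transfer, simp)+

lemma ell2_nth_sum: "ell2_nth (sum f A) i = (\<Sum>a\<in>A. ell2_nth (f a) i)"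
  by (induction A rule: infinite_finite_induct) auto

lemma has_sum_inner_ell2: "((\<lambda>i. ell2_nth \<xi> i \<bullet> ell2_nth \<eta> i) has_sum \<xi> \<bullet> \<eta>) UNIV"
  by (simp add: inner_ell2.rep_eq ell2_inner_summable[OF ell2_summable ell2_summable])

lemma has_sum_norm_ell2: "((\<lambda>i. (cmod (ell2_nth \<xi> i))\<^sup>2) has_sum (norm \<xi>)\<^sup>2) UNIV"
  using has_sum_inner_ell2[of \<xi> \<xi>] by (simp add: power2_norm_eq_inner)

lemma sum_le_norm_ell2:
  assumes "finite F"
  shows "(\<Sum>i\<in>F. (cmod (ell2_nth \<xi> i))\<^sup>2) \<le> (norm \<xi>)\<^sup>2"
  by (rule finite_sum_le_has_sum[OF has_sum_norm_ell2 assms]) auto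

lemma nth_le_norm_ell2: "cmod (ell2_nth \<xi> i) \<le> norm \<xi>"
  using sum_le_norm_ell2[of "{i}" \<xi>] by (simp add: power2_le_iff_abs_le)

text \<open>\<open>ell2_of\<close> is unspecified off the square-summable functions, so each vector
  given by a formula needs a certificate. A bound on finite partial sums provides it together with
  the norm.\<close>

lemma ell2_ofI:
  assumes "\<And>F. finite F \<Longrightarrow> (\<Sum>i\<in>F. (cmod (f i))\<^sup>2) \<le> C\<^sup>2" and "0 \<le> C"
  shows "ell2_nth (ell2_of f) = f" and "norm (ell2_of f) \<le> C"
proof -
  have "(\<lambda>i. (cmod (f i))\<^sup>2) summable_on UNIV"
    by (rule nonneg_bdd_above_summable_on) (auto intro!: bdd_aboveI2 assms)
  then show *: "ell2_nth (ell2_of f) = f" by (rule ell2_nth_of)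
  have "(norm (ell2_of f))\<^sup>2 \<le> C\<^sup>2"
    using has_sum_norm_ell2[of "ell2_of f"] unfolding *
    by (rule has_sum_le_finite_sums) (use assms in auto)
  then show "norm (ell2_of f) \<le> C" using assms(2) by (rule power2_le_imp_le)
qed

lemma scaleC_simps:
  "c *\<^sub>C (\<xi> + \<eta>) = c *\<^sub>C \<xi> + c *\<^sub>C \<eta>"
  "c *\<^sub>C (\<xi> - \<eta>) = c *\<^sub>C \<xi> - c *\<^sub>C \<eta>"
  "c *\<^sub>C (- \<xi>) = - (c *\<^sub>C \<xi>)"
  "(c + d) *\<^sub>C \<xi> = c *\<^sub>C \<xi> + d *\<^sub>C \<xi>"
  "c *\<^sub>C 0 = (0 :: 'a ell2)"
  "0 *\<^sub>C \<xi> = 0"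
  "1 *\<^sub>C \<xi> = \<xi>"
  "c *\<^sub>C d *\<^sub>C \<xi> = (c * d) *\<^sub>C \<xi>"
  "c *\<^sub>C r *\<^sub>R \<xi> = r *\<^sub>R c *\<^sub>C \<xi>"
  "of_real r *\<^sub>C \<xi> = r *\<^sub>R \<xi>"
  by (auto intro!: ell2_eqI simp: algebra_simps scaleR_conv_of_real)

lemma inner_scaleC: "(c *\<^sub>C \<xi>) \<bullet> \<eta> = \<xi> \<bullet> (cnj c *\<^sub>C \<eta>)"
proof -
  have "(c * z) \<bullet> w = z \<bullet> (cnj c * w)" for z w :: complex
    by (simp add: inner_complex_def algebra_simps)
  then show ?thesis
    using has_sum_inner_ell2[of "c *\<^sub>C \<xi>" \<eta>] has_sum_inner_ell2[of \<xi> "cnj c *\<^sub>C \<eta>"]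
    by (simp add: has_sum_unique)
qed

lemma norm_scaleC: "norm (c *\<^sub>C \<xi>) = cmod c * norm \<xi>"
proof -
  have "(norm (c *\<^sub>C \<xi>))\<^sup>2 = (cmod c * norm \<xi>)\<^sup>2"
    using has_sum_norm_ell2[of "c *\<^sub>C \<xi>"]
      has_sum_cmult_right[OF has_sum_norm_ell2[of \<xi>], of "(cmod c)\<^sup>2"]
    by (simp add: norm_mult power_mult_distrib has_sum_unique)
  then show ?thesis by (simp add: power2_eq_imp_eq)
qed

section \<open>Basis vectors and expansions in them\<close>

definition ket :: "'i \<Rightarrow> 'i ell2" where
  "ket i = ell2_of (\<lambda>j. if j = i then 1 else 0)"

lemma ell2_nth_ket: "ell2_nth (ket i) j = (if j = i then 1 else 0)"
proof -
  have "(\<Sum>j\<in>F. (cmod (if j = i then 1 else 0))\<^sup>2) \<le> 1\<^sup>2" if "finite F" for F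
    using that by (simp add: if_distrib[of cmod] if_distrib[of "\<lambda>x. x\<^sup>2"] cong: if_cong)
  from ell2_ofI(1)[OF this] show ?thesis by (simp add: ket_def)
qed

lemma inner_ket: "ket i \<bullet> \<xi> = Re (ell2_nth \<xi> i)"
proof -
  have "((\<lambda>j. ell2_nth (ket i) j \<bullet> ell2_nth \<xi> j) has_sum Re (ell2_nth \<xi> i)) UNIV"
    by (rule has_sum_finite_neutralI[of "{i}"]) (auto simp: ell2_nth_ket inner_complex_def)
  then show ?thesis using has_sum_inner_ell2 has_sum_unique by blast
qed

text \<open>By Pythagoras, truncation to F has squared error |xi|^2 minus the partial sum over F,
  and this tends to 0.\<close>

lemma has_sum_ket: "((\<lambda>i. ell2_nth \<xi> i *\<^sub>C ket i) has_sum \<xi>) UNIV"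
  unfolding has_sum_def tendsto_iff
proof safe
  fix e :: real assume "0 < e"
  have eq: "(norm (sum (\<lambda>i. ell2_nth \<xi> i *\<^sub>C ket i) F - \<xi>))\<^sup>2
      = (norm \<xi>)\<^sup>2 - (\<Sum>i\<in>F. (cmod (ell2_nth \<xi> i))\<^sup>2)" if "finite F" for F
  proof -
    have nth: "ell2_nth (sum (\<lambda>i. ell2_nth \<xi> i *\<^sub>C ket i) F) j = (if j \<in> F then ell2_nth \<xi> j else 0)" for j
      using that by (simp add: ell2_nth_sum ell2_nth_ket if_distrib[of "\<lambda>x. _ * x"] cong: if_cong)
    have "((\<lambda>j. (cmod (ell2_nth \<xi> j))\<^sup>2 - (if j \<in> F then (cmod (ell2_nth \<xi> j))\<^sup>2 else 0))
        has_sum (norm \<xi>)\<^sup>2 - (\<Sum>i\<in>F. (cmod (ell2_nth \<xi> i))\<^sup>2)) UNIV"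
      unfolding diff_conv_add_uminus has_sum_uminus
      by (intro has_sum_add has_sum_norm_ell2 has_sum_uminus[THEN iffD2] has_sum_finite_neutralI[of F])
         (use that in auto)
    moreover have "(cmod (ell2_nth \<xi> j))\<^sup>2 - (if j \<in> F then (cmod (ell2_nth \<xi> j))\<^sup>2 else 0)
      = (cmod (ell2_nth (sum (\<lambda>i. ell2_nth \<xi> i *\<^sub>C ket i) F - \<xi>) j))\<^sup>2" for j
      unfolding ell2_nth_simps nth by (cases "j \<in> F") simp_all
    ultimately show ?thesis
      by (simp only: has_sum_unique[OF has_sum_norm_ell2])
  qed
  have "\<forall>\<^sub>F F in finite_subsets_at_top UNIV. dist (\<Sum>i\<in>F. (cmod (ell2_nth \<xi> i))\<^sup>2) ((norm \<xi>)\<^sup>2) < e\<^sup>2"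
    using has_sum_norm_ell2[of \<xi>] \<open>0 < e\<close> unfolding has_sum_def tendsto_iff by simp
  moreover have "\<forall>\<^sub>F F in finite_subsets_at_top UNIV. finite (F :: 'a set)"
    by (simp add: eventually_finite_subsets_at_top_weakI)
  ultimately show "\<forall>\<^sub>F F in finite_subsets_at_top UNIV. dist (sum (\<lambda>i. ell2_nth \<xi> i *\<^sub>C ket i) F) \<xi> < e"
  proof eventually_elim
    case (elim F)
    then have "(norm (sum (\<lambda>i. ell2_nth \<xi> i *\<^sub>C ket i) F - \<xi>))\<^sup>2 < e\<^sup>2"
      by (simp add: eq dist_real_def)
    then show ?case using \<open>0 < e\<close> by (simp add: dist_norm power2_less_imp_less)
  qed
qed

text \<open>Domain and codomain may have different index types, unlike in \<open>bounded_op\<close>;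
  slices, swaps and embeddings of fibres call for this.\<close>

definition bounded_map :: "('i ell2 \<Rightarrow> 'j ell2) \<Rightarrow> bool" where
  "bounded_map x \<longleftrightarrow> bounded_linear x \<and> (\<forall>c \<xi>. x (c *\<^sub>C \<xi>) = c *\<^sub>C x \<xi>)"

lemma bounded_op_iff_map: "bounded_op x \<longleftrightarrow> bounded_map x"
  by (simp add: bounded_op_def bounded_map_def)

lemma bounded_mapI:
  assumes "\<And>\<xi> \<eta>. x (\<xi> + \<eta>) = x \<xi> + x \<eta>" and "\<And>c \<xi>. x (c *\<^sub>C \<xi>) = c *\<^sub>C x \<xi>"
    and "\<And>\<xi>. norm (x \<xi>) \<le> K * norm \<xi>"
  shows "bounded_map x"
  unfolding bounded_map_def
proof (intro conjI allI)
  show "bounded_linear x"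
  proof (rule bounded_linear_intro)
    show "x (r *\<^sub>R \<xi>) = r *\<^sub>R x \<xi>" for r \<xi>
      using assms(2)[of "of_real r" \<xi>] by (simp add: scaleC_simps)
    show "norm (x \<xi>) \<le> norm \<xi> * K" for \<xi>
      using assms(3)[of \<xi>] by (simp add: mult.commute)
  qed (rule assms)
qed (rule assms)

lemma bounded_mapD:
  assumes "bounded_map x"
  shows "x (\<xi> + \<eta>) = x \<xi> + x \<eta>" "x (\<xi> - \<eta>) = x \<xi> - x \<eta>" "x (c *\<^sub>C \<xi>) = c *\<^sub>C x \<xi>"
    "x 0 = 0" "x (- \<xi>) = - x \<xi>" "x (r *\<^sub>R \<xi>) = r *\<^sub>R x \<xi>" "x (sum f A) = (\<Sum>a\<in>A. x (f a))"
  using assms unfolding bounded_map_def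
  by (auto simp: linear_simps linear_sum bounded_linear.linear)

lemma bounded_map_bound:
  assumes "bounded_map x"
  obtains K where "0 \<le> K" "\<And>\<xi>. norm (x \<xi>) \<le> K * norm \<xi>"
  using assms bounded_linear.nonneg_bounded unfolding bounded_map_def by (metis mult.commute)

lemma bounded_map_id: "bounded_map (\<lambda>\<xi>. \<xi>)" "bounded_map id"
  by (auto simp: bounded_map_def bounded_linear_ident id_def)

lemma bounded_map_compose:
  assumes "bounded_map x" "bounded_map y"
  shows "bounded_map (\<lambda>\<xi>. x (y \<xi>))" "bounded_map (x \<circ> y)"
  using assms by (auto simp: bounded_map_def bounded_linear_compose comp_def)

lemma bounded_map_add: "bounded_map x \<Longrightarrow> bounded_map y \<Longrightarrow> bounded_map (\<lambda>\<xi>. x \<xi> + y \<xi>)"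
  by (auto simp: bounded_map_def bounded_linear_add scaleC_simps)

lemma bounded_map_zero: "bounded_map (\<lambda>\<xi>. 0)"
  by (auto simp: bounded_map_def bounded_linear_zero scaleC_simps)

lemma bounded_map_sum: "(\<And>a. a \<in> A \<Longrightarrow> bounded_map (x a)) \<Longrightarrow> bounded_map (\<lambda>\<xi>. \<Sum>a\<in>A. x a \<xi>)"
  by (induction A rule: infinite_finite_induct) (auto intro: bounded_map_zero bounded_map_add)

lemma bounded_map_scaleC:
  assumes "bounded_map x"
  shows "bounded_map (\<lambda>\<xi>. c *\<^sub>C x \<xi>)"
proof -
  obtain K where "\<And>\<xi>. norm (x \<xi>) \<le> K * norm \<xi>" using bounded_map_bound[OF assms] by blast
  then show ?thesis
    by (intro bounded_mapI[of _ "cmod c * K"])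
       (simp_all add: bounded_mapD[OF assms] scaleC_simps norm_scaleC mult.commute[of c]
         mult.assoc mult_left_mono)
qed

lemma has_sum_bounded_map:
  assumes "bounded_map x"
  shows "((\<lambda>i. ell2_nth \<xi> i *\<^sub>C x (ket i)) has_sum x \<xi>) UNIV"
  using has_sum_bounded_linear[OF _ has_sum_ket, of x \<xi>] assms by (simp add: bounded_map_def)

lemma bounded_linear_ell2_nth: "bounded_linear (\<lambda>\<xi>. ell2_nth \<xi> i)"
  by (rule bounded_linear_intro[of _ 1]) (auto simp: nth_le_norm_ell2)

lemma has_sum_bounded_map_nth:
  fixes x :: "'i ell2 \<Rightarrow> 'j ell2"
  assumes "bounded_map x"
  shows "((\<lambda>i. ell2_nth \<xi> i * ell2_nth (x (ket i)) j) has_sum ell2_nth (x \<xi>) j) UNIV"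
  using has_sum_bounded_linear[OF bounded_linear_ell2_nth[of j] has_sum_bounded_map[OF assms, of \<xi>]]
  by simp

lemma bounded_map_eqI:
  assumes "bounded_map x" "bounded_map y" "\<And>i. x (ket i) = y (ket i)"
  shows "x = y"
proof
  fix \<xi> show "x \<xi> = y \<xi>"
    using has_sum_bounded_map[OF assms(1), of \<xi>] has_sum_bounded_map[OF assms(2), of \<xi>]
    unfolding assms(3) by (rule has_sum_unique)
qed

section \<open>Adjoints, commutants and unitaries\<close>

text \<open>The candidate vector is read off the basis. Testing f on a finite truncation with
  squared norm s gives s <= sqrt s * K, so the candidate is square-summable.\<close>

lemma riesz_ell2:
  fixes f :: "'i ell2 \<Rightarrow> real"
  assumes "bounded_linear f"
  shows "\<exists>\<eta>. \<forall>\<xi>. f \<xi> = \<xi> \<bullet> \<eta>"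
proof -
  obtain K where K: "0 \<le> K" "\<And>\<xi>. norm (f \<xi>) \<le> norm \<xi> * K"
    using bounded_linear.nonneg_bounded[OF assms] by blast
  \<comment> \<open>f is only real-linear, so real and imaginary parts come from
    \<open>ket i\<close> and from its multiple by i.\<close>
  define h where "h i = Complex (f (ket i)) (f (\<i> *\<^sub>C ket i))" for i
  have fc: "f (c *\<^sub>C ket i) = c \<bullet> h i" for c i
  proof -
    have "c *\<^sub>C ket i = Re c *\<^sub>R ket i + Im c *\<^sub>R (\<i> *\<^sub>C ket i)"
      by (intro ell2_eqI) (simp add: ell2_nth_ket scaleR_conv_of_real mult.commute flip: complex_eq)
    then show ?thesis
      using assms by (simp add: linear_simps h_def inner_complex_def)
  qed
  have fin: "(\<Sum>i\<in>F. (cmod (h i))\<^sup>2) \<le> K\<^sup>2" if F: "finite F" for F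
  proof -
    define \<zeta> where "\<zeta> = (\<Sum>i\<in>F. h i *\<^sub>C ket i)"
    define s where "s = (\<Sum>i\<in>F. (cmod (h i))\<^sup>2)"
    have nth: "ell2_nth \<zeta> j = (if j \<in> F then h j else 0)" for j
      using F by (simp add: \<zeta>_def ell2_nth_sum ell2_nth_ket if_distrib[of "\<lambda>x. _ * x"] cong: if_cong)
    have "((\<lambda>j. (cmod (ell2_nth \<zeta> j))\<^sup>2) has_sum s) UNIV"
      unfolding s_def by (rule has_sum_finite_neutralI[of F]) (use F nth in auto)
    then have n: "(norm \<zeta>)\<^sup>2 = s"
      using has_sum_norm_ell2 has_sum_unique by blast
    have "f \<zeta> = s"
      unfolding \<zeta>_def s_def using assms
      by (simp add: linear_sum[OF bounded_linear.linear] fc power2_norm_eq_inner)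
    then have "s \<le> norm \<zeta> * K" using K(2)[of \<zeta>] by simp
    then have "norm \<zeta> * norm \<zeta> \<le> norm \<zeta> * K" by (simp add: n[symmetric] power2_eq_square)
    then have "norm \<zeta> \<le> K" using K(1) by (cases "norm \<zeta> = 0") auto
    then show ?thesis using n s_def by (metis norm_ge_zero power_mono)
  qed
  have nth: "ell2_nth (ell2_of h) = h" by (rule ell2_ofI(1)[OF fin K(1)])
  have "f \<xi> = \<xi> \<bullet> ell2_of h" for \<xi>
  proof (rule has_sum_unique)
    show "((\<lambda>i. ell2_nth \<xi> i \<bullet> h i) has_sum f \<xi>) UNIV"
      using has_sum_bounded_linear[OF assms has_sum_ket, of \<xi>] by (simp add: fc)
    show "((\<lambda>i. ell2_nth \<xi> i \<bullet> h i) has_sum \<xi> \<bullet> ell2_of h) UNIV"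
      using has_sum_inner_ell2[of \<xi> "ell2_of h"] by (simp add: nth)
  qed
  then show ?thesis by blast
qed

lemma inner_eqI: "(\<And>\<xi>. \<xi> \<bullet> \<eta> = \<xi> \<bullet> \<zeta>) \<Longrightarrow> \<eta> = (\<zeta> :: 'a :: real_inner)"
  by (metis inner_diff_right inner_eq_zero_iff right_minus_eq)

text \<open>\<open>adjoint\<close> is defined by choice and obeys its equation only once some
  adjoint is known to exist; Riesz representation supplies one.\<close>

lemma adjoint_inner:
  assumes "bounded_op x"
  shows "x \<xi> \<bullet> \<eta> = \<xi> \<bullet> adjoint x \<eta>"
proof -
  have "\<exists>\<zeta>. \<forall>\<xi>. x \<xi> \<bullet> \<eta> = \<xi> \<bullet> \<zeta>" for \<eta>
    using assms by (intro riesz_ell2) (simp add: bounded_op_def bounded_linear_inner_left_comp)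
  then obtain y where "\<forall>\<xi> \<eta>. x \<xi> \<bullet> \<eta> = \<xi> \<bullet> y \<eta>" by metis
  then show ?thesis using adjoint_unique by metis
qed

lemma bounded_op_adjoint:
  assumes "bounded_op x"
  shows "bounded_op (adjoint x)"
proof -
  note i = adjoint_inner[OF assms, symmetric]
  have m: "bounded_map x" using assms by (simp add: bounded_op_iff_map)
  obtain K where K: "0 \<le> K" "\<And>\<xi>. norm (x \<xi>) \<le> K * norm \<xi>"
    using bounded_map_bound[OF m] by blast
  show ?thesis unfolding bounded_op_iff_map
  proof (rule bounded_mapI)
    show "adjoint x (\<xi> + \<eta>) = adjoint x \<xi> + adjoint x \<eta>" for \<xi> \<eta>
      by (rule inner_eqI) (simp add: i inner_add_right)
    show "adjoint x (c *\<^sub>C \<xi>) = c *\<^sub>C adjoint x \<xi>" for c \<xi>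
    proof (rule inner_eqI)
      fix \<zeta>
      have "\<zeta> \<bullet> adjoint x (c *\<^sub>C \<xi>) = (cnj c *\<^sub>C x \<zeta>) \<bullet> \<xi>"
        by (simp add: i inner_scaleC)
      also have "\<dots> = (cnj c *\<^sub>C \<zeta>) \<bullet> adjoint x \<xi>"
        by (simp add: i bounded_mapD[OF m])
      finally show "\<zeta> \<bullet> adjoint x (c *\<^sub>C \<xi>) = \<zeta> \<bullet> (c *\<^sub>C adjoint x \<xi>)"
        by (simp add: inner_scaleC)
    qed
    show "norm (adjoint x \<xi>) \<le> K * norm \<xi>" for \<xi>
    proof -
      have "norm (adjoint x \<xi>) * norm (adjoint x \<xi>) = x (adjoint x \<xi>) \<bullet> \<xi>"
        by (simp add: adjoint_inner[OF assms] power2_norm_eq_inner flip: power2_eq_square)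
      also have "\<dots> \<le> norm (x (adjoint x \<xi>)) * norm \<xi>" by (rule norm_cauchy_schwarz)
      also have "\<dots> \<le> (K * norm (adjoint x \<xi>)) * norm \<xi>"
        by (rule mult_right_mono[OF K(2) norm_ge_zero])
      also have "\<dots> = norm (adjoint x \<xi>) * (K * norm \<xi>)" by simp
      finally show ?thesis using K(1) by (cases "norm (adjoint x \<xi>) = 0") auto
    qed
  qed
qed

lemma adjoint_adjoint_op: "bounded_op x \<Longrightarrow> adjoint (adjoint x) = x"
  by (rule adjoint_unique) (metis adjoint_inner inner_commute)

lemma adjoint_compose_op: "bounded_op x \<Longrightarrow> bounded_op y \<Longrightarrow> adjoint (x \<circ> y) = adjoint y \<circ> adjoint x"
  by (rule adjoint_unique) (simp add: adjoint_inner)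

lemma bounded_op_compose: "bounded_op x \<Longrightarrow> bounded_op y \<Longrightarrow> bounded_op (x \<circ> y)"
  by (simp add: bounded_op_iff_map bounded_map_compose)

lemma isometry_inner:
  assumes "bounded_map x" and "\<And>\<xi>. norm (x \<xi>) = norm \<xi>"
  shows "x \<xi> \<bullet> x \<eta> = \<xi> \<bullet> \<eta>"
proof -
  have "(norm (x (\<xi> + \<eta>)))\<^sup>2 = (norm (\<xi> + \<eta>))\<^sup>2" by (simp add: assms)
  moreover have "(norm (x \<xi>))\<^sup>2 = (norm \<xi>)\<^sup>2" "(norm (x \<eta>))\<^sup>2 = (norm \<eta>)\<^sup>2" by (simp_all add: assms)
  ultimately show ?thesis
    by (simp add: bounded_mapD[OF assms(1)] power2_norm_eq_inner inner_add_left inner_add_right inner_commute)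
qed

text \<open>An isometry with a right inverse is onto, and preservation of inner products identifies
  that inverse with the adjoint.\<close>

lemma unitary_opI:
  assumes "bounded_op x" "\<And>\<xi>. norm (x \<xi>) = norm \<xi>" "\<And>\<xi>. x (y \<xi>) = \<xi>"
  shows "unitary_op x" "adjoint x = y"
proof -
  have iso: "x \<xi> \<bullet> x \<eta> = \<xi> \<bullet> \<eta>" for \<xi> \<eta>
    using assms by (intro isometry_inner) (auto simp: bounded_op_iff_map)
  show *: "adjoint x = y"
    by (rule adjoint_unique) (metis iso assms(3))
  have "y (x \<xi>) = \<xi>" for \<xi>
    by (rule inner_eqI) (metis iso assms(3))
  then show "unitary_op x"
    using assms by (auto simp: unitary_op_def * fun_eq_iff)
qed

lemma unitary_opD:
  assumes "unitary_op x"
  shows "bounded_op x" "bounded_map x" "adjoint x (x \<xi>) = \<xi>" "x (adjoint x \<xi>) = \<xi>"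
    "norm (x \<xi>) = norm \<xi>" "norm (adjoint x \<xi>) = norm \<xi>"
proof -
  show b: "bounded_op x" and a: "adjoint x (x \<xi>) = \<xi>" "x (adjoint x \<xi>) = \<xi>" for \<xi>
    using assms by (auto simp: unitary_op_def fun_eq_iff)
  then show "bounded_map x" by (simp add: bounded_op_iff_map)
  show *: "norm (x \<xi>) = norm \<xi>" for \<xi>
    unfolding norm_eq_sqrt_inner by (simp add: adjoint_inner[OF b] a)
  show "norm (adjoint x \<xi>) = norm \<xi>"
    using *[of "adjoint x \<xi>"] by (simp add: a)
qed

lemma unitary_op_compose:
  assumes "unitary_op x" "unitary_op y"
  shows "unitary_op (x \<circ> y)"
  using unitary_opD[OF assms(1)] unitary_opD[OF assms(2)]
  by (intro unitary_opI(1)[where y = "adjoint y \<circ> adjoint x"] bounded_op_compose) auto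

lemma unitary_op_adjoint: "unitary_op x \<Longrightarrow> unitary_op (adjoint x)"
  by (auto simp: unitary_op_def bounded_op_adjoint adjoint_adjoint_op)

section \<open>Commutants and generated von Neumann algebras\<close>

lemma commutant_bounded: "x \<in> commutant S \<Longrightarrow> bounded_op x"
  by (simp add: commutant_def)

lemma commutantD: "x \<in> commutant S \<Longrightarrow> y \<in> S \<Longrightarrow> x \<circ> y = y \<circ> x"
  by (simp add: commutant_def)

lemma commutant_compose:
  assumes "x \<in> commutant S" "y \<in> commutant S"
  shows "x \<circ> y \<in> commutant S"
proof -
  have "x \<circ> y \<circ> z = z \<circ> (x \<circ> y)" if "z \<in> S" for z
    using commutantD[OF assms(1) that] commutantD[OF assms(2) that] by (metis comp_assoc)
  then show ?thesis using assms by (simp add: commutant_def bounded_op_compose)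
qed

lemma commutant_add:
  assumes "x \<in> commutant S" "y \<in> commutant S" "\<And>z. z \<in> S \<Longrightarrow> bounded_op z"
  shows "(\<lambda>\<xi>. x \<xi> + y \<xi>) \<in> commutant S"
proof -
  have "x (z \<xi>) + y (z \<xi>) = z (x \<xi> + y \<xi>)" if "z \<in> S" for z \<xi>
    using commutantD[OF assms(1) that] commutantD[OF assms(2) that] assms(3)[OF that]
    by (simp add: fun_eq_iff bounded_mapD bounded_op_iff_map)
  then show ?thesis
    using assms by (auto simp: commutant_def bounded_op_iff_map bounded_map_add)
qed

lemma vn_generated_bounded: "x \<in> vn_generated S \<Longrightarrow> bounded_op x"
  by (simp add: vn_generated_def commutant_bounded)

lemma vn_generated_superset: "(\<And>x. x \<in> S \<Longrightarrow> bounded_op x) \<Longrightarrow> S \<subseteq> vn_generated S"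
  by (auto simp: vn_generated_def commutant_def)

lemma vn_generated_mono: "S \<subseteq> T \<Longrightarrow> vn_generated S \<subseteq> vn_generated T"
proof -
  have *: "commutant B \<subseteq> commutant A" if "A \<subseteq> B" for A B :: "'a op set"
    using that by (auto simp: commutant_def)
  assume "S \<subseteq> T"
  then have "S \<union> adjoint ` S \<subseteq> T \<union> adjoint ` T" by auto
  from *[OF *[OF this]] show ?thesis by (simp add: vn_generated_def)
qed

lemma commutes_adjoint:
  assumes "bounded_op x" "bounded_op y" "x \<circ> y = y \<circ> x"
  shows "adjoint x \<circ> adjoint y = adjoint y \<circ> adjoint x"
  using assms by (metis adjoint_compose_op)

text \<open>That t commutes with the adjoint of y is the adjoint of the relation between y and the
  adjoint of t; so testing t and its adjoint on S places t in the commutant of the self-adjoint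
  generating set.\<close>

lemma vn_generated_commutes:
  assumes "x \<in> vn_generated S" "bounded_op t"
    and "\<And>y. y \<in> S \<Longrightarrow> bounded_op y"
    and "\<And>y. y \<in> S \<Longrightarrow> t \<circ> y = y \<circ> t" and "\<And>y. y \<in> S \<Longrightarrow> adjoint t \<circ> y = y \<circ> adjoint t"
  shows "x \<circ> t = t \<circ> x"
proof -
  have "t \<circ> adjoint y = adjoint y \<circ> t" if "y \<in> S" for y
    using commutes_adjoint[OF bounded_op_adjoint[OF assms(2)] assms(3)[OF that] assms(5)[OF that]]
      adjoint_adjoint_op[OF assms(2)] by simp
  then have "t \<in> commutant (S \<union> adjoint ` S)"
    using assms(2,4) by (auto simp: commutant_def)
  then show ?thesis using assms(1) commutantD unfolding vn_generated_def by blast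
qed

lemma unitary_commutes_adjoint:
  assumes "unitary_op t" "bounded_op y" "t \<circ> y = y \<circ> t"
  shows "adjoint t \<circ> y = y \<circ> adjoint t"
proof
  fix \<xi>
  have "t (y (adjoint t \<xi>)) = y \<xi>"
    using assms(3) unitary_opD(4)[OF assms(1)] by (metis comp_apply)
  then show "(adjoint t \<circ> y) \<xi> = (y \<circ> adjoint t) \<xi>"
    using unitary_opD(3)[OF assms(1)] by (metis comp_apply)
qed

lemma vn_generated_commutes_unitary:
  assumes "x \<in> vn_generated S" "unitary_op t"
    and "\<And>y. y \<in> S \<Longrightarrow> bounded_op y \<and> t \<circ> y = y \<circ> t"
  shows "x \<circ> t = t \<circ> x"
  using assms unitary_commutes_adjoint
  by (intro vn_generated_commutes[OF assms(1)]) (auto simp: unitary_op_def)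

section \<open>Weighted pullbacks and decomposable operators\<close>

text \<open>Monomial operators: a substitution of indices followed by scalar weights. Translations,
  shifts, slices, swaps and right Pauli multiplications all have this form.\<close>

definition wpull :: "('j \<Rightarrow> 'i) \<Rightarrow> ('j \<Rightarrow> complex) \<Rightarrow> 'i ell2 \<Rightarrow> 'j ell2" where
  "wpull f w \<xi> = ell2_of (\<lambda>j. w j * ell2_nth \<xi> (f j))"

text \<open>Injectivity is demanded only where the weight is nonzero. This admits embeddings of
  fibres and single matrix entries, whose index maps are not injective globally.\<close>

lemma wpull:
  assumes inj: "inj_on f {j. w j \<noteq> 0}" and bd: "\<And>j. cmod (w j) \<le> K"
  shows ell2_nth_wpull: "ell2_nth (wpull f w \<xi>) j = w j * ell2_nth \<xi> (f j)"
    and norm_wpull: "norm (wpull f w \<xi>) \<le> K * norm \<xi>"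
    and bounded_map_wpull: "bounded_map (wpull f w)"
proof -
  have K: "0 \<le> K" using bd[of undefined] norm_ge_zero order_trans by blast
  have fin: "(\<Sum>j\<in>F. (cmod (w j * ell2_nth \<xi> (f j)))\<^sup>2) \<le> (K * norm \<xi>)\<^sup>2" if "finite F" for F \<xi>
  proof -
    define E where "E = F \<inter> {j. w j \<noteq> 0}"
    have E: "finite E" "E \<subseteq> F" "inj_on f E" using that inj by (auto simp: E_def inj_on_def)
    have "(\<Sum>j\<in>F. (cmod (w j * ell2_nth \<xi> (f j)))\<^sup>2) = (\<Sum>j\<in>E. (cmod (w j * ell2_nth \<xi> (f j)))\<^sup>2)"
      by (rule sum.mono_neutral_right) (use that in \<open>auto simp: E_def\<close>)
    also have "\<dots> \<le> (\<Sum>j\<in>E. K\<^sup>2 * (cmod (ell2_nth \<xi> (f j)))\<^sup>2)"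
      by (intro sum_mono) (simp add: norm_mult power_mult_distrib mult_right_mono power_mono bd)
    also have "\<dots> = K\<^sup>2 * (\<Sum>i\<in>f ` E. (cmod (ell2_nth \<xi> i))\<^sup>2)"
      by (simp add: sum_distrib_left sum.reindex[OF E(3)])
    also have "\<dots> \<le> K\<^sup>2 * (norm \<xi>)\<^sup>2"
      using E(1) by (intro mult_left_mono sum_le_norm_ell2) auto
    finally show ?thesis by (simp add: power_mult_distrib)
  qed
  have nth: "ell2_nth (wpull f w \<xi>) j = w j * ell2_nth \<xi> (f j)" for \<xi> j
    using ell2_ofI(1)[OF fin, of \<xi>] K by (simp add: wpull_def)
  have norm: "norm (wpull f w \<xi>) \<le> K * norm \<xi>" for \<xi>
    using ell2_ofI(2)[OF fin, of \<xi>] K by (simp add: wpull_def)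
  show "ell2_nth (wpull f w \<xi>) j = w j * ell2_nth \<xi> (f j)" by (rule nth)
  show "norm (wpull f w \<xi>) \<le> K * norm \<xi>" by (rule norm)
  show "bounded_map (wpull f w)"
    by (rule bounded_mapI[OF _ _ norm]) (auto intro!: ell2_eqI simp: nth algebra_simps)
qed

lemma unitary_wpull:
  assumes f: "bij f" and w: "\<And>j. cmod (w j) = 1"
  shows "unitary_op (wpull f w)"
    and "adjoint (wpull f w) = wpull (inv f) (\<lambda>i. cnj (w (inv f i)))"
proof -
  have 1: "inj_on f A" "inj_on (inv f) A" for A
    using bij_is_inj[OF f] bij_is_inj[OF bij_imp_bij_inv[OF f]] by (auto intro: inj_on_subset)
  note nth = ell2_nth_wpull[OF 1(1) eq_refl[OF w]]
  have b: "bounded_op (wpull f w)"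
    by (simp add: bounded_op_iff_map bounded_map_wpull[OF 1(1) eq_refl[OF w]])
  have n: "norm (wpull f w \<xi>) = norm \<xi>" for \<xi>
  proof -
    have "((\<lambda>j. (cmod (ell2_nth (wpull f w \<xi>) j))\<^sup>2) has_sum (norm \<xi>)\<^sup>2) UNIV"
      using has_sum_reindex_bij_betw[OF f, of "\<lambda>i. (cmod (ell2_nth \<xi> i))\<^sup>2" "(norm \<xi>)\<^sup>2"]
      by (simp add: nth norm_mult w has_sum_norm_ell2)
    then have "(norm (wpull f w \<xi>))\<^sup>2 = (norm \<xi>)\<^sup>2"
      using has_sum_norm_ell2 has_sum_unique by blast
    then show ?thesis by (simp add: power2_eq_imp_eq)
  qed
  have cw: "w j * cnj (w j) = 1" for j
    using complex_norm_square[of "w j"] by (simp add: w)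
  have i: "wpull f w (wpull (inv f) (\<lambda>i. cnj (w (inv f i))) \<xi>) = \<xi>" for \<xi>
    by (rule ell2_eqI)
       (simp add: nth ell2_nth_wpull[OF 1(2), of _ 1] w cw bij_is_inj[OF f] flip: mult.assoc)
  show "unitary_op (wpull f w)" "adjoint (wpull f w) = wpull (inv f) (\<lambda>i. cnj (w (inv f i)))"
    using unitary_opI[OF b n i] by auto
qed

section \<open>Slices of vectors over a product index set, and operators acting slicewise\<close>

definition lslice :: "('i \<times> 'j) ell2 \<Rightarrow> 'j \<Rightarrow> 'i ell2" where
  "lslice \<xi> j = ell2_of (\<lambda>i. ell2_nth \<xi> (i, j))"

definition rslice :: "('i \<times> 'j) ell2 \<Rightarrow> 'i \<Rightarrow> 'j ell2" where
  "rslice \<xi> i = ell2_of (\<lambda>j. ell2_nth \<xi> (i, j))"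

definition swap_op :: "('i \<times> 'j) ell2 \<Rightarrow> ('j \<times> 'i) ell2" where
  "swap_op = wpull prod.swap (\<lambda>_. 1)"

lemma ell2_nth_swap [simp]: "ell2_nth (swap_op \<xi>) (i, j) = ell2_nth \<xi> (j, i)"
  unfolding swap_op_def by (subst ell2_nth_wpull[where K = 1]) auto

lemma bounded_map_swap: "bounded_map swap_op"
  unfolding swap_op_def by (rule bounded_map_wpull[where K = 1]) auto

lemma swap_swap [simp]: "swap_op (swap_op \<xi>) = \<xi>"
  by (rule ell2_eqI) (metis ell2_nth_swap surj_pair)

lemma norm_swap [simp]: "norm (swap_op \<xi>) = norm \<xi>"
proof (rule antisym)
  have *: "norm (swap_op \<xi>) \<le> norm \<xi>" for \<xi> :: "('i \<times> 'j) ell2"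
    unfolding swap_op_def using norm_wpull[of prod.swap "\<lambda>_. 1" 1 \<xi>] by simp
  then show "norm (swap_op \<xi>) \<le> norm \<xi>" .
  have *: "norm (swap_op \<xi>) \<le> norm \<xi>" for \<xi> :: "('j \<times> 'i) ell2"
    unfolding swap_op_def using norm_wpull[of prod.swap "\<lambda>_. 1" 1 \<xi>] by simp
  from *[of "swap_op \<xi>"] show "norm \<xi> \<le> norm (swap_op \<xi>)" by simp
qed

lemma lslice_eq_wpull: "lslice \<xi> j = wpull (\<lambda>i. (i, j)) (\<lambda>_. 1) \<xi>"
  by (simp add: lslice_def wpull_def)

lemma ell2_nth_lslice [simp]: "ell2_nth (lslice \<xi> j) i = ell2_nth \<xi> (i, j)"
  unfolding lslice_eq_wpull by (subst ell2_nth_wpull[where K = 1]) (auto simp: inj_on_def)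

lemma lslice_swap: "lslice (swap_op \<xi>) i = rslice \<xi> i"
  by (simp add: lslice_def rslice_def)

lemma ell2_nth_rslice [simp]: "ell2_nth (rslice \<xi> i) j = ell2_nth \<xi> (i, j)"
  by (simp flip: lslice_swap)

lemma rslice_swap: "rslice (swap_op \<xi>) i = lslice \<xi> i"
  by (rule ell2_eqI) simp

lemma lslice_eqI: "(\<And>j. lslice \<xi> j = lslice \<eta> j) \<Longrightarrow> \<xi> = \<eta>"
  by (rule ell2_eqI) (metis ell2_nth_lslice surj_pair)

lemma rslice_eqI: "(\<And>i. rslice \<xi> i = rslice \<eta> i) \<Longrightarrow> \<xi> = \<eta>"
  by (rule ell2_eqI) (metis ell2_nth_rslice surj_pair)

lemma bounded_map_lslice: "bounded_map (\<lambda>\<xi>. lslice \<xi> j)"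
  unfolding lslice_eq_wpull by (rule bounded_map_wpull[where K = 1]) (auto simp: inj_on_def)

lemma bounded_map_rslice: "bounded_map (\<lambda>\<xi>. rslice \<xi> i)"
  unfolding lslice_swap[symmetric]
  by (rule bounded_map_compose[OF bounded_map_lslice bounded_map_swap])

lemmas lslice_simps = bounded_mapD[OF bounded_map_lslice]
lemmas rslice_simps = bounded_mapD[OF bounded_map_rslice]

lemma has_sum_norm_lslice: "((\<lambda>j. (norm (lslice \<xi> j))\<^sup>2) has_sum (norm \<xi>)\<^sup>2) UNIV"
proof -
  have "((\<lambda>p. (cmod (ell2_nth (swap_op \<xi>) p))\<^sup>2) has_sum (norm \<xi>)\<^sup>2) (UNIV \<times> UNIV)"
    using has_sum_norm_ell2[of "swap_op \<xi>"] by (simp add: UNIV_Times_UNIV)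
  then show ?thesis
    by (rule has_sum_SigmaD) (use has_sum_norm_ell2[of "lslice \<xi> _"] in simp)
qed

lemma has_sum_norm_rslice: "((\<lambda>i. (norm (rslice \<xi> i))\<^sup>2) has_sum (norm \<xi>)\<^sup>2) UNIV"
  using has_sum_norm_lslice[of "swap_op \<xi>"] by (simp add: lslice_swap)

text \<open>Common form of the two slicewise constructions: a constant family gives
  \<open>amp_left\<close>, and the family \<alpha> (- g) x gives \<open>cp_embed\<close>.\<close>

definition decomposable :: "('j \<Rightarrow> 'i op) \<Rightarrow> ('i \<times> 'j) op" where
  "decomposable X \<xi> = ell2_of (\<lambda>(i, j). ell2_nth (X j (lslice \<xi> j)) i)"

lemma decomposable:
  assumes X: "\<And>j. bounded_op (X j)" and bd: "\<And>j \<eta>. norm (X j \<eta>) \<le> K * norm \<eta>" and K: "0 \<le> K"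
  shows lslice_decomposable: "lslice (decomposable X \<xi>) j = X j (lslice \<xi> j)"
    and bounded_op_decomposable: "bounded_op (decomposable X)"
proof -
  let ?f = "\<lambda>\<xi> (i, j). ell2_nth (X j (lslice \<xi> j)) i"
  have fin: "(\<Sum>p\<in>F. (cmod (?f \<xi> p))\<^sup>2) \<le> (K * norm \<xi>)\<^sup>2" if "finite F" for F \<xi>
  proof -
    \<comment> \<open>F is enlarged to a rectangle so that the sum can be taken slice by
      slice.\<close>
    have "(\<Sum>p\<in>F. (cmod (?f \<xi> p))\<^sup>2) \<le> (\<Sum>p\<in>fst ` F \<times> snd ` F. (cmod (?f \<xi> p))\<^sup>2)"
      by (rule sum_mono2) (use that in \<open>auto intro: rev_image_eqI\<close>)
    also have "\<dots> = (\<Sum>j\<in>snd ` F. \<Sum>i\<in>fst ` F. (cmod (ell2_nth (X j (lslice \<xi> j)) i))\<^sup>2)"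
      by (subst sum.swap) (simp add: sum.cartesian_product case_prod_beta)
    also have "\<dots> \<le> (\<Sum>j\<in>snd ` F. (K * norm (lslice \<xi> j))\<^sup>2)"
      using that by (intro sum_mono order_trans[OF sum_le_norm_ell2] power_mono bd) auto
    also have "\<dots> = K\<^sup>2 * (\<Sum>j\<in>snd ` F. (norm (lslice \<xi> j))\<^sup>2)"
      by (simp add: sum_distrib_left power_mult_distrib)
    also have "\<dots> \<le> K\<^sup>2 * (norm \<xi>)\<^sup>2"
      using that by (intro mult_left_mono finite_sum_le_has_sum[OF has_sum_norm_lslice]) auto
    finally show ?thesis by (simp add: power_mult_distrib)
  qed
  have nth: "ell2_nth (decomposable X \<xi>) = ?f \<xi>" for \<xi>
    unfolding decomposable_def using K by (intro ell2_ofI(1)[OF fin]) auto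
  have norm: "norm (decomposable X \<xi>) \<le> K * norm \<xi>" for \<xi>
    unfolding decomposable_def using K by (intro ell2_ofI(2)[OF fin]) auto
  have sl: "lslice (decomposable X \<xi>) j = X j (lslice \<xi> j)" for \<xi> j
    by (rule ell2_eqI) (simp add: nth)
  then show "lslice (decomposable X \<xi>) j = X j (lslice \<xi> j)" .
  show "bounded_op (decomposable X)" unfolding bounded_op_iff_map
    by (rule bounded_mapI[OF _ _ norm]; rule lslice_eqI)
       (use X in \<open>simp_all add: sl lslice_simps bounded_op_iff_map bounded_mapD\<close>)
qed

lemma unitary_decomposable:
  assumes "\<And>j. unitary_op (X j)"
  shows "unitary_op (decomposable X)"
proof -
  note D = unitary_opD[OF assms]
  note A = unitary_opD[OF unitary_op_adjoint[OF assms]]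
  have sl: "lslice (decomposable X \<xi>) j = X j (lslice \<xi> j)" for \<xi> j
    by (rule lslice_decomposable[where K = 1]) (auto simp: D)
  have sa: "lslice (decomposable (\<lambda>j. adjoint (X j)) \<xi>) j = adjoint (X j) (lslice \<xi> j)" for \<xi> j
    by (rule lslice_decomposable[where K = 1]) (auto simp: A)
  show ?thesis
  proof (rule unitary_opI(1))
    show "bounded_op (decomposable X)"
      by (rule bounded_op_decomposable[where K = 1]) (auto simp: D)
    show "norm (decomposable X \<xi>) = norm \<xi>" for \<xi>
      using has_sum_norm_lslice[of "decomposable X \<xi>"] has_sum_norm_lslice[of \<xi>]
      by (simp add: sl D has_sum_unique power2_eq_imp_eq)
    show "decomposable X (decomposable (\<lambda>j. adjoint (X j)) \<xi>) = \<xi>" for \<xi>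
      by (rule lslice_eqI) (simp add: sl sa D)
  qed
qed

lemma amp_left_eq: "amp_left x = decomposable (\<lambda>_. x)"
  by (simp add: fun_eq_iff amp_left_def decomposable_def lslice_def)

lemma cp_embed_eq: "cp_embed \<alpha> x = decomposable (\<lambda>g. \<alpha> (- g) x)"
  by (simp add: fun_eq_iff cp_embed_def decomposable_def lslice_def)

lemma lslice_amp_left: "bounded_op x \<Longrightarrow> lslice (amp_left x \<xi>) j = x (lslice \<xi> j)"
  and bounded_op_amp_left: "bounded_op x \<Longrightarrow> bounded_op (amp_left x)"
proof -
  assume x: "bounded_op x"
  then obtain K where K: "0 \<le> K" "\<And>\<xi>. norm (x \<xi>) \<le> K * norm \<xi>"
    using bounded_map_bound bounded_op_iff_map by metis
  show "lslice (amp_left x \<xi>) j = x (lslice \<xi> j)"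
    unfolding amp_left_eq by (rule lslice_decomposable[OF x K(2,1)])
  show "bounded_op (amp_left x :: ('a \<times> 'c) op)"
    unfolding amp_left_eq by (rule bounded_op_decomposable[OF x K(2,1)])
qed

lemma amp_right_eq:
  assumes "bounded_op y"
  shows "amp_right y = swap_op \<circ> amp_left y \<circ> swap_op"
proof
  fix \<xi> :: "('b \<times> 'a) ell2"
  have "(\<lambda>(i, j). ell2_nth (y (rslice \<xi> i)) j) = ell2_nth (swap_op (amp_left y (swap_op \<xi>)))"
    using lslice_amp_left[OF assms, of "swap_op \<xi>"]
    by (auto simp: fun_eq_iff lslice_swap) (metis ell2_nth_lslice)
  then show "amp_right y \<xi> = (swap_op \<circ> amp_left y \<circ> swap_op) \<xi>"
    by (simp add: amp_right_def ell2_nth_inverse flip: rslice_def)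
qed

lemma rslice_amp_right: "bounded_op y \<Longrightarrow> rslice (amp_right y \<xi>) i = y (rslice \<xi> i)"
  by (simp add: amp_right_eq rslice_swap lslice_amp_left lslice_swap)

lemma bounded_op_amp_right:
  assumes "bounded_op y"
  shows "bounded_op (amp_right y)"
proof -
  have "bounded_map (amp_left y :: ('a \<times> 'b) op)"
    using bounded_op_amp_left[OF assms] by (simp add: bounded_op_iff_map)
  then show ?thesis
    unfolding amp_right_eq[OF assms] bounded_op_iff_map
    by (intro bounded_map_compose(2) bounded_map_swap)
qed

lemma unitary_amp_left: "unitary_op x \<Longrightarrow> unitary_op (amp_left x)"
  unfolding amp_left_eq by (rule unitary_decomposable)

lemma unitary_amp_right:
  assumes "unitary_op y"
  shows "unitary_op (amp_right y)"
proof -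
  note D = unitary_opD[OF unitary_amp_left[OF assms]]
  show ?thesis
    by (rule unitary_opI(1)[OF bounded_op_amp_right,
          where y = "swap_op \<circ> adjoint (amp_left y) \<circ> swap_op"])
       (simp_all add: unitary_opD(1)[OF assms] amp_right_eq D)
qed

lemma ell2_nth_wpull_one: "inj f \<Longrightarrow> ell2_nth (wpull f (\<lambda>_. 1) \<xi>) j = ell2_nth \<xi> (f j)"
  using ell2_nth_wpull[of f "\<lambda>_. 1" 1] by auto

section \<open>Left and right translations of the group coordinate\<close>

lemma cp_unitary_eq: "cp_unitary h = wpull (\<lambda>(i, g). (i, - h + g)) (\<lambda>_. 1)"
  by (auto simp: fun_eq_iff cp_unitary_def wpull_def intro!: arg_cong[of _ _ ell2_of])

lemma bij_cp_unitary: "bij (\<lambda>(i, g). (i, - h + g :: 'g :: group_add))"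
  by (rule bij_betw_byWitness[where f' = "\<lambda>(i, g). (i, h + g)"]) (auto simp: add.assoc[symmetric])

lemma ell2_nth_cp_unitary [simp]: "ell2_nth (cp_unitary h \<xi>) (i, g) = ell2_nth \<xi> (i, - h + g)"
  using ell2_nth_wpull_one[OF bij_is_inj[OF bij_cp_unitary], of h \<xi> "(i, g)"]
  by (simp add: cp_unitary_eq)

lemma unitary_cp_unitary: "unitary_op (cp_unitary h)"
  unfolding cp_unitary_eq by (rule unitary_wpull(1)[OF bij_cp_unitary]) simp

lemma adjoint_cp_unitary: "adjoint (cp_unitary h) = cp_unitary (- h)"
  by (rule unitary_opI(2)[OF unitary_opD(1,5)[OF unitary_cp_unitary]], rule ell2_eqI)
     (auto simp: add.assoc[symmetric] split_paired_all)

lemma cp_unitary_ket: "cp_unitary h (ket (i, g)) = ket (i, h + g)"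
  by (rule ell2_eqI) (auto simp: ell2_nth_ket split_paired_all add.assoc[symmetric])

text \<open>The rho_k of the overview: a homomorphism in k that sends \<open>ket a\<close> to
  \<open>ket (a - k)\<close>.\<close>

definition rtrans :: "'g :: group_add \<Rightarrow> 'g ell2 \<Rightarrow> 'g ell2" where
  "rtrans k = wpull (\<lambda>g. g + k) (\<lambda>_. 1)"

lemma bij_rtrans: "bij (\<lambda>g. g + k :: 'g :: group_add)"
  by (rule bij_betw_byWitness[where f' = "\<lambda>g. g - k"]) auto

lemma ell2_nth_rtrans [simp]: "ell2_nth (rtrans k \<xi>) g = ell2_nth \<xi> (g + k)"
  unfolding rtrans_def by (rule ell2_nth_wpull_one[OF bij_is_inj[OF bij_rtrans]])

lemma unitary_rtrans: "unitary_op (rtrans k)"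
  unfolding rtrans_def by (rule unitary_wpull(1)[OF bij_rtrans]) simp

lemma rtrans_rtrans: "rtrans k (rtrans l \<xi>) = rtrans (k + l) \<xi>"
  by (rule ell2_eqI) (simp add: add.assoc)

lemma lslice_cp_unitary: "lslice (cp_unitary h \<xi>) g = lslice \<xi> (- h + g)"
  by (rule ell2_eqI) simp

lemma lslice_amp_right_rtrans: "lslice (amp_right (rtrans k) \<xi>) g = lslice \<xi> (g + k)"
  by (rule ell2_eqI)
     (metis ell2_nth_lslice ell2_nth_rslice ell2_nth_rtrans rslice_amp_right unitary_opD(1) unitary_rtrans)

section \<open>Matrices and the tensor product\<close>

lemma ell2_nth_mat_op [simp]: "ell2_nth (mat_op A \<xi>) i = (\<Sum>j\<in>UNIV. A $ i $ j * ell2_nth \<xi> j)"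
  unfolding mat_op_def by (subst ell2_nth_of) (auto intro: summable_on_finite)

lemma bounded_op_mat_op: "bounded_op (mat_op A)"
proof -
  let ?w = "\<lambda>j i' i. if i = i' then A $ i $ j else 0"
  have w: "inj_on (\<lambda>_ :: 2. j) {i. ?w j i' i \<noteq> 0}" "cmod (?w j i' i) \<le> (\<Sum>i\<in>UNIV. cmod (A $ i $ j))" for i' i j
    by (auto simp: inj_on_def sum_nonneg intro: member_le_sum split: if_splits)
  have "mat_op A = (\<lambda>\<xi>. \<Sum>j\<in>UNIV. \<Sum>i'\<in>UNIV. wpull (\<lambda>_. j) (?w j i') \<xi>)"
    by (intro ext ell2_eqI)
       (simp add: ell2_nth_sum ell2_nth_wpull[OF w], simp add: if_distrib[of "\<lambda>x. x * _"] cong: if_cong)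
  then show ?thesis unfolding bounded_op_iff_map
    by (simp add: bounded_map_sum bounded_map_wpull[OF w])
qed

lemma inner_ell2_finite: "\<xi> \<bullet> \<eta> = (\<Sum>i\<in>UNIV. ell2_nth \<xi> i \<bullet> ell2_nth (\<eta> :: 'i :: finite ell2) i)"
  by (rule has_sum_unique[OF has_sum_inner_ell2]) simp

lemma adjoint_mat_op: "adjoint (mat_op A) = mat_op (dagger A)"
  by (rule adjoint_unique)
     (simp add: inner_ell2_finite sum_2 dagger_def inner_complex_def algebra_simps)

lemma mat_op_mult: "mat_op (A ** B) \<xi> = mat_op A (mat_op B \<xi>)"
  by (rule ell2_eqI) (simp add: matrix_matrix_mult_def sum_2 algebra_simps)

lemma mat_op_inj: "mat_op A = mat_op B \<longleftrightarrow> A = B"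
proof
  assume "mat_op A = mat_op B"
  then have "ell2_nth (mat_op A (ket j)) i = ell2_nth (mat_op B (ket j)) i" for i j by simp
  then show "A = B"
    by (simp add: vec_eq_iff ell2_nth_ket if_distrib[of "\<lambda>x. _ * x"] cong: if_cong)
qed simp

lemma mat_op_one: "mat_op (mat 1) \<xi> = \<xi>"
  by (rule ell2_eqI) (simp add: mat_def if_distrib[of "\<lambda>x. x * _"] cong: if_cong)

lemma Ad_mat_op: "Ad (mat_op V) (mat_op A) = mat_op (V ** A ** dagger V)"
  by (simp add: Ad_def adjoint_mat_op fun_eq_iff mat_op_mult)

lemma unitary_mat_op:
  assumes "V ** dagger V = mat 1" "dagger V ** V = mat 1"
  shows "unitary_op (mat_op V)"
  using assms by (auto simp: unitary_op_def bounded_op_mat_op adjoint_mat_op fun_eq_iff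
    simp flip: mat_op_mult intro: mat_op_one)

lemma rslice_amp_left_mat_op: "rslice (amp_left (mat_op A) \<xi>) a = (\<Sum>b\<in>UNIV. A $ a $ b *\<^sub>C rslice \<xi> b)"
proof (rule ell2_eqI)
  fix s
  have "ell2_nth (rslice (amp_left (mat_op A) \<xi>) a) s = ell2_nth (lslice (amp_left (mat_op A) \<xi>) s) a"
    by simp
  then show "ell2_nth (rslice (amp_left (mat_op A) \<xi>) a) s
      = ell2_nth (\<Sum>b\<in>UNIV. A $ a $ b *\<^sub>C rslice \<xi> b) s"
    unfolding lslice_amp_left[OF bounded_op_mat_op] by (simp add: ell2_nth_sum)
qed

lemma bounded_op_tensor: "bounded_op x \<Longrightarrow> bounded_op y \<Longrightarrow> bounded_op (x \<otimes>\<^sub>o y)"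
  by (simp add: tensor_op_def bounded_op_compose bounded_op_amp_left bounded_op_amp_right)

lemma rslice_tensor:
  "bounded_op y \<Longrightarrow> rslice ((mat_op A \<otimes>\<^sub>o y) \<xi>) a = (\<Sum>b\<in>UNIV. A $ a $ b *\<^sub>C y (rslice \<xi> b))"
  by (simp add: tensor_op_def rslice_amp_left_mat_op rslice_amp_right)

lemma tensor_compose:
  assumes "bounded_op x" "bounded_op y"
  shows "(mat_op A \<otimes>\<^sub>o x) \<circ> (mat_op B \<otimes>\<^sub>o y) = mat_op (A ** B) \<otimes>\<^sub>o (x \<circ> y)"
  using assms bounded_op_compose[OF assms]
  by (intro ext rslice_eqI)
     (simp add: rslice_tensor bounded_mapD bounded_op_iff_map matrix_matrix_mult_def sum_2 scaleC_simps)

lemma unitary_tensor: "unitary_op x \<Longrightarrow> unitary_op y \<Longrightarrow> unitary_op (x \<otimes>\<^sub>o y)"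
  by (simp add: tensor_op_def unitary_op_compose unitary_amp_left unitary_amp_right)

section \<open>The infinite tensor product\<close>

lemma update_update:
  "Poly_Mapping.update g k (Poly_Mapping.update g l s) = Poly_Mapping.update g k s"
  "g \<noteq> h \<Longrightarrow> Poly_Mapping.update g k (Poly_Mapping.update h l s)
    = Poly_Mapping.update h l (Poly_Mapping.update g k s)"
  by (rule poly_mapping_eqI, auto simp: lookup_update)+

lemma update_lookup: "Poly_Mapping.update g (Poly_Mapping.lookup s g) s = s"
  by (rule poly_mapping_eqI) (simp add: lookup_update)

definition site_coeff :: "mat2 \<Rightarrow> pauli \<Rightarrow> pauli \<Rightarrow> complex" where
  "site_coeff A j k = ntr (dagger (pauli_mat j) ** A ** pauli_mat k)"

text \<open>For fixed j and k, overwriting the entry at g by k is injective on the strings whose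
  entry there is j. The operator is therefore a finite sum of weighted pullbacks.\<close>

lemma site_op:
  shows ell2_nth_site_op: "ell2_nth (site_op g A \<xi>) s
      = (\<Sum>k\<in>UNIV. site_coeff A (Poly_Mapping.lookup s g) k * ell2_nth \<xi> (Poly_Mapping.update g k s))"
    and bounded_op_site_op: "bounded_op (site_op g A)"
proof -
  let ?w = "\<lambda>j k s. if Poly_Mapping.lookup s g = j then site_coeff A j k else 0"
  have w: "inj_on (Poly_Mapping.update g k) {s. ?w j k s \<noteq> 0}"
    "cmod (?w j k s) \<le> cmod (site_coeff A j k)" for j k s
    by (auto simp: inj_on_def split: if_splits) (metis update_lookup update_update(1))
  let ?T = "\<lambda>\<xi>. \<Sum>k\<in>UNIV. \<Sum>j\<in>UNIV. wpull (Poly_Mapping.update g k) (?w j k) \<xi>"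
  have nth: "ell2_nth (?T \<xi>) = (\<lambda>s. \<Sum>k\<in>UNIV. site_coeff A (Poly_Mapping.lookup s g) k
      * ell2_nth \<xi> (Poly_Mapping.update g k s))" for \<xi>
    by (rule ext, simp add: ell2_nth_sum ell2_nth_wpull[OF w],
        simp add: if_distrib[of "\<lambda>x. x * _"] cong: if_cong)
  have eq: "site_op g A \<xi> = ?T \<xi>" for \<xi>
    unfolding site_op_def site_coeff_def[symmetric] nth[symmetric] by (rule ell2_nth_inverse)
  show "ell2_nth (site_op g A \<xi>) s
      = (\<Sum>k\<in>UNIV. site_coeff A (Poly_Mapping.lookup s g) k * ell2_nth \<xi> (Poly_Mapping.update g k s))"
    by (simp only: eq nth)
  show "bounded_op (site_op g A)"
    unfolding bounded_op_iff_map eq[abs_def] by (intro bounded_map_sum bounded_map_wpull[OF w])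
qed

section \<open>Right multiplication by Pauli matrices\<close>

fun pauli_mult :: "pauli \<Rightarrow> pauli \<Rightarrow> pauli" where
  "pauli_mult Pauli1 p = p"
| "pauli_mult p Pauli1 = p"
| "pauli_mult PauliX PauliX = Pauli1"
| "pauli_mult PauliY PauliY = Pauli1"
| "pauli_mult PauliZ PauliZ = Pauli1"
| "pauli_mult PauliX PauliY = PauliZ"
| "pauli_mult PauliY PauliX = PauliZ"
| "pauli_mult PauliX PauliZ = PauliY"
| "pauli_mult PauliZ PauliX = PauliY"
| "pauli_mult PauliY PauliZ = PauliX"
| "pauli_mult PauliZ PauliY = PauliX"

lemma pauli_mult_mult [simp]: "pauli_mult (pauli_mult j p) p = j"
  by (cases j; cases p) simp_all

text \<open>Up to a phase, Pauli matrices multiply as the Klein four-group \<open>pauli_mult\<close>;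
  \<open>pauli_phase j p\<close> is the scalar \<open>c\<close> with \<open>\<sigma>\<^sub>k \<sigma>\<^sub>p = c \<sigma>\<^sub>j\<close> for
  \<open>k = pauli_mult j p\<close>.  Hence \<open>pauli_right g p\<close> is right multiplication by \<open>\<sigma>\<^sub>p\<close> at the site
  \<open>g\<close>, a unitary in the commutant of \<open>hyperfinite_R\<close>.\<close>

definition pauli_phase :: "pauli \<Rightarrow> pauli \<Rightarrow> complex" where
  "pauli_phase j p = ntr (pauli_mat j ** pauli_mat (pauli_mult j p) ** pauli_mat p)"

lemmas mat2_simps = ntr_def dagger_def trace_def matrix_matrix_mult_def sum_2 mat_def

lemma norm_pauli_phase [simp]: "cmod (pauli_phase j p) = 1"
  by (cases j; cases p) (simp_all add: pauli_phase_def mat2_simps)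

lemma pauli_phase_same [simp]: "pauli_phase p p = 1"
  by (cases p) (simp_all add: pauli_phase_def mat2_simps)

text \<open>Associativity of matrix multiplication in Pauli coordinates: left multiplication by A
  commutes with right multiplication by sigma_p.\<close>

lemma site_coeff_commute:
  "pauli_phase j p * site_coeff A (pauli_mult j p) k
    = site_coeff A j (pauli_mult k p) * pauli_phase (pauli_mult k p) p"
  by (cases j; cases p; cases k) (simp_all add: pauli_phase_def site_coeff_def mat2_simps algebra_simps)

definition pauli_right :: "'g \<Rightarrow> pauli \<Rightarrow> ('g \<Rightarrow>\<^sub>0 pauli) op" where
  "pauli_right g p = wpull (\<lambda>s. Poly_Mapping.update g (pauli_mult (Poly_Mapping.lookup s g) p) s)
     (\<lambda>s. pauli_phase (Poly_Mapping.lookup s g) p)"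

lemma bij_pauli_right:
  "bij (\<lambda>s. Poly_Mapping.update g (pauli_mult (Poly_Mapping.lookup s g) p) s)"
  by (rule bij_betw_byWitness[where
        f' = "\<lambda>s. Poly_Mapping.update g (pauli_mult (Poly_Mapping.lookup s g) p) s"])
     (auto simp: lookup_update update_update update_lookup)

lemma unitary_pauli_right: "unitary_op (pauli_right g p)"
  unfolding pauli_right_def by (rule unitary_wpull(1)[OF bij_pauli_right]) simp

lemma ell2_nth_pauli_right:
  "ell2_nth (pauli_right g p \<xi>) s = pauli_phase (Poly_Mapping.lookup s g) p
    * ell2_nth \<xi> (Poly_Mapping.update g (pauli_mult (Poly_Mapping.lookup s g) p) s)"
  unfolding pauli_right_def
  by (rule ell2_nth_wpull[where K = 1]) (auto intro: inj_on_subset[OF bij_is_inj[OF bij_pauli_right]])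

lemma pauli_right_site_op: "pauli_right g p \<circ> site_op h A = site_op h A \<circ> pauli_right g p"
proof (intro ext ell2_eqI)
  fix \<xi> and s :: "'a \<Rightarrow>\<^sub>0 pauli"
  let ?l = "Poly_Mapping.lookup s g"
  show "ell2_nth ((pauli_right g p \<circ> site_op h A) \<xi>) s = ell2_nth ((site_op h A \<circ> pauli_right g p) \<xi>) s"
  proof (cases "g = h")
    case True
    have "(\<Sum>k\<in>UNIV. pauli_phase ?l p * (site_coeff A (pauli_mult ?l p) k * ell2_nth \<xi> (Poly_Mapping.update g k s)))
      = (\<Sum>k\<in>UNIV. site_coeff A ?l k * (pauli_phase k p * ell2_nth \<xi> (Poly_Mapping.update g (pauli_mult k p) s)))"
      by (rule sum.reindex_bij_witness[where i = "\<lambda>k. pauli_mult k p" and j = "\<lambda>k. pauli_mult k p"])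
         (simp_all add: site_coeff_commute flip: mult.assoc)
    then show ?thesis
      using True by (simp add: ell2_nth_site_op ell2_nth_pauli_right lookup_update update_update sum_distrib_left)
  next
    case False
    then show ?thesis
      by (simp add: ell2_nth_site_op ell2_nth_pauli_right lookup_update update_update(2)[of h g]
          sum_distrib_left mult_ac)
  qed
qed

lemma pauli_right_commutes:
  assumes "y \<in> hyperfinite_R"
  shows "y \<circ> pauli_right g p = pauli_right g p \<circ> y"
  using assms unfolding hyperfinite_R_def
  by (rule vn_generated_commutes_unitary[OF _ unitary_pauli_right])
     (auto simp: bounded_op_site_op pauli_right_site_op)

section \<open>The Bernoulli shift\<close>

lemma lookup_map_key_plus [simp]:
  "Poly_Mapping.lookup (Poly_Mapping.map_key (\<lambda>g. h + g) s) g = Poly_Mapping.lookup s (h + g :: 'g :: group_add)"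
  by (subst map_key.rep_eq) (auto simp: inj_on_def)

lemma bij_map_key_plus: "bij (Poly_Mapping.map_key (\<lambda>g. h + g :: 'g :: group_add))"
  by (rule bij_betw_byWitness[where f' = "Poly_Mapping.map_key (\<lambda>g. - h + g)"])
     (auto intro!: poly_mapping_eqI simp: add.assoc[symmetric])

lemma unitary_shift_op: "unitary_op (shift_op h)"
proof -
  have "shift_op h = wpull (Poly_Mapping.map_key (\<lambda>g. h + g)) (\<lambda>_. 1)"
    by (simp add: fun_eq_iff shift_op_def wpull_def)
  then show ?thesis using unitary_wpull(1)[OF bij_map_key_plus, of "\<lambda>_. 1" h] by simp
qed

lemma ell2_nth_shift_op [simp]:
  "ell2_nth (shift_op h \<xi>) s = ell2_nth \<xi> (Poly_Mapping.map_key (\<lambda>g. h + g) s)"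
proof -
  have "shift_op h \<xi> = wpull (Poly_Mapping.map_key (\<lambda>g. h + g)) (\<lambda>_. 1) \<xi>"
    by (simp add: shift_op_def wpull_def)
  then show ?thesis using ell2_nth_wpull_one[OF bij_is_inj[OF bij_map_key_plus], of h] by simp
qed

section \<open>Tensoring with the two-by-two matrices\<close>

lemma has_sum_inner_rslice: "((\<lambda>i. rslice \<xi> i \<bullet> rslice \<eta> i) has_sum \<xi> \<bullet> \<eta>) UNIV"
proof -
  have "((\<lambda>p. ell2_nth \<xi> p \<bullet> ell2_nth \<eta> p) has_sum \<xi> \<bullet> \<eta>) (UNIV \<times> UNIV)"
    using has_sum_inner_ell2[of \<xi> \<eta>] by (simp add: UNIV_Times_UNIV)
  then show ?thesis
    by (rule has_sum_SigmaD) (use has_sum_inner_ell2[of "rslice \<xi> _" "rslice \<eta> _"] in simp)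
qed

lemma adjoint_amp_right:
  assumes "bounded_op y"
  shows "adjoint (amp_right y) = amp_right (adjoint y)"
proof (rule adjoint_unique, intro allI)
  fix \<xi> \<eta>
  have "rslice (amp_right y \<xi>) i \<bullet> rslice \<eta> i = rslice \<xi> i \<bullet> rslice (amp_right (adjoint y) \<eta>) i" for i
    using assms by (simp add: rslice_amp_right bounded_op_adjoint adjoint_inner)
  then show "amp_right y \<xi> \<bullet> \<eta> = \<xi> \<bullet> amp_right (adjoint y) \<eta>"
    using has_sum_inner_rslice[of "amp_right y \<xi>" \<eta>] has_sum_inner_rslice[of \<xi> "amp_right (adjoint y) \<eta>"]
    by (simp add: has_sum_unique)
qed

definition rinj :: "'i \<Rightarrow> 'j ell2 \<Rightarrow> ('i \<times> 'j) ell2" where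
  "rinj i = wpull snd (\<lambda>p. if fst p = i then 1 else 0)"

lemma rinj:
  fixes i :: 'i and \<eta> :: "'j ell2"
  shows ell2_nth_rinj: "ell2_nth (rinj i \<eta>) (i', j) = (if i' = i then ell2_nth \<eta> j else 0)"
    and bounded_map_rinj: "bounded_map (rinj i :: 'j ell2 \<Rightarrow> ('i \<times> 'j) ell2)"
proof -
  let ?w = "\<lambda>p :: 'i \<times> 'j. if fst p = i then 1 else (0 :: complex)"
  have w: "inj_on snd {p. ?w p \<noteq> 0}" "cmod (?w p) \<le> 1" for p
    by (auto simp: inj_on_def)
  show "ell2_nth (rinj i \<eta>) (i', j) = (if i' = i then ell2_nth \<eta> j else 0)"
    unfolding rinj_def using ell2_nth_wpull[OF w, of \<eta> "(i', j)"] by simp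
  show "bounded_map (rinj i :: 'j ell2 \<Rightarrow> ('i \<times> 'j) ell2)"
    unfolding rinj_def by (rule bounded_map_wpull[OF w])
qed

lemma rslice_rinj: "rslice (rinj i \<eta>) i' = (if i' = i then \<eta> else 0)"
  by (rule ell2_eqI) (simp add: ell2_nth_rinj)

definition mat_unit :: "2 \<Rightarrow> 2 \<Rightarrow> mat2" where
  "mat_unit i j = (\<chi> a b. if a = i \<and> b = j then 1 else 0)"

lemma rslice_mat_unit_tensor:
  "bounded_op y \<Longrightarrow> rslice ((mat_op (mat_unit i j) \<otimes>\<^sub>o y) \<xi>) a = (if a = i then y (rslice \<xi> j) else 0)"
  by (simp add: rslice_tensor mat_unit_def if_distrib[of "\<lambda>x. x *\<^sub>C _"] scaleC_simps cong: if_cong)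

lemma vn_generated_add:
  assumes "x \<in> vn_generated S" "y \<in> vn_generated S"
  shows "(\<lambda>\<xi>. x \<xi> + y \<xi>) \<in> vn_generated S"
  using assms unfolding vn_generated_def by (intro commutant_add) (auto dest: commutant_bounded)

lemma vn_tensor_M2_bounded: "y \<in> vn_generated S \<Longrightarrow> bounded_op (mat_op A \<otimes>\<^sub>o y)"
  by (intro bounded_op_tensor bounded_op_mat_op vn_generated_bounded)

lemma tensor_in_vn_tensor: "y \<in> vn_generated S \<Longrightarrow> mat_op A \<otimes>\<^sub>o y \<in> vn_tensor M2 (vn_generated S)"
  unfolding vn_tensor_def
  by (rule subsetD[OF vn_generated_superset]) (auto simp: M2_def vn_tensor_M2_bounded)

lemma amp_right_commutes_vn_tensor:
  assumes z: "z \<in> vn_tensor M2 (vn_generated S)" and r: "r \<in> commutant (S \<union> adjoint ` S)"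
    and S: "\<And>y. y \<in> S \<Longrightarrow> bounded_op y"
  shows "z \<circ> amp_right r = amp_right r \<circ> z"
proof -
  note rb = commutant_bounded[OF r]
  have ar: "adjoint r \<in> commutant (S \<union> adjoint ` S)"
  proof -
    have "adjoint r \<circ> y = y \<circ> adjoint r" if y: "y \<in> S" for y
      using commutes_adjoint[OF rb bounded_op_adjoint[OF S[OF y]]] commutantD[OF r, of "adjoint y"] y
        adjoint_adjoint_op[OF S[OF y]] by auto
    moreover have "adjoint r \<circ> adjoint y = adjoint y \<circ> adjoint r" if y: "y \<in> S" for y
      using commutes_adjoint[OF rb S[OF y]] commutantD[OF r, of y] y by auto
    ultimately show ?thesis using bounded_op_adjoint[OF rb] by (auto simp: commutant_def)
  qed
  have comm: "amp_right t \<circ> (mat_op A \<otimes>\<^sub>o y) = (mat_op A \<otimes>\<^sub>o y) \<circ> amp_right t"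
    if t: "t \<in> commutant (S \<union> adjoint ` S)" and y: "y \<in> vn_generated S" for t y A
  proof (intro ext rslice_eqI)
    fix \<xi> a
    have "y (t \<eta>) = t (y \<eta>)" for \<eta>
      using commutantD[OF y[unfolded vn_generated_def] t] by (metis comp_apply)
    then show "rslice ((amp_right t \<circ> (mat_op A \<otimes>\<^sub>o y)) \<xi>) a = rslice (((mat_op A \<otimes>\<^sub>o y) \<circ> amp_right t) \<xi>) a"
      using commutant_bounded[OF t] vn_generated_bounded[OF y]
      by (simp add: rslice_amp_right rslice_tensor bounded_mapD bounded_op_iff_map)
  qed
  show ?thesis
    using z unfolding vn_tensor_def
    by (rule vn_generated_commutes)
       (auto simp: bounded_op_amp_right rb adjoint_amp_right M2_def comm r ar vn_tensor_M2_bounded)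
qed

text \<open>A von Neumann tensor product with \<open>M2\<close> is algebraic: its elements are sums of four matrix
  units tensored with elements of the other factor.  This makes an automorphism of it determined by its values
  on elementary tensors, without any appeal to normality.\<close>

lemma vn_tensor_M2_induct:
  fixes S :: "'i op set"
  assumes z: "z \<in> vn_tensor M2 (vn_generated S)" and S: "\<And>y. y \<in> S \<Longrightarrow> bounded_op y"
    and tensor: "\<And>A y. y \<in> vn_generated S \<Longrightarrow> P (mat_op A \<otimes>\<^sub>o y)"
    and add: "\<And>x y. x \<in> vn_tensor M2 (vn_generated S) \<Longrightarrow> y \<in> vn_tensor M2 (vn_generated S) \<Longrightarrow>
      P x \<Longrightarrow> P y \<Longrightarrow> P (\<lambda>\<xi>. x \<xi> + y \<xi>)"
  shows "P z"
proof -
  have zb: "bounded_map z"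
    using z vn_generated_bounded by (auto simp: vn_tensor_def bounded_op_iff_map)
  define y where "y i j = (\<lambda>\<eta>. rslice (z (rinj j \<eta>)) i)" for i j
  have yb: "bounded_op (y i j)" for i j
    unfolding y_def bounded_op_iff_map
    by (intro bounded_map_compose(1)[OF bounded_map_rslice] bounded_map_compose(1)[OF zb bounded_map_rinj])
  have y: "y i j \<in> vn_generated S" for i j
  proof -
    have "y i j \<circ> r = r \<circ> y i j" if r: "r \<in> commutant (S \<union> adjoint ` S)" for r
    proof
      fix \<eta>
      note rb = commutant_bounded[OF r]
      have "rinj j (r \<eta>) = amp_right r (rinj j \<eta>)"
        using rb by (intro rslice_eqI)
          (simp add: rslice_rinj rslice_amp_right bounded_op_iff_map bounded_mapD)
      moreover have "z (amp_right r \<zeta>) = amp_right r (z \<zeta>)" for \<zeta>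
        using amp_right_commutes_vn_tensor[OF z r S] by (metis comp_apply)
      ultimately show "(y i j \<circ> r) \<eta> = (r \<circ> y i j) \<eta>"
        by (simp add: y_def rslice_amp_right[OF rb])
    qed
    then show ?thesis using yb by (auto simp: vn_generated_def commutant_def[of "commutant _"])
  qed
  let ?E = "\<lambda>i j. mat_op (mat_unit i j) \<otimes>\<^sub>o y i j"
  have eq: "z = (\<lambda>\<xi>. (?E 1 1 \<xi> + ?E 1 2 \<xi>) + (?E 2 1 \<xi> + ?E 2 2 \<xi>))"
  proof (intro ext rslice_eqI)
    fix \<xi> :: "(2 \<times> 'i) ell2" and a
    have "\<xi> = (\<Sum>b\<in>UNIV. rinj b (rslice \<xi> b))"
      by (rule ell2_eqI) (auto simp: ell2_nth_sum ell2_nth_rinj cong: if_cong)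
    then have "z \<xi> = z (\<Sum>b\<in>UNIV. rinj b (rslice \<xi> b))" by simp
    then have "rslice (z \<xi>) a = (\<Sum>b\<in>UNIV. y a b (rslice \<xi> b))"
      by (simp add: bounded_mapD[OF zb] rslice_simps y_def)
    moreover have "a = 1 \<or> a = 2" by (rule exhaust_2)
    ultimately show "rslice (z \<xi>) a = rslice ((?E 1 1 \<xi> + ?E 1 2 \<xi>) + (?E 2 1 \<xi> + ?E 2 2 \<xi>)) a"
      by (auto simp: rslice_simps rslice_mat_unit_tensor[OF yb] sum_2)
  qed
  have in_t: "?E i j \<in> vn_tensor M2 (vn_generated S)" for i j
    by (rule tensor_in_vn_tensor[OF y])
  have plus: "(\<lambda>\<xi>. x \<xi> + x' \<xi>) \<in> vn_tensor M2 (vn_generated S)"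
    if "x \<in> vn_tensor M2 (vn_generated S)" "x' \<in> vn_tensor M2 (vn_generated S)" for x x'
    using that unfolding vn_tensor_def by (rule vn_generated_add)
  show ?thesis
    unfolding eq by (intro add plus in_t tensor y)
qed

section \<open>The group von Neumann algebra\<close>

text \<open>The adjoint of a group unitary is again a group unitary, so commuting with the
  generators already puts t in the relevant commutant.\<close>

lemma group_vn_commutes:
  assumes "y \<in> group_vn" "bounded_op t" "\<And>h. t \<circ> cp_unitary h = cp_unitary h \<circ> t"
  shows "y \<circ> t = t \<circ> y"
proof -
  have "t \<in> commutant (range cp_unitary \<union> adjoint ` range cp_unitary)"
    using assms(2,3) by (auto simp: commutant_def adjoint_cp_unitary)
  then show ?thesis
    using assms(1) unfolding group_vn_def vn_generated_def by (rule commutantD[rotated])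
qed

lemma group_vn_bounded: "y \<in> group_vn \<Longrightarrow> bounded_op y"
  by (simp add: group_vn_def vn_generated_bounded)

lemma group_vn_rtrans:
  assumes "y \<in> group_vn"
  shows "y (amp_right (rtrans k) \<xi>) = amp_right (rtrans k) (y \<xi>)"
proof -
  have "y \<circ> amp_right (rtrans k) = amp_right (rtrans k) \<circ> y"
    by (rule group_vn_commutes[OF assms bounded_op_amp_right[OF unitary_opD(1)[OF unitary_rtrans]]])
       (rule ext, rule lslice_eqI, simp add: lslice_amp_right_rtrans lslice_cp_unitary add.assoc)
  then show ?thesis by (metis comp_apply)
qed

text \<open>\<open>rinj i\<close> after the slice at \<open>i'\<close> is a matrix unit on the first
  tensor factor, whereas the group unitaries act on the second.\<close>

lemma group_vn_move:
  assumes "y \<in> group_vn"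
  shows "y (rinj i (rslice \<xi> i')) = rinj i (rslice (y \<xi>) i')"
proof -
  have "y \<circ> (\<lambda>\<xi>. rinj i (rslice \<xi> i')) = (\<lambda>\<xi>. rinj i (rslice \<xi> i')) \<circ> y"
    by (rule group_vn_commutes[OF assms])
       (auto simp: bounded_op_iff_map ell2_nth_rinj fun_eq_iff
         intro!: bounded_map_compose(1)[OF bounded_map_rinj bounded_map_rslice] ell2_eqI)
  then show ?thesis by (metis comp_apply)
qed

lemma ket_pair: "ket (i, a) = rinj i (ket a)"
  by (rule ell2_eqI) (auto simp: ell2_nth_ket ell2_nth_rinj split_paired_all)

lemma rslice_ket: "rslice (ket (i, a)) i' = (if i' = i then ket a else 0)"
  by (simp add: ket_pair rslice_rinj)

lemma rtrans_ket: "rtrans k (ket a) = ket (a - k)"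
  by (rule ell2_eqI) (auto simp: ell2_nth_ket)

text \<open>Every basis vector arises from a single one by changing the fibre and translating on the
  right, and y commutes with both. So y is left convolution by c on each fibre; the base fibre
  \<open>undefined\<close> is an arbitrary one.\<close>

lemma group_vn_entries:
  fixes y :: "('i \<times> 'g :: group_add) op"
  assumes "y \<in> group_vn"
  obtains c where "\<And>i a i' b. ell2_nth (y (ket (i, a))) (i', b) = (if i' = i then c (b - a) else 0)"
proof -
  let ?u = "undefined :: 'i"
  define c where "c g = ell2_nth (y (ket (?u, 0))) (?u, g)" for g
  have "ell2_nth (y (ket (i, a))) (i', b) = (if i' = i then c (b - a) else 0)" for i a i' b
  proof -
    have "ket (i, a) = rinj i (rslice (amp_right (rtrans (- a)) (ket (?u, 0))) ?u)"
      by (simp add: rslice_amp_right unitary_opD(1) unitary_rtrans rslice_ket rtrans_ket flip: ket_pair)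
    then have "y (ket (i, a)) = rinj i (rslice (amp_right (rtrans (- a)) (y (ket (?u, 0)))) ?u)"
      by (simp add: group_vn_move[OF assms] group_vn_rtrans[OF assms])
    then show ?thesis
      by (simp add: ell2_nth_rinj rslice_amp_right unitary_opD(1) unitary_rtrans c_def
          del: ell2_nth_rslice)
         (simp add: c_def)
  qed
  then show ?thesis by (rule that)
qed

lemma has_sum_pair_fst:
  assumes "(f has_sum S) (UNIV :: ('i \<times> 'j) set)" and "\<And>l t. l \<noteq> i \<Longrightarrow> f (l, t) = 0"
  shows "((\<lambda>t. f (i, t)) has_sum S) UNIV"
proof -
  have "(f has_sum S) (range (Pair i))"
    using assms(1) by (subst (asm) has_sum_cong_neutral[where T = "range (Pair i)"]) (use assms(2) in auto)
  then show ?thesis by (subst (asm) has_sum_reindex) (auto simp: inj_on_def comp_def)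
qed

text \<open>The converse of \<open>group_vn_entries\<close>: bounded left convolution operators lie
  in the bicommutant. An operator z commuting with left translations has translation-invariant
  entries, which makes the entries of y z and z y agree after a change of summation
  variable.\<close>

lemma group_vnI:
  fixes y :: "('i \<times> 'g :: group_add) op"
  assumes y: "bounded_op y"
    and c: "\<And>i a i' b. ell2_nth (y (ket (i, a))) (i', b) = (if i' = i then c (b - a) else 0)"
  shows "y \<in> group_vn"
proof -
  have ym: "bounded_map y" using y by (simp add: bounded_op_iff_map)
  have "y \<circ> z = z \<circ> y" if z: "z \<in> commutant (range cp_unitary \<union> adjoint ` range cp_unitary)" for z
  proof (rule bounded_map_eqI)
    have zm: "bounded_map z" using commutant_bounded[OF z] by (simp add: bounded_op_iff_map)
    show "bounded_map (y \<circ> z)" "bounded_map (z \<circ> y)" using ym zm by (simp_all add: bounded_map_compose(2))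
    fix p :: "'i \<times> 'g"
    obtain i a where p: "p = (i, a)" by (cases p)
    have inv: "ell2_nth (z (ket (l, h + s))) (i', h + t) = ell2_nth (z (ket (l, s))) (i', t)" for l s i' t h
    proof -
      have "z (cp_unitary h (ket (l, s))) = cp_unitary h (z (ket (l, s)))"
        using commutantD[OF z, of "cp_unitary h"] by (auto simp: fun_eq_iff)
      then show ?thesis by (simp add: cp_unitary_ket add.assoc[symmetric])
    qed
    show "(y \<circ> z) (ket p) = (z \<circ> y) (ket p)" unfolding p
    proof (rule ell2_eqI)
      fix q :: "'i \<times> 'g"
      obtain i' b where q: "q = (i', b)" by (cases q)
      have "((\<lambda>t. ell2_nth (z (ket (i, a))) (i', t) * ell2_nth (y (ket (i', t))) (i', b))
          has_sum ell2_nth (y (z (ket (i, a)))) (i', b)) UNIV"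
        by (rule has_sum_pair_fst[OF has_sum_bounded_map_nth[OF ym]]) (simp add: c)
      then have 1: "((\<lambda>t. ell2_nth (z (ket (i, a))) (i', t) * c (b - t))
          has_sum ell2_nth (y (z (ket (i, a)))) (i', b)) UNIV"
        by (simp add: c)
      have "((\<lambda>t. ell2_nth (y (ket (i, a))) (i, t) * ell2_nth (z (ket (i, t))) (i', b))
          has_sum ell2_nth (z (y (ket (i, a)))) (i', b)) UNIV"
        by (rule has_sum_pair_fst[OF has_sum_bounded_map_nth[OF zm]]) (simp add: c)
      then have 2: "((\<lambda>t. c (t - a) * ell2_nth (z (ket (i, t))) (i', b))
          has_sum ell2_nth (z (y (ket (i, a)))) (i', b)) UNIV"
        by (simp add: c)
      have "((\<lambda>t. ell2_nth (z (ket (i, a))) (i', t) * c (b - t))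
          has_sum ell2_nth (z (y (ket (i, a)))) (i', b)) UNIV"
      \<comment> \<open>The substitution is t -> a - t + b; translating the entry of z by t - a
        turns one summand into the other.\<close>
      proof (rule has_sum_reindex_bij_witness[THEN iffD1, OF _ _ _ _ _ refl 2])
        fix t
        have dc: "x - (- d + x) = d" for x d :: 'g
          by (simp only: diff_conv_add_uminus minus_add minus_minus add_minus_cancel)
        have at: "a - t = - (t - a)" by simp
        have "ell2_nth (z (ket (i, t))) (i', (t - a) + (a - t + b)) = ell2_nth (z (ket (i, a))) (i', a - t + b)"
          using inv[of i "t - a" a i' "a - t + b"] by simp
        moreover have "(t - a) + (a - t + b) = b" "b - (a - t + b) = t - a"
          unfolding at using dc[of b "t - a"] by (simp_all only: add_minus_cancel)
        ultimately show "ell2_nth (z (ket (i, a))) (i', a - t + b) * c (b - (a - t + b))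
            = c (t - a) * ell2_nth (z (ket (i, t))) (i', b)"
          by simp
        show "b - (a - t + b) + a = t" "a - (b - t + a) + b = t"
          using dc[of b "t - a"] dc[of a "t - b"] by (simp_all only: minus_diff_eq diff_add_cancel)
      qed auto
      with 1 show "ell2_nth ((y \<circ> z) (ket (i, a))) q = ell2_nth ((z \<circ> y) (ket (i, a))) q"
        by (simp add: q has_sum_unique)
    qed
  qed
  then show ?thesis using y by (auto simp: group_vn_def vn_generated_def commutant_def[of "commutant _"])
qed

text \<open>By \<open>group_vn_move\<close> an element of \<open>group_vn\<close> acts by the same
  operator on every fibre; this is that operator, read off at an arbitrary fibre. It supplies the
  C_k of the overview.\<close>

definition fibre_op :: "('i \<times> 'g) op \<Rightarrow> 'g op" where
  "fibre_op y \<phi> = rslice (y (rinj undefined \<phi>)) undefined"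

lemma rslice_group_vn: "y \<in> group_vn \<Longrightarrow> rslice (y \<xi>) i = fibre_op y (rslice \<xi> i)"
  using group_vn_move[of y undefined \<xi> i] by (simp add: fibre_op_def rslice_rinj)

lemma bounded_map_fibre_op: "y \<in> group_vn \<Longrightarrow> bounded_map (fibre_op y)"
  using group_vn_bounded unfolding fibre_op_def[abs_def] bounded_op_iff_map
  by (intro bounded_map_compose(1)[OF bounded_map_rslice] bounded_map_compose(1)[OF _ bounded_map_rinj])

lemma fibre_op_rtrans:
  assumes "y \<in> group_vn"
  shows "fibre_op y (rtrans k \<phi>) = rtrans k (fibre_op y \<phi>)"
proof -
  note r = rslice_amp_right[OF unitary_opD(1)[OF unitary_rtrans]]
  have "rslice (y (amp_right (rtrans k) (rinj i \<phi>))) i = rtrans k (fibre_op y \<phi>)" for i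
    by (simp add: group_vn_rtrans[OF assms] r rslice_group_vn[OF assms] rslice_rinj)
  then show ?thesis by (simp add: rslice_group_vn[OF assms] r rslice_rinj)
qed

lemma norm_rinj: "norm (rinj i \<phi>) = norm \<phi>"
proof -
  have "((\<lambda>j. (norm (rslice (rinj i \<phi>) j))\<^sup>2) has_sum (norm \<phi>)\<^sup>2) UNIV"
    by (rule has_sum_finite_neutralI[of "{i}"]) (auto simp: rslice_rinj)
  then show ?thesis
    using has_sum_norm_rslice has_sum_unique by (metis norm_ge_zero power2_eq_imp_eq)
qed

lemma fibre_op_isometry:
  fixes y :: "('i \<times> 'g :: group_add) op"
  assumes "y \<in> group_vn" "\<And>\<xi>. norm (y \<xi>) = norm \<xi>"
  shows "norm (fibre_op y \<phi>) = norm \<phi>"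
proof -
  have "y (rinj undefined \<phi>) = rinj undefined (fibre_op y \<phi>)"
    by (rule rslice_eqI)
       (simp add: rslice_group_vn[OF assms(1)] rslice_rinj bounded_mapD[OF bounded_map_fibre_op[OF assms(1)]])
  then show ?thesis using assms(2)[of "rinj undefined \<phi>"] by (simp add: norm_rinj)
qed

section \<open>Decay and orthogonality in the regular representation\<close>

lemma finite_level_set:
  fixes f :: "'a \<Rightarrow> real"
  assumes "(f has_sum S) UNIV" "\<And>x. 0 \<le> f x" "0 < e"
  shows "finite {x. e \<le> f x}"
proof (rule ccontr)
  assume inf: "infinite {x. e \<le> f x}"
  obtain n :: nat where n: "S < n * e" using reals_Archimedean3[OF assms(3)] by blast
  obtain B where B: "finite B" "card B = n" "B \<subseteq> {x. e \<le> f x}"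
    using infinite_arbitrarily_large[OF inf] by blast
  have "n * e = (\<Sum>x\<in>B. e)" by (simp add: B)
  also have "\<dots> \<le> sum f B" by (rule sum_mono) (use B in auto)
  also have "\<dots> \<le> S" by (rule finite_sum_le_has_sum[OF assms(1) B(1)]) (auto simp: assms)
  finally show False using n by simp
qed

lemma has_sum_tendsto_0:
  fixes f :: "'a \<Rightarrow> real"
  assumes "(f has_sum S) UNIV" "\<And>x. 0 \<le> f x"
  shows "(f \<longlongrightarrow> 0) cofinite"
proof (rule tendstoI)
  fix e :: real assume "0 < e"
  then show "\<forall>\<^sub>F x in cofinite. dist (f x) 0 < e"
    using finite_level_set[OF assms] assms(2) by (simp add: eventually_cofinite not_less)
qed

lemma ell2_nth_tendsto_0: "(ell2_nth \<xi> \<longlongrightarrow> 0) cofinite"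
  using tendsto_real_sqrt[OF has_sum_tendsto_0[OF has_sum_norm_ell2[of \<xi>]]]
  by (simp add: tendsto_norm_zero_iff)

lemma rslice_tendsto_0: "((\<lambda>i. rslice \<xi> i) \<longlongrightarrow> 0) cofinite"
  using tendsto_real_sqrt[OF has_sum_tendsto_0[OF has_sum_norm_rslice[of \<xi>]]]
  by (simp add: tendsto_norm_zero_iff)

lemma filterlim_inj_cofinite: "inj f \<Longrightarrow> filterlim f cofinite cofinite"
  unfolding filterlim_iff eventually_cofinite
  by (auto dest: finite_vimageI simp: vimage_def)

text \<open>For a finitely supported phi the coefficient is a finite combination of values of psi at
  points i + k, which tend to 0; general phi follow by approximation.\<close>

lemma rtrans_mixing:
  fixes \<phi> \<psi> :: "'g :: group_add ell2"
  shows "((\<lambda>k. \<phi> \<bullet> rtrans k \<psi>) \<longlongrightarrow> 0) cofinite"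
proof (rule tendstoI)
  fix e :: real assume e: "0 < e"
  \<comment> \<open>With this d the approximation costs at most e / 2; the + 1 covers psi =
    0.\<close>
  define d where "d = e / (2 * (norm \<psi> + 1))"
  have n: "norm \<psi> + 1 > 0" using norm_ge_zero[of \<psi>] by linarith
  have d: "0 < d" using e n by (simp add: d_def)
  have "\<forall>\<^sub>F F in finite_subsets_at_top UNIV. dist (\<Sum>i\<in>F. ell2_nth \<phi> i *\<^sub>C ket i) \<phi> < d"
    using has_sum_ket[of \<phi>] d unfolding has_sum_def tendsto_iff by simp
  then obtain F where F: "dist (\<Sum>i\<in>F. ell2_nth \<phi> i *\<^sub>C ket i) \<phi> < d"
    using eventually_happens' finite_subsets_at_top_neq_bot by blast
  define \<phi>' where "\<phi>' = (\<Sum>i\<in>F. ell2_nth \<phi> i *\<^sub>C ket i)"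
  have t: "((\<lambda>k. ell2_nth \<psi> (i + k)) \<longlongrightarrow> 0) cofinite" for i
    by (rule filterlim_compose[OF ell2_nth_tendsto_0 filterlim_inj_cofinite]) (simp add: inj_on_def)
  have "((\<lambda>k. Re (cnj (ell2_nth \<phi> i) * ell2_nth \<psi> (i + k))) \<longlongrightarrow> 0) cofinite" for i
  proof -
    have "((\<lambda>k. cnj (ell2_nth \<phi> i) * ell2_nth \<psi> (i + k)) \<longlongrightarrow> 0) cofinite"
      by (rule tendsto_mult_right_zero[OF t])
    from tendsto_Re[OF this] show ?thesis by (simp only: zero_complex.simps)
  qed
  then have "((\<lambda>k. \<phi>' \<bullet> rtrans k \<psi>) \<longlongrightarrow> 0) cofinite"
    unfolding \<phi>'_def inner_sum_left inner_scaleC inner_ket ell2_nth_simps ell2_nth_rtrans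
    by (rule tendsto_null_sum)
  then have "\<forall>\<^sub>F k in cofinite. dist (\<phi>' \<bullet> rtrans k \<psi>) 0 < e / 2"
    using e by (intro tendstoD) auto
  then show "\<forall>\<^sub>F k in cofinite. dist (\<phi> \<bullet> rtrans k \<psi>) 0 < e"
  proof eventually_elim
    case (elim k)
    have "\<bar>(\<phi> - \<phi>') \<bullet> rtrans k \<psi>\<bar> \<le> norm (\<phi> - \<phi>') * norm \<psi>"
      using Cauchy_Schwarz_ineq2[of "\<phi> - \<phi>'" "rtrans k \<psi>"] by (simp add: unitary_opD(5)[OF unitary_rtrans])
    also have "\<dots> \<le> d * (norm \<psi> + 1)"
      using F d by (intro mult_mono) (auto simp: \<phi>'_def dist_norm norm_minus_commute)
    also have "\<dots> = e / 2" unfolding d_def using n by (simp add: divide_simps)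
    finally show ?case using elim unfolding inner_diff_left dist_real_def by linarith
  qed
qed

text \<open>Expanding |c e - v|^2 >= 0 gives c (c |e|^2 - S) >= 0; scaling e by c spares normalizing
  the vectors.\<close>

lemma bessel_orthogonal:
  fixes w :: "'a \<Rightarrow> 'b :: real_inner"
  assumes "finite F" and orth: "\<And>x y. x \<in> F \<Longrightarrow> y \<in> F \<Longrightarrow> w x \<bullet> w y = (if x = y then c else 0)"
    and c: "0 < c"
  shows "(\<Sum>x\<in>F. (e \<bullet> w x)\<^sup>2) \<le> c * (e \<bullet> e)"
proof -
  define v where "v = (\<Sum>x\<in>F. (e \<bullet> w x) *\<^sub>R w x)"
  define S where "S = (\<Sum>x\<in>F. (e \<bullet> w x)\<^sup>2)"
  have ev: "e \<bullet> v = S" by (simp add: v_def S_def inner_sum_right power2_eq_square)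
  have "v \<bullet> w x = c * (e \<bullet> w x)" if "x \<in> F" for x
    using that assms(1) by (simp add: v_def inner_sum_left orth if_distrib[of "\<lambda>x. _ * x"] cong: if_cong)
  then have vv: "v \<bullet> v = c * S"
    by (subst (2) v_def) (simp add: inner_sum_right S_def sum_distrib_left power2_eq_square mult_ac)
  have "0 \<le> (c *\<^sub>R e - v) \<bullet> (c *\<^sub>R e - v)" by simp
  also have "\<dots> = c * (c * (e \<bullet> e) - S)"
    by (simp add: inner_diff_left inner_diff_right ev vv inner_commute[of v e] algebra_simps)
  finally show ?thesis using c by (simp add: S_def zero_le_mult_iff)
qed

section \<open>Free groups and translates\<close>

text \<open>If the orbit were finite, infinitely many k would give one and the same translate; but
  each of them puts - k + g0 into its finite support, where g0 is a point in the support of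
  s.\<close>

lemma infinite_translates:
  fixes s :: "'g :: group_add \<Rightarrow>\<^sub>0 'b :: zero"
  assumes "infinite (UNIV :: 'g set)" "s \<noteq> 0"
  shows "infinite (range (\<lambda>k. Poly_Mapping.map_key (\<lambda>g. k + g) s))"
proof
  assume "finite (range (\<lambda>k. Poly_Mapping.map_key (\<lambda>g. k + g) s))"
  then obtain k0 where inf: "infinite {k. Poly_Mapping.map_key (\<lambda>g. k + g) s = Poly_Mapping.map_key (\<lambda>g. k0 + g) s}"
    using pigeonhole_infinite[OF assms(1)] by auto
  obtain g0 where g0: "Poly_Mapping.lookup s g0 \<noteq> 0" using assms(2) by (metis poly_mapping_eqI lookup_zero)
  let ?K = "{k. Poly_Mapping.map_key (\<lambda>g. k + g) s = Poly_Mapping.map_key (\<lambda>g. k0 + g) s}"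
  have "(\<lambda>k. - k + g0) ` ?K \<subseteq> Poly_Mapping.keys (Poly_Mapping.map_key (\<lambda>g. k0 + g) s)"
  proof safe
    fix k assume k: "Poly_Mapping.map_key (\<lambda>g. k + g) s = Poly_Mapping.map_key (\<lambda>g. k0 + g) s"
    have "Poly_Mapping.lookup (Poly_Mapping.map_key (\<lambda>g. k + g) s) (- k + g0) \<noteq> 0"
      using g0 by (simp add: add.assoc[symmetric])
    then show "- k + g0 \<in> Poly_Mapping.keys (Poly_Mapping.map_key (\<lambda>g. k0 + g) s)"
      by (simp add: k in_keys_iff)
  qed
  then have "finite ((\<lambda>k. - k + g0) ` ?K)" by (rule finite_subset) simp
  then have "finite ?K" by (rule finite_imageD) (auto simp: inj_on_def)
  then show False using inf by simp
qed

lemma foldr_push_append: "reduced (v @ w) \<Longrightarrow> foldr push_letter v w = v @ w"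
proof (induction v)
  case (Cons l v)
  then have "foldr push_letter v w = v @ w" and "v @ w = [] \<or> hd (v @ w) \<noteq> inv_letter l"
    by (auto simp: reduced_Cons)
  then show ?case by (cases "v @ w") auto
qed simp

lemma reduced_replicate: "reduced (replicate n l)"
  by (induction n) (auto simp: reduced_Cons)

lemma free_group_induct [case_names zero gen inv]:
  assumes "P 0" "\<And>a g. P g \<Longrightarrow> P (free_gen a + g)" "\<And>a g. P g \<Longrightarrow> P (- free_gen a + g)"
  shows "P g"
proof -
  have "P (Abs_free_group w)" if "reduced w" for w
    using that
  proof (induction w)
    case Nil
    then show ?case using assms(1) by (simp add: zero_free_group_def)
  next
    case (Cons l w)
    then have w: "reduced w" and P: "P (Abs_free_group w)" by (auto simp: reduced_Cons)
    have push: "push_letter l w = l # w" using Cons.prems by (cases w) (auto simp: reduced_Cons)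
    obtain a b where l: "l = (a, b)" by (cases l)
    have "Abs_free_group (l # w) = (if b then free_gen a else - free_gen a) + Abs_free_group w"
      using w push unfolding l
      by (cases b) (simp_all add: plus_free_group_def free_gen_def uminus_free_group_def
        Abs_free_group_inverse reduced_Cons inv_letter_def)
    then show ?case using assms(2,3)[OF P] by (cases b) auto
  qed
  then show ?thesis by (metis Rep_free_group Rep_free_group_inverse mem_Collect_eq)
qed

text \<open>Four generators leave one, a, that differs from those of the first and last letters of
  k. Then a^-n k a^n is reduced as written, and its length grows with n.\<close>

lemma infinite_conjugates:
  fixes k :: F4
  assumes "k \<noteq> 0"
  shows "infinite (range (\<lambda>h. - h + k + h))"
proof -
  define w where "w = Rep_free_group k"
  have w: "reduced w" "w \<noteq> []"
    using Rep_free_group[of k] assms by (auto simp: w_def zero_free_group.rep_eq simp flip: Rep_free_group_inject)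
  obtain a where a: "a \<noteq> fst (hd w)" "a \<noteq> fst (last w)"
  proof -
    have "\<exists>a. a \<noteq> x \<and> a \<noteq> y" for x y :: idx4
      by (cases x; cases y) (blast intro: idx4.distinct)+
    then show ?thesis using that by blast
  qed
  define x where "x n = Abs_free_group (replicate n (a, True))" for n
  have x: "Rep_free_group (x n) = replicate n (a, True)" for n
    by (simp add: x_def Abs_free_group_inverse reduced_replicate)
  have red: "reduced (replicate n (a, False) @ w @ replicate n (a, True))" for n
    using w a reduced_replicate[of n "(a, False)"] reduced_replicate[of n "(a, True)"]
    by (cases "n = 0") (auto simp: reduced_def successively_append_iff inv_letter_def hd_append)
  have rep: "Rep_free_group (- x n + k + x n) = replicate n (a, False) @ w @ replicate n (a, True)" for n
  proof -
    have r2: "reduced (w @ replicate n (a, True))" "reduced (replicate n (a, False) @ w)"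
      using red[of n] by (auto simp: reduced_def successively_append_iff)
    have "Rep_free_group (- x n + k + x n) = foldr push_letter (replicate n (a, False) @ w) (replicate n (a, True))"
      using foldr_push_append[OF r2(2)]
      by (simp add: plus_free_group.rep_eq uminus_free_group.rep_eq x inv_letter_def del: foldr_append flip: w_def)
    also have "\<dots> = (replicate n (a, False) @ w) @ replicate n (a, True)"
      by (rule foldr_push_append) (simp add: red)
    finally show ?thesis by simp
  qed
  have "inj (\<lambda>n. - x n + k + x n)"
  proof (rule injI)
    fix m n assume "- x m + k + x m = - x n + k + x n"
    then have "length (Rep_free_group (- x m + k + x m)) = length (Rep_free_group (- x n + k + x n))" by simp
    then show "m = n" by (simp only: rep) simp
  qed
  then have "infinite (range (\<lambda>n. - x n + k + x n))" by (rule range_inj_infinite)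
  then show ?thesis by (rule contrapos_nn) (auto elim: finite_subset[rotated])
qed

lemma infinite_F4: "infinite (UNIV :: F4 set)"
proof -
  have "free_gen I1 \<noteq> 0" by transfer simp
  from infinite_conjugates[OF this] show ?thesis using finite_subset subset_UNIV by blast
qed

section \<open>Rotations of the Pauli matrices\<close>

lemma dagger_mult: "dagger (A ** B) = dagger B ** dagger A"
  by (simp add: dagger_def matrix_matrix_mult_def vec_eq_iff mult.commute)

lemma dagger_dagger [simp]: "dagger (dagger A) = A"
  by (simp add: dagger_def vec_eq_iff)

lemma dagger_pauli [simp]: "dagger (pauli_mat p) = pauli_mat p"
  by (cases p) (simp_all add: dagger_def vec_eq_iff forall_2 mat_def)

lemma dagger_one [simp]: "dagger (mat 1) = mat 1"
  by (simp add: dagger_def vec_eq_iff forall_2 mat_def)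

lemma ntr_dagger: "ntr (dagger A) = cnj (ntr A)"
  by (simp add: ntr_def dagger_def trace_def)

lemma ntr_commute: "ntr (A ** B) = ntr (B ** A)"
  unfolding ntr_def by (subst trace_mul_sym) (rule refl)

lemma ntr_eq: "ntr A = (A $ 1 $ 1 + A $ 2 $ 2) / 2" by (simp add: ntr_def trace_def sum_2)
lemma mat2_mult_nth: "(A ** B) $ i $ j = A $ i $ 1 * B $ 1 $ j + A $ i $ 2 * (B :: mat2) $ 2 $ j" by (simp add: matrix_matrix_mult_def sum_2)
lemma pauli_mat_nth: "pauli_mat p $ 1 $ 1 = (case p of Pauli1 \<Rightarrow> 1 | PauliZ \<Rightarrow> 1 | _ \<Rightarrow> 0)"
 "pauli_mat p $ 2 $ 2 = (case p of Pauli1 \<Rightarrow> 1 | PauliZ \<Rightarrow> -1 | _ \<Rightarrow> 0)"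
 "pauli_mat p $ 1 $ 2 = (case p of PauliX \<Rightarrow> 1 | PauliY \<Rightarrow> -\<i> | _ \<Rightarrow> 0)"
 "pauli_mat p $ 2 $ 1 = (case p of PauliX \<Rightarrow> 1 | PauliY \<Rightarrow> \<i> | _ \<Rightarrow> 0)"
 by (cases p; simp add: mat_def)+
lemma sum_pauli: "(\<Sum>p\<in>UNIV. f p) = f Pauli1 + f PauliX + f PauliY + f PauliZ"
  for f :: "pauli \<Rightarrow> 'a :: comm_monoid_add"
  by (simp add: UNIV_pauli add.assoc)
lemma pauli_expansion: "A $ i $ j = (\<Sum>p\<in>UNIV. ntr (pauli_mat p ** A) * pauli_mat p $ i $ j)"
  using exhaust_2[of i] exhaust_2[of j]
  by (elim disjE; simp add: sum_pauli ntr_eq mat2_mult_nth pauli_mat_nth; simp add: field_simps)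
lemma pauli_parseval: "ntr (A ** B) = (\<Sum>p\<in>UNIV. ntr (pauli_mat p ** A) * ntr (pauli_mat p ** B))"
  by (simp add: sum_pauli ntr_eq mat2_mult_nth pauli_mat_nth, simp add: field_simps)

text \<open>The matrix of conjugation by V in the Pauli basis, the source of B in the overview. It
  is real because conjugation keeps matrices self-adjoint, and a phase of V cancels.\<close>

definition pauli_rot :: "mat2 \<Rightarrow> pauli \<Rightarrow> pauli \<Rightarrow> real" where
  "pauli_rot V p q = Re (ntr (pauli_mat p ** (V ** pauli_mat q ** dagger V)))"

lemma of_real_pauli_rot: "of_real (pauli_rot V p q) = ntr (pauli_mat p ** (V ** pauli_mat q ** dagger V))"
proof -
  have "cnj (ntr (pauli_mat p ** (V ** pauli_mat q ** dagger V)))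
      = ntr (pauli_mat p ** (V ** pauli_mat q ** dagger V))"
    by (simp add: ntr_dagger[symmetric] dagger_mult matrix_mul_assoc)
       (metis ntr_commute matrix_mul_assoc)
  then show ?thesis by (simp add: pauli_rot_def complex_eq_iff)
qed

lemma pauli_rot_dagger: "pauli_rot (dagger V) p q = pauli_rot V q p"
  unfolding pauli_rot_def by (metis dagger_dagger matrix_mul_assoc ntr_commute)

lemma pauli_rot_expansion:
  "(V ** pauli_mat q ** dagger V) $ i $ j = (\<Sum>p\<in>UNIV. of_real (pauli_rot V p q) * pauli_mat p $ i $ j)"
  unfolding of_real_pauli_rot by (rule pauli_expansion)

lemma pauli_rot_mult: "pauli_rot (V ** W) p q = (\<Sum>r\<in>UNIV. pauli_rot V p r * pauli_rot W r q)"
proof -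
  have "of_real (pauli_rot (V ** W) p q) = ntr ((dagger V ** pauli_mat p ** V) ** (W ** pauli_mat q ** dagger W))"
    unfolding of_real_pauli_rot dagger_mult
    using ntr_commute[of "pauli_mat p ** V ** W ** pauli_mat q ** dagger W" "dagger V"]
    by (simp add: matrix_mul_assoc)
  also have "\<dots> = (\<Sum>r\<in>UNIV. of_real (pauli_rot (dagger V) r p) * of_real (pauli_rot W r q))"
    unfolding of_real_pauli_rot dagger_dagger by (rule pauli_parseval)
  also have "\<dots> = of_real (\<Sum>r\<in>UNIV. pauli_rot V p r * pauli_rot W r q)"
    by (simp add: pauli_rot_dagger)
  finally show ?thesis by (simp only: of_real_eq_iff)
qed

lemma pauli_rot_one: "pauli_rot (mat 1) p q = (if p = q then 1 else 0)"
  using pauli_orthonormal[of p q] by (simp add: pauli_rot_def)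

lemma pauli_rot_orthogonal:
  assumes "dagger V ** V = mat 1"
  shows "(\<Sum>q\<in>UNIV. pauli_rot V q p * pauli_rot V q r) = (if p = r then 1 else 0)"
  using pauli_rot_mult[of "dagger V" V p r] by (simp add: assms pauli_rot_dagger pauli_rot_one)

lemma pauli_rot_Pauli1:
  assumes "V ** dagger V = mat 1"
  shows "pauli_rot V p Pauli1 = (if p = Pauli1 then 1 else 0)"
  using pauli_orthonormal[of p Pauli1] by (simp add: pauli_rot_def assms)

lemma pauli_rot_v1: "pauli_rot (v_mat I1) p q = (if p = q then (if p = PauliX \<or> p = PauliY then -1 else 1) else 0)"
  by (cases p; cases q) (simp_all add: pauli_rot_def mat2_simps)

lemma pauli_rot_v2: "pauli_rot (v_mat I2) p q = (if p = q then (if p = PauliZ \<or> p = PauliY then -1 else 1) else 0)"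
  by (cases p; cases q) (simp_all add: pauli_rot_def mat2_simps)

lemma pauli_rot_v4_X: "pauli_rot (v_mat I4) PauliX q = (if q = PauliY then -1 else 0)"
  by (cases q) (simp_all add: pauli_rot_def mat2_simps)

lemma pauli_rot_v4_Z: "pauli_rot (v_mat I4) PauliZ q
    = (case q of PauliX \<Rightarrow> sqrt 3 / 2 | PauliZ \<Rightarrow> - 1 / 2 | _ \<Rightarrow> 0)"
  by (cases q) (simp_all add: pauli_rot_def mat2_simps)

lemma unitary_v_mat: "v_mat i ** dagger (v_mat i) = mat 1" "dagger (v_mat i) ** v_mat i = mat 1"
proof -
  have s: "complex_of_real (sqrt 3) * complex_of_real (sqrt 3) = 3"
    by (simp flip: of_real_mult)
  show "v_mat i ** dagger (v_mat i) = mat 1" "dagger (v_mat i) ** v_mat i = mat 1"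
    by (cases i; simp add: mat2_simps vec_eq_iff forall_2 s field_simps)+
qed

section \<open>The action on \<open>M\<close> and the commutant of the crossed product\<close>

lemma map_key_add_zero:
  "Poly_Mapping.map_key (\<lambda>g. k + g :: 'g :: group_add) s = 0 \<longleftrightarrow> s = 0"
proof
  assume "Poly_Mapping.map_key (\<lambda>g. k + g) s = 0"
  moreover have "Poly_Mapping.map_key (\<lambda>g. k + g) 0 = (0 :: 'g \<Rightarrow>\<^sub>0 'a)"
    by (rule map_key_zero) (simp add: inj_on_def)
  ultimately have "Poly_Mapping.lookup s (k + g) = 0" for g
    using map_key.rep_eq[of "\<lambda>g. k + g" s] by (simp add: inj_on_def fun_eq_iff)
  from this[of "- k + _"] show "s = 0" by (intro poly_mapping_eqI) (simp add: add.assoc[symmetric])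
qed (simp add: map_key_zero inj_on_def)

lemma pauli_rot_Pauli1_left:
  assumes "dagger V ** V = mat 1"
  shows "pauli_rot V Pauli1 p = (if p = Pauli1 then 1 else 0)"
  using pauli_rot_Pauli1[of "dagger V" p] assms by (simp add: pauli_rot_dagger)

lemma abs_pauli_rot_le:
  assumes "dagger V ** V = mat 1"
  shows "\<bar>pauli_rot V q p\<bar> \<le> 1"
proof -
  have "(pauli_rot V q p)\<^sup>2 \<le> (\<Sum>q\<in>UNIV. (pauli_rot V q p)\<^sup>2)"
    by (rule member_le_sum) auto
  also have "\<dots> = 1" using pauli_rot_orthogonal[OF assms, of p p] by (simp add: power2_eq_square)
  finally show ?thesis by (simp add: abs_square_le_1)
qed

lemma site_ops_bounded: "y \<in> {site_op g A |g A. True} \<Longrightarrow> bounded_op y"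
  by (auto simp: bounded_op_site_op)

lemma vn_action_mem: "vn_action N \<theta> \<Longrightarrow> x \<in> N \<Longrightarrow> \<theta> g x \<in> N"
  unfolding vn_action_def star_automorphism_def bij_betw_def by blast

lemma bounded_op_id: "bounded_op id"
  by (simp add: bounded_op_iff_map bounded_map_id)

lemma tensor_one_id: "(mat_op (mat 1) \<otimes>\<^sub>o id) \<xi> = \<xi>"
  by (rule rslice_eqI)
     (simp add: rslice_tensor[OF bounded_op_id] mat_def if_distrib[of "\<lambda>x. x *\<^sub>C _"] scaleC_simps cong: if_cong)

locale free_group_action =
  fixes \<beta> :: "F4 \<Rightarrow> 2 op \<Rightarrow> 2 op"
    and \<alpha> :: "F4 \<Rightarrow> (2 \<times> (F4 \<Rightarrow>\<^sub>0 pauli)) op \<Rightarrow> (2 \<times> (F4 \<Rightarrow>\<^sub>0 pauli)) op"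
  assumes \<beta>_action: "vn_action M2 \<beta>"
    and \<beta>_gen: "\<And>i x. x \<in> M2 \<Longrightarrow> \<beta> (free_gen i) x = Ad (mat_op (v_mat i)) x"
    and \<alpha>_action: "vn_action M_alg \<alpha>"
    and \<alpha>_tensor: "\<And>g x y. x \<in> M2 \<Longrightarrow> y \<in> R_alg \<Longrightarrow> \<alpha> g (x \<otimes>\<^sub>o y) = \<beta> g x \<otimes>\<^sub>o bernoulli g y"
begin

lemma \<beta>_add: "\<beta> (g + h) (mat_op A) = \<beta> g (\<beta> h (mat_op A))"
  and \<beta>_zero: "\<beta> 0 (mat_op A) = mat_op A"
  using \<beta>_action by (auto simp: vn_action_def M2_def)

text \<open>\<beta> is prescribed on generators, so the unitary is built along the word. For an
  inverse generator the value is solved for from the fact that \<beta> of a generator undoes \<beta>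
  of its inverse.\<close>

lemma ex_implementing_unitary:
  "\<exists>V. V ** dagger V = mat 1 \<and> dagger V ** V = mat 1 \<and> (\<forall>A. \<beta> g (mat_op A) = mat_op (V ** A ** dagger V))"
proof (induction g rule: free_group_induct)
  case zero
  show ?case by (rule exI[of _ "mat 1"]) (simp add: \<beta>_zero)
next
  case (gen a g)
  then obtain V where V: "V ** dagger V = mat 1" "dagger V ** V = mat 1"
    "\<And>A. \<beta> g (mat_op A) = mat_op (V ** A ** dagger V)" by blast
  let ?W = "v_mat a ** V"
  have "?W ** dagger ?W = v_mat a ** (V ** dagger V) ** dagger (v_mat a)"
    "dagger ?W ** ?W = dagger V ** (dagger (v_mat a) ** v_mat a) ** V"
    by (simp_all add: dagger_mult matrix_mul_assoc)
  moreover have "\<beta> (free_gen a + g) (mat_op A) = mat_op (?W ** A ** dagger ?W)" for A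
    by (simp add: \<beta>_add V(3) \<beta>_gen M2_def Ad_mat_op dagger_mult matrix_mul_assoc)
  ultimately show ?case by (intro exI[of _ ?W]) (simp add: V unitary_v_mat)
next
  case (inv a g)
  then obtain V where V: "V ** dagger V = mat 1" "dagger V ** V = mat 1"
    "\<And>A. \<beta> g (mat_op A) = mat_op (V ** A ** dagger V)" by blast
  let ?v = "v_mat a"
  have inv: "\<beta> (- free_gen a) (mat_op A) = mat_op (dagger ?v ** A ** ?v)" for A
  proof -
    have "\<beta> (- free_gen a) (mat_op A) \<in> M2"
      by (rule vn_action_mem[OF \<beta>_action]) (simp add: M2_def)
    then obtain C where C: "\<beta> (- free_gen a) (mat_op A) = mat_op C" by (auto simp: M2_def)
    have "mat_op A = \<beta> (free_gen a) (\<beta> (- free_gen a) (mat_op A))"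
      using \<beta>_add[of "free_gen a" "- free_gen a" A] by (simp add: \<beta>_zero)
    also have "\<dots> = mat_op (?v ** C ** dagger ?v)"
      by (simp add: C \<beta>_gen M2_def Ad_mat_op)
    finally have "A = ?v ** C ** dagger ?v" by (simp add: mat_op_inj)
    then have "dagger ?v ** A ** ?v = (dagger ?v ** ?v) ** C ** (dagger ?v ** ?v)"
      by (simp add: matrix_mul_assoc)
    then show ?thesis by (simp add: C unitary_v_mat)
  qed
  let ?W = "dagger ?v ** V"
  have "?W ** dagger ?W = dagger ?v ** (V ** dagger V) ** ?v"
    "dagger ?W ** ?W = dagger V ** (?v ** dagger ?v) ** V"
    by (simp_all add: dagger_mult matrix_mul_assoc)
  moreover have "\<beta> (- free_gen a + g) (mat_op A) = mat_op (?W ** A ** dagger ?W)" for A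
    by (simp only: \<beta>_add V(3) inv) (simp add: dagger_mult matrix_mul_assoc)
  ultimately show ?case by (intro exI[of _ ?W]) (simp add: V unitary_v_mat)
qed

text \<open>Chosen for each g separately, with an arbitrary phase; \<open>V\<close> need not be
  multiplicative, but \<open>rot\<close> is, by \<open>rot_add\<close>.\<close>

definition V :: "F4 \<Rightarrow> mat2" where
  "V g = (SOME V. V ** dagger V = mat 1 \<and> dagger V ** V = mat 1 \<and>
     (\<forall>A. \<beta> g (mat_op A) = mat_op (V ** A ** dagger V)))"

lemma V: "V g ** dagger (V g) = mat 1" "dagger (V g) ** V g = mat 1"
  "\<beta> g (mat_op A) = mat_op (V g ** A ** dagger (V g))"
  using someI_ex[OF ex_implementing_unitary[of g]] unfolding V_def by blast+

abbreviation rot :: "F4 \<Rightarrow> pauli \<Rightarrow> pauli \<Rightarrow> real" where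
  "rot g \<equiv> pauli_rot (V g)"

lemma rot_add: "rot (g + h) p q = (\<Sum>r\<in>UNIV. rot g p r * rot h r q)"
proof -
  have "mat_op (V (g + h) ** A ** dagger (V (g + h))) = mat_op (V g ** (V h ** A ** dagger (V h)) ** dagger (V g))" for A
    using \<beta>_add[of g h A] by (simp add: V)
  then have "V (g + h) ** A ** dagger (V (g + h)) = (V g ** V h) ** A ** dagger (V g ** V h)" for A
    by (simp add: mat_op_inj dagger_mult matrix_mul_assoc)
  then have "rot (g + h) p q = pauli_rot (V g ** V h) p q" by (simp add: pauli_rot_def)
  then show ?thesis by (simp add: pauli_rot_mult)
qed

lemma rot_gen: "rot (free_gen i) p q = pauli_rot (v_mat i) p q"
proof -
  have "V (free_gen i) ** A ** dagger (V (free_gen i)) = v_mat i ** A ** dagger (v_mat i)" for A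
    using \<beta>_gen[of "mat_op A" i] V(3)[of "free_gen i" A] by (simp add: M2_def Ad_mat_op mat_op_inj)
  then show ?thesis by (simp add: pauli_rot_def)
qed

definition U :: "F4 \<Rightarrow> (2 \<times> (F4 \<Rightarrow>\<^sub>0 pauli)) op" where
  "U g = mat_op (V g) \<otimes>\<^sub>o shift_op g"

lemma unitary_U: "unitary_op (U g)"
  unfolding U_def by (intro unitary_tensor unitary_mat_op V unitary_shift_op)

lemma adjoint_U: "adjoint (U g) = mat_op (dagger (V g)) \<otimes>\<^sub>o adjoint (shift_op g)"
proof (rule unitary_opI(2)[OF unitary_opD(1,5)[OF unitary_U]])
  fix \<xi>
  note S = unitary_opD[OF unitary_shift_op, of g]
  have "U g \<circ> (mat_op (dagger (V g)) \<otimes>\<^sub>o adjoint (shift_op g)) = mat_op (mat 1) \<otimes>\<^sub>o id"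
    unfolding U_def using tensor_compose[OF S(1) bounded_op_adjoint[OF S(1)]] unitary_shift_op[of g]
    by (simp add: V unitary_op_def)
  then show "U g ((mat_op (dagger (V g)) \<otimes>\<^sub>o adjoint (shift_op g)) \<xi>) = \<xi>"
    by (metis comp_apply tensor_one_id)
qed

lemma M_alg_eq: "M_alg = vn_tensor M2 (vn_generated {site_op g A |g A. True})"
  by (simp add: M_alg_def R_alg_def hyperfinite_R_def)

lemma R_alg_eq: "R_alg = vn_generated {site_op g A |g A. True}"
  by (simp add: R_alg_def hyperfinite_R_def)

lemma M_alg_bounded: "z \<in> M_alg \<Longrightarrow> bounded_op z"
  by (simp add: M_alg_def vn_tensor_def vn_generated_bounded)

lemma \<alpha>_in_M: "z \<in> M_alg \<Longrightarrow> \<alpha> g z \<in> M_alg"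
  by (rule vn_action_mem[OF \<alpha>_action])

lemma \<alpha>_Ad:
  assumes "z \<in> M_alg"
  shows "\<alpha> g z = Ad (U g) z"
proof (rule vn_tensor_M2_induct[where P = "\<lambda>z. \<alpha> g z = Ad (U g) z", OF assms[unfolded M_alg_eq] site_ops_bounded])
  fix A and y :: "(F4 \<Rightarrow>\<^sub>0 pauli) op" assume y: "y \<in> vn_generated {site_op g A |g A. True}"
  note S = unitary_opD[OF unitary_shift_op, of g]
  note yb = vn_generated_bounded[OF y]
  have "\<alpha> g (mat_op A \<otimes>\<^sub>o y) = mat_op (V g ** A ** dagger (V g)) \<otimes>\<^sub>o (shift_op g \<circ> y \<circ> adjoint (shift_op g))"
    using y by (simp add: \<alpha>_tensor R_alg_eq M2_def V bernoulli_def Ad_def)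
  also have "\<dots> = U g \<circ> (mat_op A \<otimes>\<^sub>o y) \<circ> adjoint (U g)"
    unfolding adjoint_U unfolding U_def
    by (simp only: tensor_compose S(1) bounded_op_adjoint bounded_op_compose yb)
  finally show "\<alpha> g (mat_op A \<otimes>\<^sub>o y) = Ad (U g) (mat_op A \<otimes>\<^sub>o y)" by (simp add: Ad_def)
next
  fix x y assume xy: "x \<in> vn_tensor M2 (vn_generated {site_op g A |g A. True})"
    "y \<in> vn_tensor M2 (vn_generated {site_op g A |g A. True})"
    "\<alpha> g x = Ad (U g) x" "\<alpha> g y = Ad (U g) y"
  then have "\<alpha> g (\<lambda>\<xi>. x \<xi> + y \<xi>) = (\<lambda>\<xi>. \<alpha> g x \<xi> + \<alpha> g y \<xi>)"
    using \<alpha>_action unfolding vn_action_def star_automorphism_def M_alg_eq by blast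
  then show "\<alpha> g (\<lambda>\<xi>. x \<xi> + y \<xi>) = Ad (U g) (\<lambda>\<xi>. x \<xi> + y \<xi>)"
    using xy(3,4) by (simp add: Ad_def fun_eq_iff bounded_mapD[OF unitary_opD(2)[OF unitary_U]])
qed

text \<open>Conjugation by the unitaries \<open>U\<close> keeps one bound of z valid for all g at
  once, so the slicewise definition gives a bounded operator.\<close>

lemma cp_embed:
  assumes "z \<in> M_alg"
  shows lslice_cp_embed: "lslice (cp_embed \<alpha> z \<xi>) g = \<alpha> (- g) z (lslice \<xi> g)"
    and bounded_op_cp_embed: "bounded_op (cp_embed \<alpha> z)"
proof -
  obtain K where K: "0 \<le> K" "\<And>\<xi>. norm (z \<xi>) \<le> K * norm \<xi>"
    using bounded_map_bound M_alg_bounded[OF assms] unfolding bounded_op_iff_map by metis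
  have b: "norm (\<alpha> (- g) z \<xi>) \<le> K * norm \<xi>" for g \<xi>
    using K(2)[of "adjoint (U (- g)) \<xi>"] by (simp add: \<alpha>_Ad[OF assms] Ad_def unitary_opD[OF unitary_U])
  note d = M_alg_bounded[OF \<alpha>_in_M[OF assms]] b K(1)
  show "lslice (cp_embed \<alpha> z \<xi>) g = \<alpha> (- g) z (lslice \<xi> g)" "bounded_op (cp_embed \<alpha> z)"
    unfolding cp_embed_eq by (rule lslice_decomposable bounded_op_decomposable; rule d)+
qed

section \<open>The crossed product and unitaries in its commutant\<close>

abbreviation "P \<equiv> crossed_product M_alg \<alpha>"

lemma P_bounded: "x \<in> P \<Longrightarrow> bounded_op x"
  by (simp add: crossed_product_def vn_generated_bounded)

lemma cp_embed_in_P: "z \<in> M_alg \<Longrightarrow> cp_embed \<alpha> z \<in> P"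
  unfolding crossed_product_def
  by (rule subsetD[OF vn_generated_superset]) (auto simp: bounded_op_cp_embed unitary_opD(1) unitary_cp_unitary)

lemma LG_subset_P: "LG \<subseteq> P"
  unfolding LG_def group_vn_def crossed_product_def by (rule vn_generated_mono) auto

lemma P_commutes:
  assumes "x \<in> P" "unitary_op t"
    and "\<And>z. z \<in> M_alg \<Longrightarrow> t \<circ> cp_embed \<alpha> z = cp_embed \<alpha> z \<circ> t"
    and "\<And>h. t \<circ> cp_unitary h = cp_unitary h \<circ> t"
  shows "x (t \<xi>) = t (x \<xi>)"
proof -
  have "x \<circ> t = t \<circ> x"
    using assms(1) unfolding crossed_product_def
    by (rule vn_generated_commutes_unitary[OF _ assms(2)])
       (auto simp: assms(3,4) bounded_op_cp_embed unitary_opD(1) unitary_cp_unitary)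
  then show ?thesis by (metis comp_apply)
qed

text \<open>Right translations, corrected by the unitaries implementing \<open>\<alpha>\<close> so as to commute with \<open>M\<close>.\<close>

definition W :: "F4 \<Rightarrow> ((2 \<times> (F4 \<Rightarrow>\<^sub>0 pauli)) \<times> F4) op" where
  "W k = amp_left (U k) \<circ> amp_right (rtrans k)"

lemma lslice_W: "lslice (W k \<xi>) g = U k (lslice \<xi> (g + k))"
  by (simp add: W_def lslice_amp_left unitary_opD(1)[OF unitary_U] lslice_amp_right_rtrans)

lemma P_commutes_W:
  assumes "x \<in> P"
  shows "x (W k \<xi>) = W k (x \<xi>)"
proof (rule P_commutes[OF assms])
  show "unitary_op (W k)"
    unfolding W_def by (intro unitary_op_compose unitary_amp_left unitary_amp_right unitary_U unitary_rtrans)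
  show "W k \<circ> cp_unitary h = cp_unitary h \<circ> W k" for h
    by (rule ext, rule lslice_eqI) (simp add: lslice_W lslice_cp_unitary add.assoc)
  fix z assume z: "z \<in> M_alg"
  show "W k \<circ> cp_embed \<alpha> z = cp_embed \<alpha> z \<circ> W k"
  proof (rule ext, rule lslice_eqI)
    fix \<xi> g
    let ?z = "\<alpha> (- g) z"
    \<comment> \<open>Since - (g + k) = - k - g, the claim on this slice is that ?z after
      \<open>U k\<close> equals \<open>U k\<close> after \<alpha> (- k) ?z.\<close>
    have "\<alpha> (- (g + k)) z = \<alpha> (- k) ?z"
      using \<alpha>_action z unfolding minus_add vn_action_def by blast
    moreover have "?z = \<alpha> k (\<alpha> (- k) ?z)"
      using \<alpha>_action \<alpha>_in_M[OF z] by (metis (no_types, lifting) add.right_inverse vn_action_def)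
    then have "?z = U k \<circ> \<alpha> (- k) ?z \<circ> adjoint (U k)"
      using \<alpha>_Ad[OF \<alpha>_in_M[OF \<alpha>_in_M[OF z]]] by (simp add: Ad_def)
    then have "?z (U k \<eta>) = U k (\<alpha> (- k) ?z \<eta>)" for \<eta>
      by (metis comp_apply unitary_opD(3)[OF unitary_U])
    ultimately show "lslice ((W k \<circ> cp_embed \<alpha> z) \<xi>) g = lslice ((cp_embed \<alpha> z \<circ> W k) \<xi>) g"
      by (simp add: lslice_W lslice_cp_embed[OF z])
  qed
qed

text \<open>Right multiplications commute with all of M, hence with every \<alpha> h z, so they act
  in the same way on all slices and need no correction as in \<open>W\<close>.\<close>

lemma P_commutes_pauli_right:
  assumes "x \<in> P"
  shows "x (amp_left (amp_right (pauli_right g p)) \<xi>) = amp_left (amp_right (pauli_right g p)) (x \<xi>)"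
proof (rule P_commutes[OF assms])
  let ?t = "amp_right (pauli_right g p) :: (2 \<times> _) op"
  have u: "unitary_op ?t" by (intro unitary_amp_right unitary_pauli_right)
  show "unitary_op (amp_left ?t)" by (rule unitary_amp_left[OF u])
  note sl = lslice_amp_left[OF unitary_opD(1)[OF u]]
  show "amp_left ?t \<circ> cp_unitary h = cp_unitary h \<circ> amp_left ?t" for h
    by (rule ext, rule lslice_eqI) (simp add: sl lslice_cp_unitary)
  have t: "y \<circ> ?t = ?t \<circ> y" if y: "y \<in> M_alg" for y
    using y unfolding M_alg_def vn_tensor_def
  proof (rule vn_generated_commutes_unitary[OF _ u])
    fix y assume "y \<in> {x \<otimes>\<^sub>o y |x y. x \<in> M2 \<and> y \<in> R_alg}"
    then obtain A r where r: "y = mat_op A \<otimes>\<^sub>o r" "r \<in> R_alg" by (auto simp: M2_def)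
    have rb: "bounded_op r" using r(2) by (simp add: R_alg_eq vn_generated_bounded)
    have "r (pauli_right g p \<eta>) = pauli_right g p (r \<eta>)" for \<eta>
      using pauli_right_commutes[of r g p] r(2) by (metis R_alg_def comp_apply)
    then have "?t \<circ> y = y \<circ> ?t"
      unfolding r(1)
      by (intro ext rslice_eqI)
         (simp add: rslice_tensor[OF rb] rslice_amp_right unitary_opD(1) unitary_pauli_right
           bounded_mapD[OF unitary_opD(2)[OF unitary_pauli_right]])
    then show "bounded_op y \<and> ?t \<circ> y = y \<circ> ?t"
      by (simp add: r(1) bounded_op_tensor bounded_op_mat_op rb)
  qed
  fix z assume z: "z \<in> M_alg"
  have "?t (\<alpha> h z \<eta>) = \<alpha> h z (?t \<eta>)" for h \<eta>
    using t[OF \<alpha>_in_M[OF z]] by (metis comp_apply)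
  then show "amp_left ?t \<circ> cp_embed \<alpha> z = cp_embed \<alpha> z \<circ> amp_left ?t"
    by (intro ext lslice_eqI) (simp add: sl lslice_cp_embed[OF z])
qed

lemma ell2_nth_W:
  "ell2_nth (W k \<xi>) ((b, s), g)
    = (\<Sum>b'\<in>UNIV. V k $ b $ b' * ell2_nth \<xi> ((b', Poly_Mapping.map_key (\<lambda>g. k + g) s), g + k))"
proof -
  have "ell2_nth (W k \<xi>) ((b, s), g) = ell2_nth (rslice (lslice (W k \<xi>) g) b) s" by simp
  then show ?thesis
    unfolding lslice_W U_def rslice_tensor[OF unitary_opD(1)[OF unitary_shift_op]]
    by (simp add: ell2_nth_sum)
qed

text \<open>Shifts fix the vacuum string 0. So vacuum vectors go to vacuum vectors: the group
  coordinate moves from 0 to - k and the matrix index is rotated by \<open>V k\<close>.\<close>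

lemma W_ket: "W k (ket ((a, 0), 0)) = (\<Sum>a'\<in>UNIV. V k $ a' $ a *\<^sub>C ket ((a', 0), - k))"
proof (rule ell2_eqI)
  fix p :: "(2 \<times> (F4 \<Rightarrow>\<^sub>0 pauli)) \<times> F4"
  obtain b s g where p: "p = ((b, s), g)" by (metis surj_pair)
  have "g + k = 0 \<longleftrightarrow> g = - k" by (simp add: eq_neg_iff_add_eq_0)
  then show "ell2_nth (W k (ket ((a, 0), 0))) p = ell2_nth (\<Sum>a'\<in>UNIV. V k $ a' $ a *\<^sub>C ket ((a', 0), - k)) p"
    unfolding p ell2_nth_W using exhaust_2[of a] exhaust_2[of b]
    by (auto simp: ell2_nth_sum ell2_nth_ket map_key_add_zero sum_2)
qed

end

text \<open>Meant for a quantity dominated by a vanishing function along an infinite orbit or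
  conjugacy class.\<close>

lemma le_zero_of_tendsto_cofinite:
  fixes f :: "'a \<Rightarrow> real"
  assumes "(f \<longlongrightarrow> 0) cofinite" "infinite A" "\<And>x. x \<in> A \<Longrightarrow> c \<le> f x"
  shows "c \<le> 0"
proof (rule ccontr)
  assume "\<not> c \<le> 0"
  then have "\<forall>\<^sub>F x in cofinite. f x < c" using order_tendstoD(2)[OF assms(1), of c] by simp
  then have "finite {x. \<not> f x < c}" by (simp add: eventually_cofinite)
  moreover have "A \<subseteq> {x. \<not> f x < c}" using assms(3) by (auto simp: not_less)
  ultimately show False using assms(2) finite_subset by blast
qed

context free_group_action
begin

section \<open>Vanishing of the non-scalar components\<close>

text \<open>All that the vanishing argument retains of the normalizing unitary: its coefficient
  vectors and the isometries C_k. The limit hypothesis reflects that squared norms are summable over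
  the strings.\<close>

context
  fixes \<phi> :: "pauli \<Rightarrow> (F4 \<Rightarrow>\<^sub>0 pauli) \<Rightarrow> F4 ell2" and C :: "F4 \<Rightarrow> F4 op"
  assumes C: "\<And>k. bounded_map (C k)" "\<And>k \<xi>. norm (C k \<xi>) = norm \<xi>"
    "\<And>k l \<xi>. C k (rtrans l \<xi>) = rtrans l (C k \<xi>)"
    and rel: "\<And>k q s. C k (\<phi> q s)
      = (\<Sum>r\<in>UNIV. rot k q r *\<^sub>R rtrans k (\<phi> r (Poly_Mapping.map_key (\<lambda>g. k + g) s)))"
    and lim: "\<And>p. ((\<lambda>s. \<phi> p s) \<longlongrightarrow> 0) cofinite"
begin

text \<open>An isometry commuting with right translations preserves the coefficient, so
  \<open>C k\<close> drops out; moving \<open>rtrans k\<close> across replaces l by its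
  conjugate.\<close>

lemma gram_rel:
  fixes k l q r s
  defines "s' \<equiv> Poly_Mapping.map_key (\<lambda>g. k + g) s"
  shows "\<phi> q s \<bullet> rtrans l (\<phi> r s) = (\<Sum>p\<in>UNIV. \<Sum>p'\<in>UNIV.
    rot k q p * rot k r p' * (\<phi> p s' \<bullet> rtrans (- k + l + k) (\<phi> p' s')))"
proof -
  note R = bounded_mapD[OF unitary_opD(2)[OF unitary_rtrans]]
  have inner: "rtrans k \<phi>1 \<bullet> rtrans l (rtrans k \<phi>2) = \<phi>1 \<bullet> rtrans (- k + l + k) \<phi>2" for \<phi>1 \<phi>2
  proof -
    have "rtrans l (rtrans k \<phi>2) = rtrans k (rtrans (- k + l + k) \<phi>2)"
      by (simp add: rtrans_rtrans add.assoc[symmetric])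
    then show ?thesis
      using isometry_inner[OF unitary_opD(2,5)[OF unitary_rtrans]] by metis
  qed
  have "\<phi> q s \<bullet> rtrans l (\<phi> r s) = C k (\<phi> q s) \<bullet> rtrans l (C k (\<phi> r s))"
    unfolding C(3)[symmetric] by (rule isometry_inner[OF C(1,2), symmetric])
  also have "\<dots> = (\<Sum>p\<in>UNIV. \<Sum>p'\<in>UNIV. rot k q p * rot k r p' * (rtrans k (\<phi> p s') \<bullet> rtrans l (rtrans k (\<phi> p' s'))))"
    unfolding rel s'_def R inner_sum_left
    by (simp add: inner_sum_right sum_distrib_left mult_ac)
  finally show ?thesis by (simp only: inner)
qed

text \<open>The columns of \<open>rot k\<close> are orthonormal, so the mixed terms of
  \<open>gram_rel\<close> at l = 0 cancel in the sum over q.\<close>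

lemma norm_sum_invariant:
  "(\<Sum>q\<in>UNIV. \<phi> q s \<bullet> \<phi> q s) = (\<Sum>p\<in>UNIV. \<phi> p (Poly_Mapping.map_key (\<lambda>g. k + g) s)
    \<bullet> \<phi> p (Poly_Mapping.map_key (\<lambda>g. k + g) s))"
proof -
  let ?s = "Poly_Mapping.map_key (\<lambda>g. k + g) s"
  have r0: "rtrans 0 \<xi> = \<xi>" for \<xi> :: "F4 ell2" by (rule ell2_eqI) simp
  have "(\<Sum>q\<in>UNIV. \<phi> q s \<bullet> \<phi> q s)
      = (\<Sum>q\<in>UNIV. \<Sum>p\<in>UNIV. \<Sum>p'\<in>UNIV. rot k q p * rot k q p' * (\<phi> p ?s \<bullet> \<phi> p' ?s))"
    using gram_rel[of _ s 0 _ k] by (simp add: r0)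
  also have "\<dots> = (\<Sum>p\<in>UNIV. \<Sum>p'\<in>UNIV. (\<Sum>q\<in>UNIV. rot k q p * rot k q p') * (\<phi> p ?s \<bullet> \<phi> p' ?s))"
    by (subst sum.swap, rule sum.cong[OF refl], subst sum.swap) (simp add: sum_distrib_right)
  also have "\<dots> = (\<Sum>p\<in>UNIV. \<phi> p ?s \<bullet> \<phi> p ?s)"
    by (simp add: pauli_rot_orthogonal V if_distrib[of "\<lambda>x. x * _"] cong: if_cong)
  finally show ?thesis .
qed

lemma vanish_off_zero:
  assumes "s \<noteq> 0"
  shows "\<phi> p s = 0"
proof -
  let ?N = "\<lambda>s. \<Sum>q\<in>UNIV. \<phi> q s \<bullet> \<phi> q s"
  have "(?N \<longlongrightarrow> 0) cofinite"
    by (intro tendsto_null_sum) (use tendsto_inner[OF lim lim] in simp)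
  then have "?N s \<le> 0"
    by (rule le_zero_of_tendsto_cofinite[OF _ infinite_translates[OF infinite_F4 assms]])
       (auto simp flip: norm_sum_invariant)
  moreover have "\<phi> p s \<bullet> \<phi> p s \<le> ?N s" by (rule member_le_sum) auto
  ultimately show ?thesis by (meson inner_ge_zero inner_eq_zero_iff order_antisym order_trans)
qed

text \<open>Entries of an orthogonal matrix have modulus at most 1, so the sum ?F of all absolute
  coefficients, taken at any conjugate of l, bounds the coefficient at l.\<close>

lemma gram_off_zero:
  assumes "l \<noteq> 0"
  shows "\<phi> q 0 \<bullet> rtrans l (\<phi> r 0) = 0"
proof -
  let ?F = "\<lambda>l. \<Sum>p\<in>UNIV. \<Sum>p'\<in>UNIV. \<bar>\<phi> p 0 \<bullet> rtrans l (\<phi> p' 0)\<bar>"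
  have "(?F \<longlongrightarrow> 0) cofinite"
    by (intro tendsto_null_sum tendsto_rabs_zero rtrans_mixing)
  moreover have "\<bar>\<phi> q 0 \<bullet> rtrans l (\<phi> r 0)\<bar> \<le> ?F (- k + l + k)" for k
  proof -
    have "\<bar>rot k q p * rot k r p' * x\<bar> \<le> \<bar>x\<bar>" for p p' and x :: real
      using abs_pauli_rot_le[OF V(2)]
      by (simp add: abs_mult mult_le_one mult_left_le_one_le)
    moreover have "Poly_Mapping.map_key (\<lambda>g. k + g) 0 = (0 :: F4 \<Rightarrow>\<^sub>0 pauli)" by (simp add: map_key_add_zero)
    ultimately show ?thesis
      unfolding gram_rel[of q 0 l r k]
      by (simp only:) (intro order_trans[OF sum_abs] sum_mono, assumption)
  qed
  ultimately have "\<bar>\<phi> q 0 \<bullet> rtrans l (\<phi> r 0)\<bar> \<le> 0"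
    by (intro le_zero_of_tendsto_cofinite[OF _ infinite_conjugates[OF assms]]) auto
  then show ?thesis by simp
qed

lemma gram_zero_rel:
  "\<phi> q 0 \<bullet> \<phi> r 0 = (\<Sum>p\<in>UNIV. \<Sum>p'\<in>UNIV. pauli_rot (v_mat i) q p * pauli_rot (v_mat i) r p' * (\<phi> p 0 \<bullet> \<phi> p' 0))"
proof -
  have r0: "rtrans 0 \<xi> = \<xi>" for \<xi> :: "F4 ell2" by (rule ell2_eqI) simp
  have "Poly_Mapping.map_key (\<lambda>g. free_gen i + g) 0 = (0 :: F4 \<Rightarrow>\<^sub>0 pauli)" by (simp add: map_key_add_zero)
  then show ?thesis using gram_rel[of q 0 0 r "free_gen i"] by (simp add: rot_gen r0)
qed

text \<open>v_1 and v_2 act by diagonal signs, which kill the mixed terms. For v_4 the X row is - Y,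
  equating the X and Y lengths, and the Z row is (sqrt 3 / 2) X - Z / 2, giving z = 3/4 x + 1/4 z
  and hence z = x for the squared lengths.\<close>

lemma gram_zero:
  "\<phi> PauliX 0 \<bullet> \<phi> PauliY 0 = 0" "\<phi> PauliX 0 \<bullet> \<phi> PauliZ 0 = 0" "\<phi> PauliY 0 \<bullet> \<phi> PauliZ 0 = 0"
  "\<phi> PauliY 0 \<bullet> \<phi> PauliY 0 = \<phi> PauliX 0 \<bullet> \<phi> PauliX 0"
  "\<phi> PauliZ 0 \<bullet> \<phi> PauliZ 0 = \<phi> PauliX 0 \<bullet> \<phi> PauliX 0"
proof -
  note s = sum_pauli
  show 1: "\<phi> PauliX 0 \<bullet> \<phi> PauliY 0 = 0"
    using gram_zero_rel[of PauliX PauliY I2] by (simp add: s pauli_rot_v2 del: v_mat.simps)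
  show 2: "\<phi> PauliX 0 \<bullet> \<phi> PauliZ 0 = 0"
    using gram_zero_rel[of PauliX PauliZ I1] by (simp add: s pauli_rot_v1 del: v_mat.simps)
  show 3: "\<phi> PauliY 0 \<bullet> \<phi> PauliZ 0 = 0"
    using gram_zero_rel[of PauliY PauliZ I1] by (simp add: s pauli_rot_v1 del: v_mat.simps)
  show 4: "\<phi> PauliY 0 \<bullet> \<phi> PauliY 0 = \<phi> PauliX 0 \<bullet> \<phi> PauliX 0"
    using gram_zero_rel[of PauliX PauliX I4] by (simp add: s pauli_rot_v4_X del: v_mat.simps)
  show "\<phi> PauliZ 0 \<bullet> \<phi> PauliZ 0 = \<phi> PauliX 0 \<bullet> \<phi> PauliX 0"
    using gram_zero_rel[of PauliZ PauliZ I4] 2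
    by (simp add: s pauli_rot_v4_Z inner_commute[of "\<phi> PauliZ 0" "\<phi> PauliX 0"]
      del: v_mat.simps)
qed

text \<open>The translates of the three components form an orthogonal system of vectors of equal length.
  If it were nonzero, Bessel's inequality for the vectors \<open>ket 0\<close> and \<open>\<i> *\<^sub>C ket 0\<close>, which
  together read off all coefficients of the components, would give \<open>3 \<le> 2\<close>.\<close>

lemma vanish_non_scalar:
  assumes "p \<noteq> Pauli1"
  shows "\<phi> p 0 = 0"
proof -
  define c where "c = \<phi> PauliX 0 \<bullet> \<phi> PauliX 0"
  define A where "A = {PauliX, PauliY, PauliZ}"
  have gram: "\<phi> p 0 \<bullet> \<phi> q 0 = (if p = q then c else 0)" if "p \<in> A" "q \<in> A" for p q
    using that gram_zero unfolding A_def c_def by (auto simp: inner_commute)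
  have "c = 0"
  proof (rule ccontr)
    assume "c \<noteq> 0"
    then have c: "0 < c" using inner_ge_zero[of "\<phi> PauliX 0"] by (simp add: c_def less_le)
    let ?w = "\<lambda>(k, p). rtrans k (\<phi> p 0)"
    have w: "?w x \<bullet> ?w y = (if x = y then c else 0)" if x: "x \<in> F \<times> A" and y: "y \<in> F \<times> A" for F x y
    proof -
      obtain k p l q where xy: "x = (k, p)" "y = (l, q)" "p \<in> A" "q \<in> A" using x y by auto
      have "rtrans l (\<phi> q 0) = rtrans k (rtrans (- k + l) (\<phi> q 0))"
        by (simp add: rtrans_rtrans add.assoc[symmetric])
      then have "?w x \<bullet> ?w y = \<phi> p 0 \<bullet> rtrans (- k + l) (\<phi> q 0)"
        using isometry_inner[OF unitary_opD(2,5)[OF unitary_rtrans]] by (simp add: xy)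
      moreover have "rtrans 0 \<xi> = \<xi>" for \<xi> :: "F4 ell2" by (rule ell2_eqI) simp
      moreover have "- k + l = 0 \<longleftrightarrow> k = l" by (metis add.left_neutral add_minus_cancel left_minus add.right_neutral)
      ultimately show ?thesis
        using gram_off_zero[of "- k + l" p q] gram[OF xy(3,4)] by (cases "k = l") (auto simp: xy)
    qed
    have bound: "(\<Sum>k\<in>F. \<Sum>p\<in>A. (cmod (ell2_nth (\<phi> p 0) k))\<^sup>2) \<le> 2 * c" if F: "finite F" for F
    proof -
      have fin: "finite (F \<times> A)" using F by (simp add: A_def)
      have "(\<Sum>x\<in>F \<times> A. (ket 0 \<bullet> ?w x)\<^sup>2) \<le> c * (ket 0 \<bullet> (ket 0 :: F4 ell2))"
        by (rule bessel_orthogonal[OF fin w c])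
      moreover have "(\<Sum>x\<in>F \<times> A. ((\<i> *\<^sub>C ket 0) \<bullet> ?w x)\<^sup>2) \<le> c * ((\<i> *\<^sub>C ket 0) \<bullet> (\<i> *\<^sub>C ket 0 :: F4 ell2))"
        by (rule bessel_orthogonal[OF fin w c])
      ultimately have "(\<Sum>x\<in>F \<times> A. (ket 0 \<bullet> ?w x)\<^sup>2 + ((\<i> *\<^sub>C ket 0) \<bullet> ?w x)\<^sup>2) \<le> 2 * c"
        by (simp add: sum.distrib inner_scaleC inner_ket ell2_nth_ket)
      moreover have "(ket 0 \<bullet> ?w x)\<^sup>2 + ((\<i> *\<^sub>C ket 0) \<bullet> ?w x)\<^sup>2 = (case x of (k, p) \<Rightarrow> (cmod (ell2_nth (\<phi> p 0) k))\<^sup>2)" for x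
        by (cases x) (simp add: inner_scaleC inner_ket cmod_power2)
      ultimately show ?thesis by (simp add: sum.cartesian_product)
    qed
    have "((\<lambda>k. \<Sum>p\<in>A. (cmod (ell2_nth (\<phi> p 0) k))\<^sup>2) has_sum (\<Sum>p\<in>A. (norm (\<phi> p 0))\<^sup>2)) UNIV"
      unfolding A_def by simp (intro has_sum_add has_sum_norm_ell2)
    then have "(\<Sum>p\<in>A. (norm (\<phi> p 0))\<^sup>2) \<le> 2 * c"
      by (rule has_sum_le_finite_sums) (rule bound)
    moreover have "(\<Sum>p\<in>A. (norm (\<phi> p 0))\<^sup>2) = 3 * c"
    proof -
      have "(\<Sum>p\<in>A. (norm (\<phi> p 0))\<^sup>2) = (\<Sum>p\<in>A. c)"
        by (rule sum.cong) (simp_all add: gram power2_norm_eq_inner)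
      then show ?thesis by (simp add: A_def)
    qed
    ultimately show False using c by simp
  qed
  moreover have "p \<in> A" using assms by (cases p) (auto simp: A_def)
  ultimately show ?thesis using gram[of p p] by simp
qed

end

end

context free_group_action
begin

section \<open>Singularity\<close>

text \<open>If \<open>\<zeta> a\<close> is the image of the \<open>a\<close>-th vacuum vector under an operator \<open>x\<close>, then
  \<open>smat \<zeta> s g\<close> is the matrix part of the Fourier coefficient of \<open>x\<close> at \<open>g\<close> and at the Pauli string
  \<open>s\<close>, and \<open>coef \<zeta> p s\<close> is twice its component along \<open>\<sigma>\<^sub>p\<close>, as a function of \<open>g\<close>.\<close>

definition coef :: "(2 \<Rightarrow> ((2 \<times> (F4 \<Rightarrow>\<^sub>0 pauli)) \<times> F4) ell2) \<Rightarrow> pauli \<Rightarrow> (F4 \<Rightarrow>\<^sub>0 pauli) \<Rightarrow> F4 ell2" where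
  "coef \<zeta> p s = (\<Sum>a\<in>UNIV. \<Sum>b\<in>UNIV. pauli_mat p $ a $ b *\<^sub>C rslice (\<zeta> a) (b, s))"

definition smat :: "(2 \<Rightarrow> ((2 \<times> (F4 \<Rightarrow>\<^sub>0 pauli)) \<times> F4) ell2) \<Rightarrow> (F4 \<Rightarrow>\<^sub>0 pauli) \<Rightarrow> F4 \<Rightarrow> mat2" where
  "smat \<zeta> s g = (\<chi> b a. ell2_nth (\<zeta> a) ((b, s), g))"

lemma ell2_nth_coef: "ell2_nth (coef \<zeta> p s) g = 2 * ntr (pauli_mat p ** smat \<zeta> s g)"
  by (simp add: coef_def smat_def ell2_nth_sum ntr_eq mat2_mult_nth sum_2)

lemma fibre_op_coef:
  assumes "y \<in> group_vn"
  shows "fibre_op y (coef \<zeta> p s) = coef (\<lambda>a. y (\<zeta> a)) p s"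
  by (simp add: coef_def rslice_group_vn[OF assms] bounded_mapD[OF bounded_map_fibre_op[OF assms]])

lemma coef_tendsto_0: "((\<lambda>s. coef \<zeta> p s) \<longlongrightarrow> 0) cofinite"
proof -
  have scale: "((\<lambda>s. c *\<^sub>C f s) \<longlongrightarrow> 0) F" if "(f \<longlongrightarrow> 0) F"
    for c and f :: "(F4 \<Rightarrow>\<^sub>0 pauli) \<Rightarrow> F4 ell2" and F
    using tendsto_mult_right_zero[OF tendsto_norm_zero[OF that], of "cmod c"]
    by (auto intro: tendsto_norm_zero_cancel[of "\<lambda>s. c *\<^sub>C f s"] simp: norm_scaleC)
  have slice: "((\<lambda>s. rslice (\<zeta> a) (b, s)) \<longlongrightarrow> 0) cofinite" for a b
    using filterlim_compose[OF rslice_tendsto_0[of "\<zeta> a"] filterlim_inj_cofinite, of "Pair b"]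
    by (simp add: inj_on_def)
  show ?thesis
    unfolding coef_def by (intro tendsto_null_sum) (rule scale[OF slice])
qed

text \<open>Collected over a, the hypothesis says X V = V Y for the coefficient matrices of \<eta>
  and of the translated \<zeta>. So X is Y conjugated by V, which in Pauli coordinates is
  \<open>rot\<close>.\<close>

lemma coef_W:
  assumes "\<And>a. (\<Sum>a'\<in>UNIV. V k $ a' $ a *\<^sub>C \<eta> a') = W k (\<zeta> a)"
  shows "coef \<eta> q s = (\<Sum>r\<in>UNIV. rot k q r *\<^sub>R rtrans k (coef \<zeta> r (Poly_Mapping.map_key (\<lambda>g. k + g) s)))"
proof (rule ell2_eqI)
  fix g
  let ?X = "smat \<eta> s g" and ?Y = "smat \<zeta> (Poly_Mapping.map_key (\<lambda>g. k + g) s) (g + k)"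
  have "?X ** V k = V k ** ?Y"
  proof -
    have "(?X ** V k) $ b $ a = ell2_nth (\<Sum>a'\<in>UNIV. V k $ a' $ a *\<^sub>C \<eta> a') ((b, s), g)" for a b
      by (simp add: smat_def matrix_matrix_mult_def ell2_nth_sum mult.commute)
    moreover have "(V k ** ?Y) $ b $ a = ell2_nth (W k (\<zeta> a)) ((b, s), g)" for a b
      by (simp add: smat_def matrix_matrix_mult_def ell2_nth_W)
    ultimately show ?thesis by (simp add: vec_eq_iff assms)
  qed
  then have "?X ** (V k ** dagger (V k)) = V k ** ?Y ** dagger (V k)"
    by (simp add: matrix_mul_assoc)
  then have X: "?X = V k ** ?Y ** dagger (V k)" by (simp add: V)
  have "ntr (pauli_mat q ** ?X) = ntr ((pauli_mat q ** V k ** ?Y) ** dagger (V k))"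
    by (simp add: X matrix_mul_assoc)
  also have "\<dots> = ntr ((dagger (V k) ** pauli_mat q ** V k) ** ?Y)"
    using ntr_commute[of "pauli_mat q ** V k ** ?Y" "dagger (V k)"] by (simp add: matrix_mul_assoc)
  also have "\<dots> = (\<Sum>r\<in>UNIV. of_real (rot k q r) * ntr (pauli_mat r ** ?Y))"
  proof -
    have "ntr (pauli_mat r ** (dagger (V k) ** pauli_mat q ** V k)) = of_real (rot k q r)" for r
      using of_real_pauli_rot[of "dagger (V k)" r q] by (simp add: pauli_rot_dagger)
    then show ?thesis by (subst pauli_parseval) simp
  qed
  finally show "ell2_nth (coef \<eta> q s) g = ell2_nth (\<Sum>r\<in>UNIV. rot k q r *\<^sub>R
      rtrans k (coef \<zeta> r (Poly_Mapping.map_key (\<lambda>g. k + g) s))) g"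
    by (simp add: ell2_nth_coef ell2_nth_sum sum_distrib_left scaleR_conv_of_real mult_ac)
qed

lemma normalizer_in_LG:
  assumes u: "u \<in> P" "unitary_op u" and norm: "Ad u ` LG = LG"
  shows "u \<in> LG"
proof -
  note uD = unitary_opD[OF u(2)]
  \<comment> \<open>The sign matches \<open>W k\<close>, which carries vacuum vectors at 0 to vacuum
    vectors at - k.\<close>
  define y where "y k = Ad u (cp_unitary (- k))" for k
  have y: "y k \<in> group_vn" for k
  proof -
    have "cp_unitary (- k) \<in> LG"
      unfolding LG_def group_vn_def
      by (rule subsetD[OF vn_generated_superset]) (auto simp: unitary_opD(1) unitary_cp_unitary)
    then show ?thesis using norm by (auto simp: y_def LG_def)
  qed
  have yu: "y k (u \<xi>) = u (cp_unitary (- k) \<xi>)" for k \<xi>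
    by (simp add: y_def Ad_def uD)
  have y_iso: "norm (y k \<xi>) = norm \<xi>" for k \<xi>
    by (simp add: y_def Ad_def uD unitary_opD[OF unitary_cp_unitary])
  define \<xi> where "\<xi> a = u (ket ((a, 0), 0))" for a
  define C where "C k = fibre_op (y k)" for k
  have C: "bounded_map (C k)" "norm (C k \<eta>) = norm \<eta>" "C k (rtrans l \<eta>) = rtrans l (C k \<eta>)" for k l \<eta>
    unfolding C_def
    by (rule bounded_map_fibre_op[OF y] fibre_op_isometry[OF y y_iso] fibre_op_rtrans[OF y])+
  \<comment> \<open>Both sides are u applied to \<open>W k (ket ((a, 0), 0))\<close>: one by the
    relation \<open>yu\<close>, the other because u commutes with \<open>W k\<close>.\<close>
  have "(\<Sum>a'\<in>UNIV. V k $ a' $ a *\<^sub>C y k (\<xi> a')) = W k (\<xi> a)" for k a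
  proof -
    have "(\<Sum>a'\<in>UNIV. V k $ a' $ a *\<^sub>C y k (\<xi> a')) = u (\<Sum>a'\<in>UNIV. V k $ a' $ a *\<^sub>C ket ((a', 0), - k))"
      by (simp add: \<xi>_def yu cp_unitary_ket bounded_mapD[OF uD(2)])
    then show ?thesis by (simp add: \<xi>_def P_commutes_W[OF u(1)] flip: W_ket)
  qed
  then have rel: "C k (coef \<xi> q s) = (\<Sum>r\<in>UNIV. rot k q r *\<^sub>R
      rtrans k (coef \<xi> r (Poly_Mapping.map_key (\<lambda>g. k + g) s)))" for k q s
    unfolding C_def fibre_op_coef[OF y] by (rule coef_W)
  note van = vanish_off_zero[OF C rel coef_tendsto_0] vanish_non_scalar[OF C rel coef_tendsto_0]
  \<comment> \<open>The factor 1 / 2 undoes the 2 in \<open>ell2_nth_coef\<close>; f holds the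
    scalar Fourier coefficients of u.\<close>
  define f where "f = (1 / 2) *\<^sub>C coef \<xi> Pauli1 0"
  have Cf: "C k f = rtrans k f" for k
  proof -
    have "C k (coef \<xi> Pauli1 0) = rtrans k (coef \<xi> Pauli1 0)"
      using rel[of k Pauli1 0] pauli_rot_Pauli1_left[OF V(2)]
      by (simp add: sum_pauli map_key_add_zero[THEN iffD2])
    then show ?thesis
      by (simp add: f_def bounded_mapD[OF C(1)] bounded_mapD[OF unitary_opD(2)[OF unitary_rtrans]])
  qed
  \<comment> \<open>Strings are built from the vacuum one site at a time by right Pauli
    multiplications, which commute with u; each new site lies outside the support, so its entry is
    still \<open>Pauli1\<close>.\<close>
  have nth: "ell2_nth (u (ket ((a, t), 0))) ((b, s), g) = (if b = a \<and> s = t then ell2_nth f g else 0)"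
    for a t b s g
  proof (induction t arbitrary: s rule: update_induct)
    case (const s)
    have "ell2_nth (u (ket ((a, 0), 0))) ((b, s), g) = smat \<xi> s g $ b $ a"
      by (simp add: smat_def \<xi>_def)
    also have "\<dots> = (\<Sum>p\<in>UNIV. (1 / 2) * ell2_nth (coef \<xi> p s) g * pauli_mat p $ b $ a)"
      by (subst pauli_expansion) (simp add: ell2_nth_coef)
    also have "\<dots> = (if b = a \<and> s = 0 then ell2_nth f g else 0)"
      using van by (cases "s = 0") (auto simp: sum_pauli f_def mat_def)
    finally show ?case .
  next
    case (update t g0 p s)
    let ?T = "amp_left (amp_right (pauli_right g0 p))"
    let ?t = "Poly_Mapping.update g0 p t"
    let ?m = "\<lambda>s. Poly_Mapping.update g0 (pauli_mult (Poly_Mapping.lookup s g0) p) s"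
    have t0: "Poly_Mapping.lookup t g0 = Pauli1"
      using update(1) by (simp add: in_keys_iff zero_pauli_def)
    have T: "ell2_nth (?T \<zeta>) ((b, s), g) = pauli_phase (Poly_Mapping.lookup s g0) p * ell2_nth \<zeta> ((b, ?m s), g)"
      for \<zeta> :: "((2 \<times> (F4 \<Rightarrow>\<^sub>0 pauli)) \<times> F4) ell2" and b s g
    proof -
      note ub = unitary_opD(1)[OF unitary_pauli_right]
      have "ell2_nth (?T \<zeta>) ((b, s), g) = ell2_nth (rslice (lslice (?T \<zeta>) g) b) s" by simp
      then show ?thesis
        unfolding lslice_amp_left[OF bounded_op_amp_right[OF ub]] rslice_amp_right[OF ub]
        by (simp add: ell2_nth_pauli_right)
    qed
    have m: "?m s = t \<longleftrightarrow> s = ?t" for s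
    proof
      assume eq: "?m s = t"
      then have "Poly_Mapping.lookup (?m s) g0 = Pauli1" by (simp add: t0)
      then have "pauli_mult (Poly_Mapping.lookup s g0) p = Pauli1" by (simp add: lookup_update)
      then have "Poly_Mapping.lookup s g0 = p" using pauli_mult_mult[of "Poly_Mapping.lookup s g0" p] by simp
      then have "Poly_Mapping.update g0 p (?m s) = s" by (metis update_lookup update_update(1))
      then show "s = ?t" by (simp add: eq)
    next
      assume s: "s = ?t"
      have "pauli_mult p p = Pauli1" using pauli_mult_mult[of Pauli1 p] by simp
      then show "?m s = t"
        using update_lookup[of g0 t] by (simp add: s lookup_update update_update t0)
    qed
    \<comment> \<open>The phase that occurs is \<open>pauli_phase p p\<close>, which is 1, so basis
      vectors go exactly to basis vectors.\<close>
    have Tket: "?T (ket ((a, t), 0 :: F4)) = ket ((a, ?t), 0)"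
    proof (rule ell2_eqI)
      fix n :: "(2 \<times> (F4 \<Rightarrow>\<^sub>0 pauli)) \<times> F4"
      obtain b s g where n: "n = ((b, s), g)" by (metis surj_pair)
      show "ell2_nth (?T (ket ((a, t), 0))) n = ell2_nth (ket ((a, ?t), 0)) n"
        unfolding n T ell2_nth_ket by (auto simp: m lookup_update)
    qed
    have "ell2_nth (u (ket ((a, ?t), 0))) ((b, s), g) = ell2_nth (?T (u (ket ((a, t), 0)))) ((b, s), g)"
      by (simp flip: Tket P_commutes_pauli_right[OF u(1)])
    also have "\<dots> = (if b = a \<and> s = ?t then ell2_nth f g else 0)"
      unfolding T update(3) m by (auto simp: lookup_update)
    finally show ?case .
  qed
  show ?thesis
    unfolding LG_def
  proof (rule group_vnI[where c = "ell2_nth f"])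
    show "bounded_op u" by (rule uD(1))
    fix i i' :: "2 \<times> (F4 \<Rightarrow>\<^sub>0 pauli)" and h g :: F4
    have sl: "rslice (u (ket (i, 0))) i' = (if i' = i then f else 0)"
      by (rule ell2_eqI, cases i, cases i') (simp add: nth)
    \<comment> \<open>The group coordinate is moved from 0 to h by u_h, which becomes
      \<open>y (- h)\<close> on the other side of u.\<close>
    have "u (ket (i, h)) = y (- h) (u (ket (i, 0)))" by (simp add: yu cp_unitary_ket)
    then have "rslice (u (ket (i, h))) i' = C (- h) (rslice (u (ket (i, 0))) i')"
      by (simp add: rslice_group_vn[OF y] C_def)
    then have "rslice (u (ket (i, h))) i' = (if i' = i then rtrans (- h) f else 0)"
      by (simp add: sl Cf bounded_mapD[OF C(1)])
    then have "ell2_nth (rslice (u (ket (i, h))) i') g = (if i' = i then ell2_nth f (g - h) else 0)"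
      by simp
    then show "ell2_nth (u (ket (i, h))) (i', g) = (if i' = i then ell2_nth f (g - h) else 0)"
      by simp
  qed
qed

section \<open>Quasinormalizers\<close>

abbreviation pauli_amp :: "pauli \<Rightarrow> (2 \<times> (F4 \<Rightarrow>\<^sub>0 pauli)) op" where
  "pauli_amp p \<equiv> mat_op (pauli_mat p) \<otimes>\<^sub>o id"

definition E :: "pauli \<Rightarrow> ((2 \<times> (F4 \<Rightarrow>\<^sub>0 pauli)) \<times> F4) op" where
  "E p = cp_embed \<alpha> (pauli_amp p)"

lemma bounded_pauli_amp: "bounded_op (pauli_amp p)"
  by (intro bounded_op_tensor bounded_op_mat_op bounded_op_id)

lemma id_in_R: "id \<in> R_alg"
  by (auto simp: R_alg_eq vn_generated_def commutant_def[of "commutant _"] bounded_op_id)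

lemma pauli_amp_in_M: "pauli_amp p \<in> M_alg"
  unfolding M_alg_eq by (rule tensor_in_vn_tensor) (use id_in_R R_alg_eq in simp)

lemma E_in_P: "E p \<in> P"
  unfolding E_def by (rule cp_embed_in_P[OF pauli_amp_in_M])

lemma \<alpha>_pauli_amp: "\<alpha> g (pauli_amp p) \<eta> = (\<Sum>i\<in>UNIV. rot g i p *\<^sub>R pauli_amp i \<eta>)"
proof -
  have "bernoulli g id = (id :: (F4 \<Rightarrow>\<^sub>0 pauli) op)"
    using unitary_shift_op[of g] by (simp add: bernoulli_def Ad_def unitary_op_def)
  then have "\<alpha> g (pauli_amp p) = mat_op (V g ** pauli_mat p ** dagger (V g)) \<otimes>\<^sub>o id"
    by (simp add: \<alpha>_tensor id_in_R M2_def V)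
  then show ?thesis
    by (intro rslice_eqI ell2_eqI)
       (simp add: rslice_tensor[OF bounded_op_id] rslice_simps pauli_rot_expansion sum_2 sum_pauli
         scaleR_conv_of_real algebra_simps del: pauli_mat.simps ell2_nth_rslice)
qed

lemma lslice_E: "lslice (E p \<xi>) g = (\<Sum>i\<in>UNIV. rot (- g) i p *\<^sub>R pauli_amp i (lslice \<xi> g))"
  by (simp add: E_def lslice_cp_embed[OF pauli_amp_in_M] \<alpha>_pauli_amp)

text \<open>These matrix coefficients are the functions of g by which \<open>cp_embed\<close> twists
  the Pauli matrices.\<close>

definition coord_mult :: "pauli \<Rightarrow> pauli \<Rightarrow> ((2 \<times> (F4 \<Rightarrow>\<^sub>0 pauli)) \<times> F4) op" where
  "coord_mult i p = decomposable (\<lambda>g \<eta>. rot (- g) i p *\<^sub>R \<eta>)"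

lemma coord_mult:
  shows lslice_coord_mult: "lslice (coord_mult i p \<xi>) g = rot (- g) i p *\<^sub>R lslice \<xi> g"
    and bounded_op_coord_mult: "bounded_op (coord_mult i p)"
proof -
  have b: "bounded_op (\<lambda>\<eta>. rot (- g) i p *\<^sub>R \<eta> :: (2 \<times> (F4 \<Rightarrow>\<^sub>0 pauli)) ell2)" for g
    unfolding bounded_op_iff_map scaleC_simps(10)[symmetric]
    by (rule bounded_map_scaleC[OF bounded_map_id(1)])
  have n: "norm (rot (- g) i p *\<^sub>R \<eta>) \<le> 1 * norm \<eta>" for g and \<eta> :: "(2 \<times> (F4 \<Rightarrow>\<^sub>0 pauli)) ell2"
    using abs_pauli_rot_le[OF V(2)] by (simp add: mult_left_le_one_le)
  show "lslice (coord_mult i p \<xi>) g = rot (- g) i p *\<^sub>R lslice \<xi> g" "bounded_op (coord_mult i p)"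
    unfolding coord_mult_def by (rule lslice_decomposable[OF b n] bounded_op_decomposable[OF b n], simp)+
qed

lemmas coord_mult_simps = bounded_mapD[OF bounded_op_coord_mult[unfolded bounded_op_iff_map]]

text \<open>The untwisted Pauli matrices commute with \<open>LG\<close>, so the coordinate
  multipliers carry all of the interaction between \<open>E\<close> and \<open>LG\<close>.\<close>

abbreviation T :: "pauli \<Rightarrow> ((2 \<times> (F4 \<Rightarrow>\<^sub>0 pauli)) \<times> F4) op" where
  "T i \<equiv> amp_left (pauli_amp i)"

lemma lslice_T: "lslice (T i \<xi>) g = pauli_amp i (lslice \<xi> g)"
  by (rule lslice_amp_left[OF bounded_pauli_amp])

lemma LG_T:
  assumes "b \<in> LG"
  shows "b (T i \<xi>) = T i (b \<xi>)"
proof -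
  have "b \<circ> T i = T i \<circ> b"
    using assms unfolding LG_def
    by (rule group_vn_commutes[OF _ bounded_op_amp_left[OF bounded_pauli_amp]])
       (rule ext, rule lslice_eqI, simp add: lslice_T lslice_cp_unitary)
  then show ?thesis by (metis comp_apply)
qed

lemma rot_row_orthogonal: "(\<Sum>l\<in>UNIV. rot g i l * rot g j l) = (if i = j then 1 else 0)"
  using pauli_rot_orthogonal[of "dagger (V g)" i j] by (simp add: pauli_rot_dagger V)

lemmas pauli_amp_simps = bounded_mapD[OF bounded_pauli_amp[unfolded bounded_op_iff_map]]

lemma E_eq: "E p \<xi> = (\<Sum>i\<in>UNIV. coord_mult i p (T i \<xi>))" "E p \<xi> = (\<Sum>i\<in>UNIV. T i (coord_mult i p \<xi>))"
  by (rule lslice_eqI, simp add: lslice_E lslice_simps lslice_coord_mult lslice_T pauli_amp_simps)+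

text \<open>Orthonormality of the rows of \<open>rot g\<close> inverts \<open>E_eq\<close>.\<close>

lemma sum_coord_mult_E:
  "(\<Sum>l\<in>UNIV. coord_mult i l (E l \<xi>)) = T i \<xi>" "(\<Sum>l\<in>UNIV. E l (coord_mult i l \<xi>)) = T i \<xi>"
proof -
  have "(\<Sum>l\<in>UNIV. \<Sum>j\<in>UNIV. (rot g i l * rot g j l) *\<^sub>R pauli_amp j \<eta>) = pauli_amp i \<eta>" for g \<eta>
    by (subst sum.swap) (simp add: rot_row_orthogonal if_distrib[of "\<lambda>x. x *\<^sub>R _"] cong: if_cong flip: scaleR_sum_left)
  then show "(\<Sum>l\<in>UNIV. coord_mult i l (E l \<xi>)) = T i \<xi>" "(\<Sum>l\<in>UNIV. E l (coord_mult i l \<xi>)) = T i \<xi>"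
    by (auto intro!: lslice_eqI simp: lslice_E lslice_simps lslice_coord_mult lslice_T pauli_amp_simps
        scaleR_sum_right mult.commute)
qed

text \<open>The matrix coefficients of \<open>twist b j l\<close> are those of \<open>b\<close> multiplied by the positions
  \<open>(j, l)\<close> of the finite-dimensional orthogonal representation, a Herz--Schur multiplier.\<close>

definition twist :: "((2 \<times> (F4 \<Rightarrow>\<^sub>0 pauli)) \<times> F4) op \<Rightarrow> pauli \<Rightarrow> pauli \<Rightarrow> ((2 \<times> (F4 \<Rightarrow>\<^sub>0 pauli)) \<times> F4) op" where
  "twist b j l \<xi> = (\<Sum>i\<in>UNIV. coord_mult i j (b (coord_mult i l \<xi>)))"

text \<open>Its entries are those of b times \<open>rot (g - a) j l\<close>, again functions of g -
  a, so \<open>group_vnI\<close> applies. Boundedness is immediate because the multiplier is a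
  finite sum of products of bounded operators.\<close>

lemma twist_in_LG:
  assumes "b \<in> LG"
  shows "twist b j l \<in> LG"
proof -
  have bb: "bounded_map b"
    using assms group_vn_bounded by (auto simp: LG_def bounded_op_iff_map)
  obtain c where c: "\<And>i a i' g. ell2_nth (b (ket (i, a))) (i', g) = (if i' = i then c (g - a) else 0)"
    using group_vn_entries[of b] assms unfolding LG_def by blast
  have nth: "ell2_nth (coord_mult i p \<xi>) (n, g) = of_real (rot (- g) i p) * ell2_nth \<xi> (n, g)" for i p \<xi> n g
  proof -
    have "ell2_nth (coord_mult i p \<xi>) (n, g) = ell2_nth (lslice (coord_mult i p \<xi>) g) n" by simp
    then show ?thesis unfolding lslice_coord_mult by (simp add: scaleR_conv_of_real)
  qed
  have ket: "coord_mult i p (ket (n, a)) = rot (- a) i p *\<^sub>R ket (n, a)" for i p n a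
    by (rule ell2_eqI) (auto simp: nth ell2_nth_ket scaleR_conv_of_real split_paired_all)
  \<comment> \<open>Factor rot (- a) as rot (- g) times rot (g - a) and cancel rot (- g) by
    orthogonality.\<close>
  have mult: "(\<Sum>i\<in>UNIV. rot (- g) i j * rot (- a) i l) = rot (g - a) j l" for g a
  proof -
    have "- g + (g - a) = - a" by (simp add: add_diff_eq)
    then have "rot (- a) i l = (\<Sum>r\<in>UNIV. rot (- g) i r * rot (g - a) r l)" for i
      using rot_add[of "- g" "g - a" i l] by simp
    then have "(\<Sum>i\<in>UNIV. rot (- g) i j * rot (- a) i l)
        = (\<Sum>i\<in>UNIV. \<Sum>r\<in>UNIV. rot (- g) i j * rot (- g) i r * rot (g - a) r l)"
      by (simp only: sum_distrib_left mult.assoc)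
    also have "\<dots> = (\<Sum>r\<in>UNIV. (\<Sum>i\<in>UNIV. rot (- g) i j * rot (- g) i r) * rot (g - a) r l)"
      unfolding sum_distrib_right by (rule sum.swap)
    finally show ?thesis
      by (simp add: pauli_rot_orthogonal V if_distrib[of "\<lambda>x. x * _"] cong: if_cong)
  qed
  note cm = bounded_op_coord_mult[unfolded bounded_op_iff_map]
  show ?thesis
    unfolding LG_def
  proof (rule group_vnI[where c = "\<lambda>g. of_real (rot g j l) * c g"])
    show "bounded_op (twist b j l)"
      unfolding twist_def[abs_def] bounded_op_iff_map
      by (rule bounded_map_sum, rule bounded_map_compose(1)[OF cm bounded_map_compose(1)[OF bb cm]])
    fix n n' :: "2 \<times> (F4 \<Rightarrow>\<^sub>0 pauli)" and a g :: F4
    have "ell2_nth (twist b j l (ket (n, a))) (n', g)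
        = (\<Sum>i\<in>UNIV. of_real (rot (- g) i j * rot (- a) i l)) * ell2_nth (b (ket (n, a))) (n', g)"
      by (simp add: twist_def ell2_nth_sum nth ket bounded_mapD[OF bb] scaleR_conv_of_real sum_distrib_right mult.assoc)
    also have "\<dots> = of_real (rot (g - a) j l) * ell2_nth (b (ket (n, a))) (n', g)"
      unfolding of_real_sum[symmetric] mult ..
    finally show "ell2_nth (twist b j l (ket (n, a))) (n', g)
        = (if n' = n then of_real (rot (g - a) j l) * c (g - a) else 0)"
      by (simp add: c)
  qed
qed

text \<open>Write M_ij for the coordinate multipliers. Then E_j b = sum_i M_ij T_i b = sum_i M_ij b
  T_i, and inserting T_i = sum_l M_il E_l collects everything left of E_l into
  \<open>twist b j l\<close>. The other side is analogous.\<close>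

lemma E_quasinormalizer: "E j \<in> quasinormalizers LG P"
proof -
  \<comment> \<open>Quasinormalizers are defined with families indexed by natural numbers below n,
    so the four Pauli matrices are enumerated.\<close>
  define \<iota> :: "nat \<Rightarrow> pauli" where "\<iota> k = [Pauli1, PauliX, PauliY, PauliZ] ! k" for k
  have \<iota>: "(\<Sum>k<4. f (\<iota> k)) = (\<Sum>p\<in>UNIV. f p)" for f :: "pauli \<Rightarrow> 'x :: comm_monoid_add"
    by (simp add: \<iota>_def sum_pauli eval_nat_numeral)
  have left: "E j \<circ> b = (\<lambda>\<xi>. \<Sum>k<4. twist b j (\<iota> k) (E (\<iota> k) \<xi>))" if b: "b \<in> LG" for b
  proof
    fix \<xi>
    have bb: "bounded_map b"
      using b group_vn_bounded by (auto simp: LG_def bounded_op_iff_map)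
    have "(\<Sum>l\<in>UNIV. twist b j l (E l \<xi>)) = (\<Sum>i\<in>UNIV. coord_mult i j (b (\<Sum>l\<in>UNIV. coord_mult i l (E l \<xi>))))"
      unfolding twist_def by (subst sum.swap) (simp add: coord_mult_simps bounded_mapD[OF bb])
    also have "\<dots> = E j (b \<xi>)"
      by (simp add: sum_coord_mult_E E_eq(1)[of j "b \<xi>"] LG_T[OF b])
    finally show "(E j \<circ> b) \<xi> = (\<Sum>k<4. twist b j (\<iota> k) (E (\<iota> k) \<xi>))"
      using \<iota>[of "\<lambda>l. twist b j l (E l \<xi>)"] by simp
  qed
  have right: "b \<circ> E j = (\<lambda>\<xi>. \<Sum>k<4. E (\<iota> k) (twist b (\<iota> k) j \<xi>))" if b: "b \<in> LG" for b
  proof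
    fix \<xi>
    have bb: "bounded_map b"
      using b group_vn_bounded by (auto simp: LG_def bounded_op_iff_map)
    have Eb: "bounded_map (E l)" for l
      using P_bounded[OF E_in_P] by (simp add: bounded_op_iff_map)
    have "(\<Sum>l\<in>UNIV. E l (twist b l j \<xi>)) = (\<Sum>i\<in>UNIV. \<Sum>l\<in>UNIV. E l (coord_mult i l (b (coord_mult i j \<xi>))))"
      unfolding twist_def by (subst sum.swap) (simp add: bounded_mapD[OF Eb])
    also have "\<dots> = b (E j \<xi>)"
      by (simp add: sum_coord_mult_E E_eq(2)[of j \<xi>] LG_T[OF b] bounded_mapD[OF bb])
    finally show "(b \<circ> E j) \<xi> = (\<Sum>k<4. E (\<iota> k) (twist b (\<iota> k) j \<xi>))"
      using \<iota>[of "\<lambda>l. E l (twist b l j \<xi>)"] by simp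
  qed
  show ?thesis
    unfolding quasinormalizers_def
  proof (intro CollectI conjI E_in_P, rule exI[of _ 4], rule exI[of _ "\<lambda>k. E (\<iota> k)"],
      intro conjI ballI allI impI E_in_P)
    fix b assume b: "b \<in> LG"
    show "\<exists>c. (\<forall>k<4. c k \<in> LG) \<and> E j \<circ> b = (\<lambda>\<xi>. \<Sum>k<4. c k (E (\<iota> k) \<xi>))"
      by (rule exI[of _ "\<lambda>k. twist b j (\<iota> k)"]) (simp add: left[OF b] twist_in_LG[OF b])
    show "\<exists>c. (\<forall>k<4. c k \<in> LG) \<and> b \<circ> E j = (\<lambda>\<xi>. \<Sum>k<4. E (\<iota> k) (c k \<xi>))"
      by (rule exI[of _ "\<lambda>k. twist b (\<iota> k) j"]) (simp add: right[OF b] twist_in_LG[OF b])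
  qed
qed

text \<open>An element of \<open>LG\<close> has the same diagonal entry \<open>c 0\<close> at both
  vacuum vectors over 0, while sigma_Z has 1 and -1 there.\<close>

lemma E_not_in_LG: "E PauliZ \<notin> LG"
proof
  assume "E PauliZ \<in> LG"
  then obtain c where c: "\<And>i a i' g. ell2_nth (E PauliZ (ket (i, a))) (i', g) = (if i' = i then c (g - a) else 0)"
    using group_vn_entries[of "E PauliZ"] unfolding LG_def by blast
  have \<alpha>0: "\<alpha> 0 (pauli_amp PauliZ) = pauli_amp PauliZ"
    using \<alpha>_action pauli_amp_in_M[of PauliZ] unfolding vn_action_def by blast
  have "ell2_nth (E PauliZ (ket ((a, 0), 0))) ((a, 0), 0) = pauli_mat PauliZ $ a $ a" for a
  proof -
    have "ell2_nth (E PauliZ (ket ((a, 0), 0))) ((a, 0), 0)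
        = ell2_nth (rslice (lslice (E PauliZ (ket ((a, 0), 0))) 0) a) 0" by simp
    also have "\<dots> = (\<Sum>b\<in>UNIV. pauli_mat PauliZ $ a $ b * ell2_nth (ket ((a, 0), 0 :: F4)) ((b, 0 :: F4 \<Rightarrow>\<^sub>0 pauli), 0))"
      unfolding E_def lslice_cp_embed[OF pauli_amp_in_M] minus_zero \<alpha>0 rslice_tensor[OF bounded_op_id]
      by (simp add: ell2_nth_sum)
    also have "\<dots> = pauli_mat PauliZ $ a $ a"
      by (simp add: ell2_nth_ket if_distrib[of "\<lambda>x. _ * x"] del: pauli_mat.simps cong: if_cong)
    finally show ?thesis .
  qed
  from this[of 1] this[of 2] show False by (simp add: c)
qed

lemma LG_subset_quasinormalizers: "LG \<subseteq> quasinormalizers LG P"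
proof
  fix x assume x: "x \<in> (LG :: ((2 \<times> (F4 \<Rightarrow>\<^sub>0 pauli)) \<times> F4) op set)"
  have id: "id \<in> (LG :: ((2 \<times> (F4 \<Rightarrow>\<^sub>0 pauli)) \<times> F4) op set)"
    by (auto simp: LG_def group_vn_def vn_generated_def commutant_def[of "commutant _"] bounded_op_id)
  have comp: "x \<circ> b \<in> LG" "b \<circ> x \<in> LG" if "b \<in> LG" for b
    using x that unfolding LG_def group_vn_def vn_generated_def by (auto intro: commutant_compose)
  show "x \<in> quasinormalizers LG P"
    unfolding quasinormalizers_def
  proof (intro CollectI conjI, use x LG_subset_P in blast, rule exI[of _ 1], rule exI[of _ "\<lambda>_. id"],
      intro conjI ballI allI impI)
    show "id \<in> P" using id LG_subset_P by auto
    fix b assume "b \<in> (LG :: ((2 \<times> (F4 \<Rightarrow>\<^sub>0 pauli)) \<times> F4) op set)"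
    note comp = comp[OF this]
    show "\<exists>c. (\<forall>k<1. c k \<in> LG) \<and> x \<circ> b = (\<lambda>\<xi>. \<Sum>k<1::nat. c k (id \<xi>))"
      by (rule exI[of _ "\<lambda>_. x \<circ> b"]) (simp add: comp fun_eq_iff)
    show "\<exists>c. (\<forall>k<1. c k \<in> LG) \<and> b \<circ> x = (\<lambda>\<xi>. \<Sum>k<1::nat. id (c k \<xi>))"
      by (rule exI[of _ "\<lambda>_. b \<circ> x"]) (simp add: comp fun_eq_iff)
  qed
qed

end

theorem theorem3p6:
  fixes \<beta> :: "F4 \<Rightarrow> 2 op \<Rightarrow> 2 op"
    and \<alpha> :: "F4 \<Rightarrow> (2 \<times> (F4 \<Rightarrow>\<^sub>0 pauli)) op \<Rightarrow> (2 \<times> (F4 \<Rightarrow>\<^sub>0 pauli)) op"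
  assumes "vn_action M2 \<beta>"
    and "\<forall>i. \<forall>x\<in>M2. \<beta> (free_gen i) x = Ad (mat_op (v_mat i)) x"
    and "vn_action M_alg \<alpha>"
    and "\<forall>g. \<forall>x\<in>M2. \<forall>y\<in>R_alg. \<alpha> g (x \<otimes>\<^sub>o y) = \<beta> g x \<otimes>\<^sub>o bernoulli g y"
  shows "singular LG (crossed_product M_alg \<alpha>) \<and>
         LG \<subset> vn_generated (quasinormalizers LG (crossed_product M_alg \<alpha>))"
proof -
  interpret free_group_action \<beta> \<alpha>
    by unfold_locales (use assms in blast)+
  have "singular LG P"
    using LG_subset_P normalizer_in_LG by (auto simp: singular_def)
  moreover have "quasinormalizers LG P \<subseteq> vn_generated (quasinormalizers LG P)"
    by (rule vn_generated_superset) (auto simp: quasinormalizers_def intro: P_bounded)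
  then have "LG \<subset> vn_generated (quasinormalizers LG P)"
    using LG_subset_quasinormalizers E_quasinormalizer E_not_in_LG by blast
  ultimately show ?thesis ..
qed

end
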